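(* Let $q$ be a prime power and let $\mathcal{H}$ be the Hermitian curve over $\mathbb{F}_{q^2}$. Let $T_1=\{P,Q,R\}$ be a collinear triangle, i.e., a set of three distinct $\mathbb{F}_{q^2}$-rational points of $\mathcal{H}$ lying on a line in $\mathbb{P}^2$. Then the cardinality $N(T_1)$ of its Weierstrass gap set is $$\#G(P,Q,R)=N(T_1)=\frac{1}{24}\left(2q^6-6q^5+9q^4+12q^3-35q^2+18q\right).$$
   Context: $\mathbb{N}$ denotes the nonnegative integers. The Hermitian curve $\mathcal{H}$ over $\mathbb{F}_{q^2}$ is the smooth projective plane curve $X^{q+1}-Y^qZ-YZ^q=0$. For distinct rational points $P,Q,R$, the Weierstrass semigroup is $H(P,Q,R)=\{(a,b,c)\in\mathbb{N}^3 : aP+bQ+cR=(f)_\infty\text{ for some }f\in\mathbb{F}_{q^2}(\mathcal{H})\}$, where $(f)_\infty$ is the pole divisor, and the Weierstrass gap set is $G(P,Q,R)=\mathbb{N}^3\setminus H(P,Q,R)$. *)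

theory Defs
  imports
    "HOL-Algebra.Algebraic_Closure_Type"
    "HOL-Algebra.Ideal"
    "HOL-Library.Cardinality"
    "HOL-Number_Theory.Prime_Powers"
begin

text \<open>
  Ternary polynomials form the iterated polynomial ring \<open>K[X][Y][Z]\<close>: the coefficient of
  \<open>X\<^sup>i Y\<^sup>j Z\<^sup>k\<close> in \<open>p\<close> is \<open>coeff (coeff (coeff p k) j) i\<close>.
\<close>

type_synonym 'a poly3 = "'a poly poly poly"

definition var_X :: "'a :: comm_ring_1 poly3" where
  "var_X = [:[:[:0, 1:]:]:]"

definition var_Y :: "'a :: comm_ring_1 poly3" where
  "var_Y = [:[:0, 1:]:]"

definition var_Z :: "'a :: comm_ring_1 poly3" where
  "var_Z = [:0, 1:]"

definition eval3 :: "'a :: comm_ring_1 poly3 \<Rightarrow> 'a \<times> 'a \<times> 'a \<Rightarrow> 'a" where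
  "eval3 p = (\<lambda>(x, y, z). poly (poly (poly p [:[:z:]:]) [:y:]) x)"

definition map_poly3 :: "('a :: comm_ring_1 \<Rightarrow> 'b :: comm_ring_1) \<Rightarrow> 'a poly3 \<Rightarrow> 'b poly3" where
  "map_poly3 h = map_poly (map_poly (map_poly h))"

definition is_form :: "nat \<Rightarrow> 'a :: comm_ring_1 poly3 \<Rightarrow> bool" where
  "is_form d p \<longleftrightarrow>
     (\<forall>i j k. Polynomial.coeff (Polynomial.coeff (Polynomial.coeff p k) j) i \<noteq> 0 \<longrightarrow> i + j + k = d)"


text \<open>
  A point of the projective plane is the set of all its (nonzero) homogeneous coordinate vectors.
\<close>

type_synonym 'a proj_pt = "('a \<times> 'a \<times> 'a) set"

definition proj_point :: "'a :: field \<times> 'a \<times> 'a \<Rightarrow> 'a proj_pt" where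
  "proj_point = (\<lambda>(x, y, z). {(c * x, c * y, c * z) | c. c \<noteq> 0})"

definition proj_plane :: "'a :: field proj_pt set" where
  "proj_plane = {proj_point v | v. v \<noteq> (0, 0, 0)}"

definition collinear_points :: "'a :: field proj_pt set \<Rightarrow> bool" where
  "collinear_points T \<longleftrightarrow>
     (\<exists>\<alpha> \<beta> \<gamma>. (\<alpha>, \<beta>, \<gamma>) \<noteq> (0, 0, 0) \<and>
        (\<forall>S\<in>T. \<forall>(x, y, z)\<in>S. \<alpha> * x + \<beta> * y + \<gamma> * z = 0))"

definition curve_points :: "'a :: field poly3 \<Rightarrow> 'a proj_pt set" where
  "curve_points F = {S \<in> proj_plane. \<forall>v\<in>S. eval3 F v = 0}"


text \<open>
  The function field of the integral plane curve \<open>F = 0\<close>: its elements are classes of quotients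
  \<open>G / H\<close> of forms of equal degree with \<open>H\<close> not divisible by \<open>F\<close>, where \<open>G / H\<close> and
  \<open>G' / H'\<close> are identified if \<open>F\<close> divides \<open>G H' - G' H\<close>.
\<close>

definition fractions :: "'a :: field poly3 \<Rightarrow> ('a poly3 \<times> 'a poly3) set" where
  "fractions F = {(G, H). (\<exists>d. is_form d G \<and> is_form d H) \<and> \<not> F dvd H}"

definition frac_rel :: "'a :: field poly3 \<Rightarrow> (('a poly3 \<times> 'a poly3) \<times> ('a poly3 \<times> 'a poly3)) set" where
  "frac_rel F = {((G, H), (G', H')).
     (G, H) \<in> fractions F \<and> (G', H') \<in> fractions F \<and> F dvd (G * H' - G' * H)}"

type_synonym 'a rat_fun = "('a poly3 \<times> 'a poly3) set"

definition frac_class :: "'a :: field poly3 \<Rightarrow> 'a poly3 \<times> 'a poly3 \<Rightarrow> 'a rat_fun" where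
  "frac_class F r = frac_rel F `` {r}"

definition function_field :: "'a :: field poly3 \<Rightarrow> 'a rat_fun ring" where
  "function_field F = \<lparr>
     carrier = fractions F // frac_rel F,
     monoid.mult = (\<lambda>A B. \<Union>(G, H)\<in>A. \<Union>(G', H')\<in>B. frac_class F (G * G', H * H')),
     one = frac_class F (1, 1),
     ring.zero = frac_class F (0, 1),
     add = (\<lambda>A B. \<Union>(G, H)\<in>A. \<Union>(G', H')\<in>B. frac_class F (G * H' + G' * H, H * H'))\<rparr>"

definition regular_at :: "'a :: field poly3 \<Rightarrow> 'a proj_pt \<Rightarrow> 'a rat_fun set" where
  "regular_at F S =
     {f \<in> carrier (function_field F). \<exists>(G, H)\<in>f. \<forall>v\<in>S. eval3 H v \<noteq> 0}"

definition local_ring :: "'a :: field poly3 \<Rightarrow> 'a proj_pt \<Rightarrow> 'a rat_fun ring" where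
  "local_ring F S = (function_field F)\<lparr>carrier := regular_at F S\<rparr>"

definition max_ideal_at :: "'a :: field poly3 \<Rightarrow> 'a proj_pt \<Rightarrow> 'a rat_fun set" where
  "max_ideal_at F S =
     {f \<in> carrier (function_field F). \<exists>(G, H)\<in>f. \<forall>v\<in>S. eval3 H v \<noteq> 0 \<and> eval3 G v = 0}"

definition uniformizer :: "'a :: field poly3 \<Rightarrow> 'a proj_pt \<Rightarrow> 'a rat_fun \<Rightarrow> bool" where
  "uniformizer F S t \<longleftrightarrow>
     t \<in> regular_at F S \<and> cgenideal (local_ring F S) t = max_ideal_at F S"

text \<open>
  At a smooth point \<open>S\<close> the local ring is a discrete valuation ring; a function \<open>f\<close> outside of it
  has a pole of order \<open>n\<close> if \<open>t\<^sup>n f\<close> is a unit of the local ring for a uniformizer \<open>t\<close>.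
\<close>

definition pole_order :: "'a :: field poly3 \<Rightarrow> 'a rat_fun \<Rightarrow> 'a proj_pt \<Rightarrow> nat" where
  "pole_order F f S =
     (if f \<in> regular_at F S then 0
      else (THE n. \<exists>t. uniformizer F S t \<and>
              (t [^]\<^bsub>function_field F\<^esub> n) \<otimes>\<^bsub>function_field F\<^esub> f \<in> Units (local_ring F S)))"

text \<open>
  Effective divisors are multiplicity functions on the points of the curve, extended by \<open>0\<close>.
\<close>

type_synonym 'a divisor = "'a proj_pt \<Rightarrow> nat"

definition pole_divisor :: "'a :: field poly3 \<Rightarrow> 'a rat_fun \<Rightarrow> 'a divisor" where
  "pole_divisor F f = (\<lambda>S. if S \<in> curve_points F then pole_order F f S else 0)"

definition point_divisor :: "'a proj_pt \<Rightarrow> 'a divisor" where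
  "point_divisor P = (\<lambda>S. of_bool (S = P))"


text \<open>
  A curve \<open>F = 0\<close> over a field \<open>k\<close> is studied through its points over the algebraic closure of
  \<open>k\<close>, so that divisors are supported on geometric points and a pole at a non-rational closed
  point is a pole at each of its conjugates.  The function field over \<open>k\<close> consists of the functions
  that are quotients of forms with coefficients in \<open>k\<close>.
\<close>

abbreviation geom :: "'a :: field poly3 \<Rightarrow> 'a alg_closure poly3" where
  "geom \<equiv> map_poly3 to_ac"

definition rational_points :: "'a :: field poly3 \<Rightarrow> 'a alg_closure proj_pt set" where
  "rational_points F =
     {S \<in> curve_points (geom F). \<exists>x y z. S = proj_point (to_ac x, to_ac y, to_ac z)}"

definition rational_functions :: "'a :: field poly3 \<Rightarrow> 'a alg_closure rat_fun set" where
  "rational_functions F =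
     {frac_class (geom F) (geom G, geom H) | G H. (geom G, geom H) \<in> fractions (geom F)}"

definition weierstrass_semigroup ::
  "'a :: field poly3 \<Rightarrow> 'a alg_closure proj_pt \<Rightarrow> 'a alg_closure proj_pt \<Rightarrow> 'a alg_closure proj_pt \<Rightarrow>
     (nat \<times> nat \<times> nat) set" where
  "weierstrass_semigroup F P Q R =
     {(a, b, c). \<exists>f\<in>rational_functions F.
        (\<lambda>S. a * point_divisor P S + b * point_divisor Q S + c * point_divisor R S) =
        pole_divisor (geom F) f}"

definition weierstrass_gaps ::
  "'a :: field poly3 \<Rightarrow> 'a alg_closure proj_pt \<Rightarrow> 'a alg_closure proj_pt \<Rightarrow> 'a alg_closure proj_pt \<Rightarrow>
     (nat \<times> nat \<times> nat) set" where
  "weierstrass_gaps F P Q R = UNIV - weierstrass_semigroup F P Q R"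


definition hermitian :: "nat \<Rightarrow> 'a :: field poly3" where
  "hermitian q = var_X ^ (q + 1) - var_Y ^ q * var_Z - var_Y * var_Z ^ q"

end

theory Submission
  imports Defs "HOL-Computational_Algebra.Formal_Laurent_Series" "HOL-Number_Theory.Residues"
begin

text \<open>
  Put \<open>n = q + 1\<close>. The tangent at a rational point \<open>P\<close> meets the curve only in \<open>P\<close>, with
  multiplicity \<open>n\<close>, and the line through \<open>P\<close>, \<open>Q\<close>, \<open>R\<close> meets it transversally in each of them.
  Quotients of products of these four linear forms provide a function with poles bounded by
  \<open>a P + b Q + c R\<close> and of order exactly \<open>a\<close> at \<open>P\<close> as soon as
  \<open>j \<le> (a + j) div n + (b + j) div n + (c + j) div n\<close> for the residue \<open>j < n\<close> of \<open>- a\<close>.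
  If this inequality fails, there is a product of the four forms of degree \<open>q - 2\<close>, that is, a
  regular differential, whose product with such a function has a single simple pole; this is
  excluded by an elementary residue theorem that rests on \<open>K[X, Y] / (Y\<^sup>q + Y - X\<^sup>q\<^sup>+\<^sup>1)\<close> being
  integrally closed, with the powers of \<open>Y\<close> having pole orders distinct modulo \<open>q\<close> at infinity. As
  the field has at least four elements, functions attaining the three pole orders can be combined,
  so the semigroup is described by the three inequalities. Writing the pole orders as \<open>n A - i\<close>,
  \<open>n B - j\<close>, \<open>n C - k\<close>, the gaps are the triples for which one of \<open>i\<close>, \<open>j\<close>, \<open>k\<close> exceeds
  \<open>T = A + B + C\<close>, or these three residues are \<open>T\<close>, \<open>T\<close>, \<open>T - 1\<close> in some order.
\<close>

section \<open>Evaluation of ternary forms\<close>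

text \<open>The definitions speak of local rings, uniformizers and classes of fractions over the
  algebraic closure. The proof translates all of them into power series: an explicit branch passes
  through every geometric point, and a form is divisible by \<open>F\<close> as soon as its
  expansion along one branch vanishes. So the function field embeds into the Laurent series at each
  point, and pole orders are orders of series. The inequality for \<open>j\<close> is a count of
  degrees. A power of the tangent in the denominator gives a pole of order divisible by
  \<open>n\<close>; lowering it by \<open>j\<close> costs \<open>j\<close> factors of the line in
  the numerator, and numerator and denominator must have equal degree. Conversely,
  \<open>q - 2\<close> is the degree \<open>q + 1\<close> of the plane curve minus 3, at which forms
  cut out canonical divisors; a failing inequality is exactly the room for such a form to cancel all
  poles but one. All geometric points have to be considered, not only the rational ones, because the
  pole divisor must vanish at every other point.\<close>

definition rhom :: "('a :: comm_ring_1 \<Rightarrow> 'b :: comm_ring_1) \<Rightarrow> bool" where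
  "rhom h \<longleftrightarrow> h 1 = 1 \<and> (\<forall>x y. h (x + y) = h x + h y) \<and> (\<forall>x y. h (x * y) = h x * h y)"

lemma rhom_1: "rhom h \<Longrightarrow> h 1 = 1"
  and rhom_add: "rhom h \<Longrightarrow> h (x + y) = h x + h y"
  and rhom_mult: "rhom h \<Longrightarrow> h (x * y) = h x * h y"
  by (simp_all add: rhom_def)

lemma rhom_0: "rhom h \<Longrightarrow> h 0 = 0"
  using rhom_add[of h 0 0] by simp

lemma rhom_minus: "rhom h \<Longrightarrow> h (- x) = - h x"
  using rhom_add[of h x "- x"] rhom_0[of h] by (simp add: eq_neg_iff_add_eq_0 add.commute)

lemma rhom_diff: "rhom h \<Longrightarrow> h (x - y) = h x - h y"
  using rhom_add[of h x "- y"] rhom_minus[of h y] by simp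

lemma rhom_power: "rhom h \<Longrightarrow> h (x ^ n) = h x ^ n"
  by (induction n) (simp_all add: rhom_1 rhom_mult)

lemma rhom_sum: "rhom h \<Longrightarrow> h (sum g A) = (\<Sum>x\<in>A. h (g x))"
  by (induction A rule: infinite_finite_induct) (simp_all add: rhom_0 rhom_add)

lemma rhom_prod: "rhom h \<Longrightarrow> h (prod g A) = (\<Prod>x\<in>A. h (g x))"
  by (induction A rule: infinite_finite_induct) (simp_all add: rhom_1 rhom_mult)

lemma rhom_of_nat: "rhom h \<Longrightarrow> h (of_nat n) = of_nat n"
  by (induction n) (simp_all add: rhom_0 rhom_1 rhom_add)

lemmas rhom_simps = rhom_0 rhom_1 rhom_add rhom_mult rhom_minus rhom_diff rhom_power rhom_sum rhom_prod

lemma rhom_comp: "rhom h \<Longrightarrow> rhom g \<Longrightarrow> rhom (\<lambda>x. g (h x))"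
  by (simp add: rhom_def)

lemma rhom_dvd: "rhom h \<Longrightarrow> a dvd b \<Longrightarrow> h a dvd h b"
  by (auto simp: rhom_mult elim!: dvdE)

lemma rhom_const: "rhom (\<lambda>c. [:c:])"
  by (simp add: rhom_def one_pCons)

lemma rhom_fps_const: "rhom fps_const"
  by (simp add: rhom_def)

lemma rhom_fps_nth: "rhom (\<lambda>f. fps_nth f 0)"
  by (simp add: rhom_def)

lemma rhom_fps_to_fls: "rhom fps_to_fls"
  by (simp add: rhom_def fls_times_fps_to_fls)

lemma rhom_to_ac: "rhom to_ac"
  by (simp add: rhom_def)

text \<open>Carries the additivity of \<open>x ^ q\<close> from the field over to its polynomials
  and power series, into which it embeds by constants.\<close>

lemma rhom_CHAR:
  fixes h :: "'a :: comm_ring_1 \<Rightarrow> 'b :: comm_ring_1"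
  assumes "rhom h" "\<And>x. h x = 0 \<Longrightarrow> x = 0"
  shows "CHAR('b) = CHAR('a)"
  by (rule CHAR_eqI)
    (use assms rhom_of_nat[OF assms(1)] rhom_0[OF assms(1)] in \<open>metis of_nat_CHAR of_nat_eq_0_iff_char_dvd\<close>)+

definition eval_hom :: "('a :: comm_ring_1 \<Rightarrow> 'b :: comm_ring_1) \<Rightarrow> 'b \<Rightarrow> 'a Polynomial.poly \<Rightarrow> 'b" where
  "eval_hom h x p = poly (map_poly h p) x"

lemma eval_hom_0: "eval_hom h x 0 = 0"
  by (simp add: eval_hom_def)

lemma eval_hom_pCons: "rhom h \<Longrightarrow> eval_hom h x (pCons a p) = h a + x * eval_hom h x p"
  by (cases "p = 0 \<and> a = 0") (auto simp: eval_hom_def rhom_0 map_poly_pCons)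

lemma eval_hom_add: "rhom h \<Longrightarrow> eval_hom h x (p + r) = eval_hom h x p + eval_hom h x r"
proof -
  assume h: "rhom h"
  have "map_poly h (p + r) = map_poly h p + map_poly h r"
    by (rule poly_eqI) (simp add: coeff_map_poly rhom_0[OF h] rhom_add[OF h])
  then show ?thesis by (simp add: eval_hom_def)
qed

lemma eval_hom_smult: "rhom h \<Longrightarrow> eval_hom h x (Polynomial.smult c p) = h c * eval_hom h x p"
  by (induction p) (simp_all add: eval_hom_0 eval_hom_pCons rhom_mult algebra_simps)

lemma rhom_eval_hom:
  assumes h: "rhom h"
  shows "rhom (eval_hom h x)"
proof -
  have "eval_hom h x (p * r) = eval_hom h x p * eval_hom h x r" for p r
  proof (induction p)
    case (pCons a p)
    then show ?case
      by (simp add: eval_hom_pCons[OF h] eval_hom_add[OF h] eval_hom_smult[OF h] rhom_0[OF h] algebra_simps)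
  qed (simp add: eval_hom_0)
  moreover have "eval_hom h x 1 = 1"
    by (simp add: one_pCons eval_hom_pCons[OF h] eval_hom_0 rhom_1[OF h])
  ultimately show ?thesis
    by (simp add: rhom_def eval_hom_add[OF h])
qed

lemma eval_hom_const: "rhom h \<Longrightarrow> eval_hom h x [:c:] = h c"
  by (simp add: eval_hom_pCons eval_hom_0)

lemma eval_hom_monom: "rhom h \<Longrightarrow> eval_hom h x (Polynomial.monom c n) = h c * x ^ n"
  by (simp add: eval_hom_def map_poly_monom rhom_0 poly_monom)

lemma eval_hom_as_sum: "rhom h \<Longrightarrow> eval_hom h x p = (\<Sum>i\<le>Polynomial.degree p. h (Polynomial.coeff p i) * x ^ i)"
  by (subst (1) poly_as_sum_of_monoms[symmetric])
     (simp add: rhom_sum[OF rhom_eval_hom] eval_hom_monom)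

definition eval_hom3 :: "('a :: comm_ring_1 \<Rightarrow> 'b :: comm_ring_1) \<Rightarrow> 'b \<times> 'b \<times> 'b \<Rightarrow> 'a poly3 \<Rightarrow> 'b" where
  "eval_hom3 h = (\<lambda>(x, y, z). eval_hom (eval_hom (eval_hom h x) y) z)"

lemma rhom_eval_hom3: "rhom h \<Longrightarrow> rhom (eval_hom3 h v)"
  by (cases v) (simp add: eval_hom3_def rhom_eval_hom)

definition monom3 :: "'a :: comm_ring_1 \<Rightarrow> nat \<Rightarrow> nat \<Rightarrow> nat \<Rightarrow> 'a poly3" where
  "monom3 c i j k = Polynomial.monom (Polynomial.monom (Polynomial.monom c i) j) k"

lemma eval_hom3_monom3: "rhom h \<Longrightarrow> eval_hom3 h (x, y, z) (monom3 c i j k) = h c * x ^ i * y ^ j * z ^ k"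
  by (simp add: eval_hom3_def monom3_def eval_hom_monom rhom_eval_hom)

lemma coeff_monom3: "Polynomial.coeff (Polynomial.coeff (Polynomial.coeff (monom3 c i j k) k') j') i' =
    (if i = i' \<and> j = j' \<and> k = k' then c else 0)"
  by (auto simp: monom3_def)

lemma monom3_sum: 
  "(\<Sum>k\<le>Polynomial.degree p. \<Sum>j\<le>Polynomial.degree (Polynomial.coeff p k).
     \<Sum>i\<le>Polynomial.degree (Polynomial.coeff (Polynomial.coeff p k) j).
       monom3 (Polynomial.coeff (Polynomial.coeff (Polynomial.coeff p k) j) i) i j k) = p"
  unfolding monom3_def by (simp add: poly_as_sum_of_monoms flip: Polynomial.monom_sum)

text \<open>The monomial case concerns only the coefficients of the given \<open>p\<close>; for a
  form these vanish outside its degree, which is what \<open>form_induct\<close> exploits.\<close>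

lemma poly3_induct [case_names add monom3]:
  assumes add: "\<And>p r. P p \<Longrightarrow> P r \<Longrightarrow> P (p + r)"
    and monom3: "\<And>i j k. P (monom3 (Polynomial.coeff (Polynomial.coeff (Polynomial.coeff p k) j) i) i j k)"
    and zero: "P 0"
  shows "P p"
proof -
  have s: "(\<And>x. x \<in> A \<Longrightarrow> P (g x)) \<Longrightarrow> P (sum g A)" for A :: "nat set" and g
    by (induction A rule: infinite_finite_induct) (auto intro: add zero)
  have "P (\<Sum>k\<le>Polynomial.degree p. \<Sum>j\<le>Polynomial.degree (Polynomial.coeff p k).
     \<Sum>i\<le>Polynomial.degree (Polynomial.coeff (Polynomial.coeff p k) j).
       monom3 (Polynomial.coeff (Polynomial.coeff (Polynomial.coeff p k) j) i) i j k)"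
    by (intro s monom3)
  then show ?thesis by (simp only: monom3_sum)
qed

lemma rhom_eq_poly3:
  assumes "rhom h" "rhom g" "\<And>c i j k. h (monom3 c i j k) = g (monom3 c i j k)"
  shows "h p = g p"
  by (induction p rule: poly3_induct) (simp_all add: assms rhom_add rhom_0)


lemma monom3_0 [simp]: "monom3 0 i j k = 0"
  by (simp add: monom3_def)

lemma monom3_add: "monom3 (c + d) i j k = monom3 c i j k + monom3 d i j k"
  by (simp add: monom3_def add_monom)

lemma monom3_mult: "monom3 c i j k * monom3 d i' j' k' = monom3 (c * d) (i + i') (j + j') (k + k')"
  by (simp add: monom3_def mult_monom)

lemma var_eq_monom3: "var_X = monom3 1 1 0 0" "var_Y = monom3 1 0 1 0" "var_Z = monom3 1 0 0 1"
  by (simp_all add: var_X_def var_Y_def var_Z_def monom3_def monom_altdef flip: one_pCons)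

section \<open>Homogeneous forms\<close>

lemma is_form_0 [simp]: "is_form d 0"
  by (simp add: is_form_def)

lemma is_form_monom3 [simp]: "i + j + k = d \<Longrightarrow> is_form d (monom3 c i j k)"
  by (auto simp: is_form_def coeff_monom3 split: if_splits)

lemma is_form_add: "is_form d p \<Longrightarrow> is_form d r \<Longrightarrow> is_form d (p + r)"
  by (auto simp: is_form_def) (metis add.right_neutral)

lemma is_form_uminus: "is_form d p \<Longrightarrow> is_form d (- p)"
  by (simp add: is_form_def)

lemma is_form_diff: "is_form d p \<Longrightarrow> is_form d r \<Longrightarrow> is_form d (p - r)"
  using is_form_add[of d p "- r"] is_form_uminus[of d r] by simp

lemma is_form_sum: "(\<And>x. x \<in> A \<Longrightarrow> is_form d (g x)) \<Longrightarrow> is_form d (sum g A)"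
  by (induction A rule: infinite_finite_induct) (auto intro: is_form_add)

lemma form_induct [consumes 1, case_names zero add monom3]:
  assumes "is_form d p" "P 0"
    and "\<And>p r. is_form d p \<Longrightarrow> is_form d r \<Longrightarrow> P p \<Longrightarrow> P r \<Longrightarrow> P (p + r)"
    and "\<And>c i j k. i + j + k = d \<Longrightarrow> P (monom3 c i j k)"
  shows "P p"
proof -
  have "is_form d p \<and> P p"
  proof (induction p rule: poly3_induct)
    case (monom3 i j k)
    let ?c = "Polynomial.coeff (Polynomial.coeff (Polynomial.coeff p k) j) i"
    show ?case
    proof (cases "?c = 0")
      case False
      with assms(1) have "i + j + k = d" by (simp add: is_form_def)
      then show ?thesis using assms(4) by simp
    qed (simp add: assms(2))
  qed (auto intro: assms is_form_add)
  then show ?thesis by simp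
qed

lemma is_form_mult:
  assumes "is_form d p" "is_form e r"
  shows "is_form (d + e) (p * r)"
  using assms(1)
proof (induction p rule: form_induct)
  case (monom3 c i j k)
  from assms(2) show ?case
    by (induction r rule: form_induct)
       (use monom3 in \<open>auto simp: distrib_left monom3_mult intro: is_form_add\<close>)
qed (auto simp: distrib_right intro: is_form_add)

lemma is_form_1: "is_form 0 1"
  using is_form_monom3[of 0 0 0 0 1] by (simp add: monom3_def flip: one_pCons)

lemma is_form_power: "is_form d p \<Longrightarrow> is_form (n * d) (p ^ n)"
  by (induction n) (auto simp: is_form_1 intro: is_form_mult)

lemma is_form_power1: "is_form 1 p \<Longrightarrow> is_form n (p ^ n)"
  using is_form_power[of 1 p n] by simp

lemma is_form_var [simp]: "is_form 1 var_X" "is_form 1 var_Y" "is_form 1 var_Z"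
  by (simp_all add: var_eq_monom3)

lemmas is_form_var_Suc [simp] = is_form_var[unfolded One_nat_def]

definition const3 :: "'a :: comm_ring_1 \<Rightarrow> 'a poly3" where
  "const3 c = monom3 c 0 0 0"

lemma rhom_const3: "rhom const3"
  by (simp add: rhom_def const3_def monom3_add monom3_mult) (simp add: monom3_def flip: one_pCons)

lemma is_form_const3 [simp]: "is_form 0 (const3 c)"
  by (simp add: const3_def)

lemma eval_hom3_var:
  assumes "rhom h"
  shows "eval_hom3 h (x, y, z) var_X = x" "eval_hom3 h (x, y, z) var_Y = y" "eval_hom3 h (x, y, z) var_Z = z"
    and eval_hom3_const3: "eval_hom3 h (x, y, z) (const3 c) = h c"
  using assms by (simp_all add: var_eq_monom3 eval_hom3_monom3 rhom_1 const3_def)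

lemma eval_hom3_scale:
  assumes "rhom h" "is_form d p"
  shows "eval_hom3 h (c * x, c * y, c * z) p = c ^ d * eval_hom3 h (x, y, z) p"
  using assms(2)
proof (induction p rule: form_induct)
  case (monom3 a i j k)
  then show ?case
    by (simp add: eval_hom3_monom3 assms(1) power_mult_distrib power_add[symmetric] flip: monom3)
       (simp add: power_add algebra_simps)
qed (simp_all add: rhom_simps rhom_eval_hom3 assms(1) distrib_left)

lemma rhom_eval3: "rhom (\<lambda>p. eval3 p v)"
  by (cases v) (simp add: eval3_def rhom_def)

lemma eval3_monom3: "eval3 (monom3 c i j k) (x, y, z) = c * x ^ i * y ^ j * z ^ k"
  by (simp add: eval3_def monom3_def poly_monom poly_const_pow algebra_simps)

lemma rhom_id: "rhom (\<lambda>x. x)"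
  by (simp add: rhom_def)

lemma eval3_eq_eval_hom3: "eval3 p v = eval_hom3 (\<lambda>x. x) v p"
  by (cases v, rule rhom_eq_poly3[of "\<lambda>p. eval3 p v" "eval_hom3 (\<lambda>x. x) v"])
     (simp_all add: rhom_eval3 rhom_eval_hom3 rhom_id eval3_monom3 eval_hom3_monom3)

lemma map_poly_eq_eval_hom: "rhom h \<Longrightarrow> map_poly h p = eval_hom (\<lambda>c. [:h c:]) [:0, 1:] p"
  by (induction p)
     (auto simp: eval_hom_0 eval_hom_pCons rhom_comp[OF _ rhom_const] map_poly_pCons rhom_0)

lemma rhom_map_poly: "rhom h \<Longrightarrow> rhom (map_poly h)"
  using rhom_eval_hom[OF rhom_comp[OF _ rhom_const], of h "[:0, 1:]"]
  by (simp add: rhom_def map_poly_eq_eval_hom)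

lemma rhom_map_poly3: "rhom h \<Longrightarrow> rhom (map_poly3 h)"
  by (simp add: map_poly3_def rhom_map_poly)

lemma map_poly3_monom3: "rhom h \<Longrightarrow> map_poly3 h (monom3 c i j k) = monom3 (h c) i j k"
  by (simp add: map_poly3_def monom3_def map_poly_monom rhom_0)

lemma map_poly3_const3: "rhom h \<Longrightarrow> map_poly3 h (const3 c) = const3 (h c)"
  by (simp add: const3_def map_poly3_monom3)

lemma map_poly3_var: "rhom h \<Longrightarrow> map_poly3 h var_X = var_X"
  "rhom h \<Longrightarrow> map_poly3 h var_Y = var_Y" "rhom h \<Longrightarrow> map_poly3 h var_Z = var_Z"
  by (simp_all add: var_eq_monom3 map_poly3_monom3 rhom_1)

lemma eval_hom3_comp:
  assumes "rhom h" "rhom g"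
  shows "g (eval_hom3 h (x, y, z) p) = eval_hom3 (\<lambda>c. g (h c)) (g x, g y, g z) p"
  by (rule rhom_eq_poly3[of "\<lambda>p. g (eval_hom3 h (x, y, z) p)"])
     (simp_all add: rhom_comp rhom_eval_hom3 assms eval_hom3_monom3 rhom_mult rhom_power)

section \<open>Dehomogenization at Z = 1\<close>

definition dehom :: "'a :: comm_ring_1 poly3 \<Rightarrow> 'a Polynomial.poly Polynomial.poly" where
  "dehom p = poly p 1"

lemma rhom_dehom: "rhom dehom"
  by (simp add: rhom_def dehom_def)

abbreviation eval_hom2 :: "('a :: comm_ring_1 \<Rightarrow> 'b :: comm_ring_1) \<Rightarrow> 'b \<Rightarrow> 'b \<Rightarrow>
    'a Polynomial.poly Polynomial.poly \<Rightarrow> 'b" where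
  "eval_hom2 h x y \<equiv> eval_hom (eval_hom h x) y"

lemma dehom_monom3: "dehom (monom3 c i j k) = Polynomial.monom (Polynomial.monom c i) j"
  by (simp add: dehom_def monom3_def poly_monom)

lemma eval_hom3_dehom:
  assumes "rhom h"
  shows "eval_hom3 h (x, y, 1) p = eval_hom2 h x y (dehom p)"
  by (rule rhom_eq_poly3[of "eval_hom3 h (x, y, 1)"])
     (simp_all add: rhom_comp[OF rhom_dehom] rhom_eval_hom3 rhom_eval_hom assms eval_hom3_monom3 dehom_monom3 eval_hom_monom)

lemma coeff_dehom:
  assumes "is_form d p" "i + j \<le> d"
  shows "Polynomial.coeff (Polynomial.coeff (dehom p) j) i =
    Polynomial.coeff (Polynomial.coeff (Polynomial.coeff p (d - i - j)) j) i"
  using assms(1)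
proof (induction p rule: form_induct)
  case (monom3 c i' j' k')
  then show ?case using assms(2) by (auto simp: dehom_monom3 coeff_monom3)
qed (simp_all add: rhom_simps rhom_dehom)

text \<open>In a form of known degree the exponent of \<open>Z\<close> is determined by the other
  two, so no coefficients merge when \<open>Z\<close> becomes 1.\<close>

lemma dehom_inj:
  assumes "is_form d p" "dehom p = 0"
  shows "p = 0"
proof (intro poly_eqI)
  fix k j i
  show "Polynomial.coeff (Polynomial.coeff (Polynomial.coeff p k) j) i =
     Polynomial.coeff (Polynomial.coeff (Polynomial.coeff 0 k) j) i"
  proof (cases "i + j + k = d")
    case True
    then have "d - i - j = k" "i + j \<le> d" by auto
    then show ?thesis using coeff_dehom[OF assms(1), of i j] assms(2) by simp
  next
    case False
    then show ?thesis using assms(1) by (auto simp: is_form_def)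
  qed
qed

lemma dehom_var [simp]: "dehom var_X = [:[:0, 1:]:]" "dehom var_Y = [:0, 1:]" "dehom var_Z = 1"
  by (simp_all add: dehom_def var_X_def var_Y_def var_Z_def one_pCons)

text \<open>The degree is left open because summands are brought to a common degree by multiplying
  each with a power of \<open>Z\<close>, which may overshoot the degree of \<open>g\<close>.\<close>

lemma dehom_surj: "\<exists>d p. is_form d p \<and> dehom p = g"
proof -
  have *: "\<exists>d p. is_form d p \<and> dehom p = sum g A"
    if "finite A" "\<And>x. x \<in> A \<Longrightarrow> \<exists>d p. is_form d p \<and> dehom p = g x"
    for A :: "nat set" and g :: "nat \<Rightarrow> 'a Polynomial.poly Polynomial.poly"
    using that
  proof (induction A rule: finite_induct)
    case empty
    show ?case by (auto intro!: exI[of _ 0] simp: rhom_0[OF rhom_dehom])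
  next
    case (insert x A)
    then obtain d p e r where "is_form d p" "dehom p = g x" "is_form e r" "dehom r = sum g A"
      by (metis insertCI)
    moreover from this have "is_form (d + e) (p * var_Z ^ e)" "is_form (d + e) (var_Z ^ d * r)"
      by (auto intro!: is_form_mult is_form_power1)
    ultimately show ?case using insert(1,2)
      by (intro exI[of _ "d + e"] exI[of _ "p * var_Z ^ e + var_Z ^ d * r"])
         (auto simp: rhom_simps rhom_dehom intro: is_form_add)
  qed
  have "\<exists>d p. is_form d p \<and> dehom p = (\<Sum>j\<le>Polynomial.degree g. \<Sum>i\<le>Polynomial.degree (Polynomial.coeff g j).
      Polynomial.monom (Polynomial.monom (Polynomial.coeff (Polynomial.coeff g j) i) i) j)"
    by (intro * exI[of _ "_ + _ + 0"] exI[of _ "monom3 _ _ _ 0"] conjI is_form_monom3)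
       (simp_all add: dehom_monom3)
  then show ?thesis
    by (simp add: poly_as_sum_of_monoms flip: Polynomial.monom_sum)
qed

section \<open>Expansions of functions at the points of the Hermitian curve\<close>

text \<open>Lowest terms of different orders cannot cancel. At infinity this is applied twice: to
  the powers of \<open>X\<close>, and to the powers of \<open>Y\<close>, whose terms are separated
  modulo \<open>q\<close>.\<close>

lemma fls_sum_distinct_subdegree:
  fixes g :: "'i \<Rightarrow> 'a :: field fls"
  assumes "finite I" "I \<noteq> {}" "\<And>i. i \<in> I \<Longrightarrow> g i \<noteq> 0"
    and "inj_on (\<lambda>i. fls_subdegree (g i)) I"
  shows "sum g I \<noteq> 0 \<and> (\<exists>i\<in>I. fls_subdegree (sum g I) = fls_subdegree (g i)) \<and>
    (\<forall>i\<in>I. fls_subdegree (sum g I) \<le> fls_subdegree (g i))"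
  using assms
proof (induction I rule: finite_ne_induct)
  case (insert x I)
  then obtain i where i: "sum g I \<noteq> 0" "i \<in> I" "fls_subdegree (sum g I) = fls_subdegree (g i)"
    "\<forall>j\<in>I. fls_subdegree (sum g I) \<le> fls_subdegree (g j)"
    by (metis (no_types, lifting) inj_on_insert insertCI)
  have ne: "fls_subdegree (g x) \<noteq> fls_subdegree (sum g I)"
    using insert i by (auto simp: inj_on_def)
  have gx: "g x \<noteq> 0" using insert by auto
  show ?case
  proof (cases "fls_subdegree (g x) < fls_subdegree (sum g I)")
    case True
    have "fls_subdegree (g x + sum g I) = fls_subdegree (g x)"
      by (rule fls_subdegree_add_eq1[OF gx True])
    moreover have "g x + sum g I \<noteq> 0"
      using True by (auto simp: add_eq_0_iff2)
    ultimately show ?thesis using insert True i(4) by force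
  next
    case False
    then have lt: "fls_subdegree (sum g I) < fls_subdegree (g x)" using ne by simp
    have "fls_subdegree (g x + sum g I) = fls_subdegree (sum g I)"
      by (rule fls_subdegree_add_eq2[OF i(1) lt])
    moreover have "g x + sum g I \<noteq> 0"
      using lt by (auto simp: add_eq_0_iff2)
    ultimately show ?thesis using insert lt i by force
  qed
qed auto

lemma rhom_fls_const: "rhom (fls_const :: 'a :: comm_ring_1 \<Rightarrow> _)"
  by (simp add: rhom_def fls_plus_const fls_const_mult_const)

text \<open>As \<open>x\<close> has a pole, its powers have distinct orders and the leading term has
  the largest pole.\<close>

lemma eval_hom_fls_subdegree:
  fixes c :: "'a :: field Polynomial.poly"
  assumes "c \<noteq> 0" "fls_subdegree x < 0"
  shows "eval_hom fls_const x c \<noteq> 0"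
    and "fls_subdegree (eval_hom fls_const x c) = int (Polynomial.degree c) * fls_subdegree x"
proof -
  define I where "I = {i. i \<le> Polynomial.degree c \<and> Polynomial.coeff c i \<noteq> 0}"
  define g where "g i = fls_const (Polynomial.coeff c i) * x ^ i" for i
  have x: "x \<noteq> 0" using assms(2) by auto
  have d: "Polynomial.degree c \<in> I" using assms(1) by (auto simp: I_def)
  have g0: "g i \<noteq> 0" and gs: "fls_subdegree (g i) = int i * fls_subdegree x" if "i \<in> I" for i
    using that x by (auto simp: g_def I_def fls_const_nonzero fls_subdegree_pow)
  have "eval_hom fls_const x c = sum g {..Polynomial.degree c}"
    by (simp add: eval_hom_as_sum rhom_fls_const g_def)
  also have "\<dots> = sum g I"
    by (rule sum.mono_neutral_right) (auto simp: I_def g_def)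
  finally have sum_I: "eval_hom fls_const x c = sum g I" .
  have fin: "finite I" by (simp add: I_def)
  have "inj_on (\<lambda>i. fls_subdegree (g i)) I"
    using assms(2) by (auto simp: inj_on_def gs)
  from fls_sum_distinct_subdegree[OF fin _ g0 this] d
  obtain i where i: "sum g I \<noteq> 0" "i \<in> I" "fls_subdegree (sum g I) = fls_subdegree (g i)"
    "\<forall>j\<in>I. fls_subdegree (sum g I) \<le> fls_subdegree (g j)" by blast
  then have "int i * fls_subdegree x \<le> int (Polynomial.degree c) * fls_subdegree x"
    using d gs by metis
  then have "i \<ge> Polynomial.degree c" using assms(2) by (simp add: mult_le_cancel_right)
  then have "i = Polynomial.degree c" using i(2) by (auto simp: I_def)
  then show "eval_hom fls_const x c \<noteq> 0"
    "fls_subdegree (eval_hom fls_const x c) = int (Polynomial.degree c) * fls_subdegree x"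
    using i sum_I gs by auto
qed

section \<open>The curve over an algebraically closed field\<close>

locale hermitian_curve =
  fixes q e :: nat and K :: "'k :: alg_closed_field itself"
  assumes prime_char: "prime CHAR('k)" and q_eq: "q = CHAR('k) ^ e" and e: "e > 0"
begin

lemma q2: "q \<ge> 2"
  using prime_char e prime_ge_2_nat[OF prime_char] self_le_power[of "CHAR('k)" e] by (simp add: q_eq)

lemma frob:
  fixes h :: "'k \<Rightarrow> 'b :: comm_ring_1"
  assumes "rhom h" "\<And>x. h x = 0 \<Longrightarrow> x = 0"
  shows "(x + y :: 'b) ^ q = x ^ q + y ^ q"
  by (rule freshmans_dream'[of _ e]) (use rhom_CHAR[OF assms] prime_char q_eq in auto)

lemma frob_k: "(x + y :: 'k) ^ q = x ^ q + y ^ q"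
  by (rule frob[OF rhom_id])

lemma frob_fps: "(x + y :: 'k fps) ^ q = x ^ q + y ^ q"
  by (rule frob[OF rhom_fps_const]) simp

lemma rhom_const2: "rhom (\<lambda>c. [:[:c:]:])"
  by (rule rhom_comp[OF rhom_const rhom_const])

lemma frob_poly2: "(x + y :: 'k Polynomial.poly Polynomial.poly) ^ q = x ^ q + y ^ q"
  by (rule frob[OF rhom_const2]) simp

lemma const3_eq_0: "const3 c = 0 \<longleftrightarrow> c = 0"
  by (simp add: const3_def monom3_def monom_eq_0_iff)

lemma frob_poly3: "(x + y :: 'k poly3) ^ q = x ^ q + y ^ q"
  by (rule frob[OF rhom_const3]) (simp add: const3_eq_0)

lemma minus_one_q: "(- 1 :: 'k) ^ q = - 1"
proof -
  have "(1 + (-1) :: 'k) ^ q = 1 ^ q + (-1) ^ q" by (rule frob_k)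
  then show ?thesis using q2 by (simp add: power_0_left eq_neg_iff_add_eq_0 add.commute)
qed

lemma frob_k_uminus: "(- x :: 'k) ^ q = - (x ^ q)"
  using power_mult_distrib[of "-1" x q] minus_one_q by simp

lemma frob_k_diff: "(x - y :: 'k) ^ q = x ^ q - y ^ q"
  using frob_k[of x "- y"] frob_k_uminus[of y] by simp

abbreviation F :: "'k poly3" where "F \<equiv> hermitian q"

lemma eval_hom3_F: "rhom h \<Longrightarrow> eval_hom3 h (x, y, z) F = x ^ (q + 1) - y ^ q * z - y * z ^ q"
  by (simp add: hermitian_def rhom_simps rhom_eval_hom3 eval_hom3_var)

lemma is_form_F: "is_form (q + 1) F"
  unfolding hermitian_def
  using is_form_mult[OF is_form_power1[of var_Y q] is_form_var(3)] 
    is_form_mult[OF is_form_var(2) is_form_power1[of var_Z q]]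
    is_form_power1[of var_X "q + 1"]
  by (intro is_form_diff) simp_all

text \<open>The sign is opposite to that of \<open>F\<close>, which makes the equation monic in
  \<open>Y\<close>, so that division with remainder creates no denominators.\<close>

definition f :: "'k Polynomial.poly Polynomial.poly" where
  "f = [:0, 1:] ^ q + [:0, 1:] - [:[:0, 1:] ^ (q + 1):]"

lemma dehom_F: "dehom F = - f"
  by (simp add: hermitian_def rhom_simps rhom_dehom f_def poly_const_pow del: power_Suc)

lemma f_monic: "Polynomial.degree f = q" "Polynomial.lead_coeff f = 1"
proof -
  have *: "f = Polynomial.monom 1 q + [:- ([:0, 1:] ^ (q + 1)), 1:]"
    by (simp add: f_def monom_altdef)
  have "Polynomial.degree [:- ([:0, 1:] ^ (q + 1)) :: 'k Polynomial.poly, 1:] < 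
    Polynomial.degree (Polynomial.monom (1 :: 'k Polynomial.poly) q)"
    using q2 by (simp add: degree_monom_eq)
  then show "Polynomial.degree f = q" unfolding *
    by (subst degree_add_eq_left) (simp_all add: degree_monom_eq)
  then show "Polynomial.lead_coeff f = 1" 
    using q2 by (simp add: *) (auto simp: coeff_pCons split: nat.splits)
qed

lemma f_nz: "f \<noteq> 0"
  using f_monic(1) q2 by auto

lemma reduce: "\<exists>r. f dvd g - r \<and> (r = 0 \<or> Polynomial.degree r < q)"
proof -
  obtain k r where kr: "pseudo_divmod g f = (k, r)" by fastforce
  from pseudo_divmod[OF f_nz kr] have "g = f * k + r" "r = 0 \<or> Polynomial.degree r < q"
    by (simp_all add: f_monic f_monic(2)[unfolded f_monic(1)])
  then show ?thesis by (intro exI[of _ r]) auto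
qed

lemma f_dvd_small: "f dvd r \<Longrightarrow> Polynomial.degree r < q \<Longrightarrow> r = 0"
  using dvd_imp_degree_le[of f r] f_monic by force

section \<open>Power series branches of the curve\<close>

definition eta :: "'k \<Rightarrow> 'k fps" where
  "eta x = fps_compose (fps_inv (fps_X + fps_X ^ q))
     ((fps_const x + fps_X) ^ (q + 1) - fps_const x ^ (q + 1))"

text \<open>Since \<open>x ^ q\<close> is additive, the ansatz \<open>Y = y + eta\<close> leaves an
  equation that is the same for all \<open>y\<close> above \<open>x\<close>. The series
  \<open>t + t ^ q\<close> has linear coefficient 1, so composing with its inverse under composition
  solves it. For \<open>x = 0\<close> it is also the equation of the curve in the chart
  \<open>Y = 1\<close>.\<close>

lemma eta_eq: "eta x ^ q + eta x = (fps_const x + fps_X) ^ (q + 1) - fps_const x ^ (q + 1)"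
  and eta_0: "fps_nth (eta x) 0 = 0"
proof -
  define G :: "'k fps" where "G = fps_X + fps_X ^ q"
  define s where "s = (fps_const x + fps_X) ^ (q + 1) - fps_const x ^ (q + 1)"
  have s0: "fps_nth s 0 = 0"
    by (simp add: s_def fps_nth_power_0 rhom_simps rhom_fps_nth)
  have G0: "fps_nth G 0 = 0" and G1: "fps_nth G 1 \<noteq> 0"
    using q2 by (auto simp: G_def fps_X_power_iff)
  have i0: "fps_nth (fps_inv G) 0 = 0" by (simp add: fps_inv_def)
  have eta: "eta x = fps_compose (fps_inv G) s" by (simp add: eta_def G_def s_def)
  have "fps_compose G (fps_compose (fps_inv G) s) = fps_compose (fps_compose G (fps_inv G)) s"
    by (rule fps_compose_assoc[OF s0 i0])
  also have "\<dots> = s" using s0 by (simp add: fps_inv_right[OF G0 G1])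
  finally have "fps_compose G (eta x) = s" by (simp add: eta)
  moreover show e0: "fps_nth (eta x) 0 = 0"
    by (simp add: eta i0 s0)
  then have "fps_compose G (eta x) = eta x + eta x ^ q"
    by (simp add: G_def fps_compose_add_distrib flip: fps_compose_power)
  ultimately show "eta x ^ q + eta x = (fps_const x + fps_X) ^ (q + 1) - fps_const x ^ (q + 1)"
    by (simp only: s_def add.commute)
qed

text \<open>Every point of the curve has exactly one representative in \<open>points\<close>.\<close>

definition points :: "('k \<times> 'k \<times> 'k) set" where
  "points = {(x, y, 1) | x y. y ^ q + y = x ^ (q + 1)} \<union> {(0, 1, 0)}"

text \<open>Coordinates are taken in the chart \<open>Z = 1\<close>, or \<open>Y = 1\<close> at infinity; in both the power series
  variable is the increment of \<open>X\<close>.\<close>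

definition branch :: "'k \<times> 'k \<times> 'k \<Rightarrow> 'k fps \<times> 'k fps \<times> 'k fps" where
  "branch = (\<lambda>(x, y, z). if z = 0 then (fps_X, 1, eta 0) else (fps_const x + fps_X, fps_const y + eta x, 1))"

definition E :: "'k \<times> 'k \<times> 'k \<Rightarrow> 'k poly3 \<Rightarrow> 'k fps" where
  "E s p = eval_hom3 fps_const (branch s) p"

lemma rhom_E: "rhom (E s)"
  unfolding E_def by (rule rhom_eval_hom3[OF rhom_fps_const])

lemma E_F: "s \<in> points \<Longrightarrow> E s F = 0"
proof -
  assume s: "s \<in> points"
  from s consider x y where "s = (x, y, 1)" "y ^ q + y = x ^ (q + 1)" | "s = (0, 1, 0)"
    by (auto simp: points_def)
  then show ?thesis
  proof cases
    case 1
    have "E s F = (fps_const x + fps_X) ^ (q + 1) - (fps_const y + eta x) ^ q - (fps_const y + eta x)"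
      by (simp add: 1 E_def branch_def eval_hom3_F rhom_fps_const)
    also have "\<dots> = fps_const (x ^ (q + 1)) - fps_const (y ^ q + y)"
      using eta_eq[of x] unfolding frob_fps by (simp add: algebra_simps fps_const_power flip: fps_const_add)
    finally show ?thesis by (simp add: 1)
  next
    case 2
    show ?thesis using eta_eq[of 0] q2
      by (simp add: 2 E_def branch_def eval_hom3_F rhom_fps_const power_0_left algebra_simps)
  qed
qed

lemma E_nth_0: "s \<in> points \<Longrightarrow> fps_nth (E s p) 0 = eval3 p s"
proof -
  assume s: "s \<in> points"
  obtain a b c where abc: "branch s = (a, b, c)" by (cases "branch s")
  have s': "s = (fps_nth a 0, fps_nth b 0, fps_nth c 0)"
    using s abc eta_0 by (auto simp: points_def branch_def)
  show ?thesis
    unfolding E_def abc eval3_eq_eval_hom3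
    by (subst s') (rule eval_hom3_comp[OF rhom_fps_const rhom_fps_nth, of a b c p, simplified])
qed

abbreviation zeta where "zeta \<equiv> eta 0"

lemma zeta_eq: "zeta ^ q + zeta = fps_X ^ (q + 1)"
  using eta_eq[of 0] q2 by (simp add: power_0_left)

lemma zeta_nz: "zeta \<noteq> 0"
  using zeta_eq q2 by (auto simp: power_0_left)

text \<open>\<open>zeta ^ (q - 1) + 1\<close> is a unit, so \<open>zeta\<close> has the order of
  \<open>X ^ (q + 1)\<close>: the contact order of the line \<open>Z = 0\<close> at
  infinity.\<close>

lemma subdegree_zeta: "subdegree zeta = q + 1"
proof -
  have "zeta * (zeta ^ (q - 1) + 1) = fps_X ^ (q + 1)"
    using zeta_eq q2 by (simp add: algebra_simps flip: power_Suc)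
  moreover have u: "fps_nth (zeta ^ (q - 1) + 1) 0 = 1"
    using q2 by (simp add: fps_nth_power_0 eta_0 power_0_left)
  moreover have "zeta ^ (q - 1) + 1 \<noteq> 0" using u by (metis fps_zero_nth zero_neq_one)
  ultimately have "subdegree zeta + subdegree (zeta ^ (q - 1) + 1) = q + 1"
    by (metis subdegree_mult zeta_nz subdegree_power subdegree_fps_X mult_1_right)
  moreover have "subdegree (zeta ^ (q - 1) + 1) = 0"
    by (rule subdegree_eq_0) (simp only: u, simp)
  ultimately show ?thesis by simp
qed

section \<open>Expansions at infinity\<close>

definition xi :: "'k fls" where "xi = fls_X / fps_to_fls zeta"
definition yi :: "'k fls" where "yi = inverse (fps_to_fls zeta)"

lemma yi_nz: "yi \<noteq> 0"
  using zeta_nz by (simp add: yi_def)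

text \<open>With \<open>X = t\<close>, \<open>Y = 1\<close>, \<open>Z = zeta\<close> on the branch,
  \<open>xi\<close> and \<open>yi\<close> are the affine coordinates \<open>X / Z\<close> and
  \<open>Y / Z\<close>.\<close>

lemma subdegree_xi: "fls_subdegree xi = - int q"
  and subdegree_yi: "fls_subdegree yi = - int (q + 1)"
  using zeta_nz by (simp_all add: xi_def yi_def fls_divide_subdegree fls_inverse_subdegree fls_subdegree_fls_to_fps subdegree_zeta)

definition expand_infinity :: "'k Polynomial.poly Polynomial.poly \<Rightarrow> 'k fls" where
  "expand_infinity g = eval_hom2 fls_const xi yi g"

lemma rhom_expand_infinity: "rhom expand_infinity"
  unfolding expand_infinity_def by (intro rhom_eval_hom rhom_fls_const)

lemma E_inf:
  assumes "is_form d p"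
  shows "fps_to_fls (E (0, 1, 0) p) = fps_to_fls zeta ^ d * expand_infinity (dehom p)"
proof -
  define z where "z = fps_to_fls zeta"
  have z: "z \<noteq> 0" using zeta_nz by (simp add: z_def)
  have "fps_to_fls (E (0, 1, 0) p) = eval_hom3 fls_const (fls_X, 1, z) p"
    unfolding E_def branch_def by (simp add: eval_hom3_comp[OF rhom_fps_const rhom_fps_to_fls] z_def)
  also have "\<dots> = eval_hom3 fls_const (z * xi, z * yi, z * 1) p"
    using z by (simp add: xi_def yi_def z_def)
  also have "\<dots> = z ^ d * eval_hom3 fls_const (xi, yi, 1) p"
    by (rule eval_hom3_scale[OF rhom_fls_const assms])
  finally show ?thesis
    by (simp add: eval_hom3_dehom rhom_fls_const expand_infinity_def z_def)
qed

lemma expand_infinity_f: "expand_infinity f = 0"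
proof -
  have "fps_to_fls (E (0, 1, 0) F) = fps_to_fls zeta ^ (q + 1) * expand_infinity (dehom F)"
    by (rule E_inf[OF is_form_F])
  moreover have "E (0, 1, 0) F = 0" by (rule E_F) (simp add: points_def)
  ultimately have "expand_infinity (dehom F) = 0" using zeta_nz by simp
  then show ?thesis by (simp add: dehom_F rhom_simps rhom_expand_infinity)
qed

text \<open>The pole order of the term with \<open>Y ^ j\<close> is congruent to \<open>j\<close>
  modulo \<open>q\<close>, and \<open>j < q\<close>, so all these orders are distinct and nothing
  cancels. The order of the sum is that of one term, and it is bounded by that of every
  term.\<close>

lemma expand_infinity_small:
  assumes "r \<noteq> 0" "Polynomial.degree r < q"
  shows "expand_infinity r \<noteq> 0"
    and "\<exists>j<q. Polynomial.coeff r j \<noteq> 0 \<and> 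
      fls_subdegree (expand_infinity r) = - int (q * Polynomial.degree (Polynomial.coeff r j) + (q + 1) * j)"
    and "Polynomial.coeff r j \<noteq> 0 \<Longrightarrow>
      fls_subdegree (expand_infinity r) \<le> - int (q * Polynomial.degree (Polynomial.coeff r j) + (q + 1) * j)"
proof -
  define I where "I = {i. i \<le> Polynomial.degree r \<and> Polynomial.coeff r i \<noteq> 0}"
  define g where "g i = eval_hom fls_const xi (Polynomial.coeff r i) * yi ^ i" for i
  have d: "Polynomial.degree r \<in> I" using assms(1) by (auto simp: I_def)
  have neg: "fls_subdegree xi < 0" using q2 by (simp add: subdegree_xi)
  have g0: "g i \<noteq> 0" and gs: "fls_subdegree (g i) = - int (q * Polynomial.degree (Polynomial.coeff r i) + (q + 1) * i)" 
    if "i \<in> I" for i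
    using that yi_nz eval_hom_fls_subdegree[OF _ neg, of "Polynomial.coeff r i"]
    by (auto simp: g_def I_def fls_subdegree_pow subdegree_xi subdegree_yi algebra_simps)
  have "expand_infinity r = sum g {..Polynomial.degree r}"
    by (simp add: expand_infinity_def eval_hom_as_sum[OF rhom_eval_hom[OF rhom_fls_const]] g_def)
  also have "\<dots> = sum g I"
    by (rule sum.mono_neutral_right) (auto simp: I_def g_def eval_hom_0)
  finally have sum_I: "expand_infinity r = sum g I" .
  have fin: "finite I" by (simp add: I_def)
  have "i = j" if "i \<in> I" "j \<in> I" "fls_subdegree (g i) = fls_subdegree (g j)" for i j
  proof -
    have "q * Polynomial.degree (Polynomial.coeff r i) + (q + 1) * i = 
      q * Polynomial.degree (Polynomial.coeff r j) + (q + 1) * j"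
      using that gs by (metis neg_equal_iff_equal of_nat_eq_iff)
    then have "(i + q * (Polynomial.degree (Polynomial.coeff r i) + i)) mod q =
      (j + q * (Polynomial.degree (Polynomial.coeff r j) + j)) mod q"
      by (simp add: algebra_simps)
    moreover have "i < q" "j < q" using that assms(2) by (auto simp: I_def)
    ultimately show ?thesis by simp
  qed
  then have "inj_on (\<lambda>i. fls_subdegree (g i)) I"
    by (auto simp: inj_on_def)
  from fls_sum_distinct_subdegree[OF fin _ g0 this] d
  obtain i where i: "sum g I \<noteq> 0" "i \<in> I" "fls_subdegree (sum g I) = fls_subdegree (g i)"
    "\<forall>j\<in>I. fls_subdegree (sum g I) \<le> fls_subdegree (g j)" by blast
  show "expand_infinity r \<noteq> 0" using i sum_I by simp
  show "\<exists>j<q. Polynomial.coeff r j \<noteq> 0 \<and> 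
      fls_subdegree (expand_infinity r) = - int (q * Polynomial.degree (Polynomial.coeff r j) + (q + 1) * j)"
    using i sum_I gs assms(2) by (intro exI[of _ i]) (auto simp: I_def)
  show "Polynomial.coeff r j \<noteq> 0 \<Longrightarrow>
      fls_subdegree (expand_infinity r) \<le> - int (q * Polynomial.degree (Polynomial.coeff r j) + (q + 1) * j)"
    using i(4) sum_I gs[of j] by (metis (mono_tags, lifting) I_def le_degree mem_Collect_eq)
qed

lemma expand_infinity_dvd: "f dvd g \<Longrightarrow> expand_infinity g = 0"
  by (elim dvdE) (simp add: rhom_mult[OF rhom_expand_infinity] expand_infinity_f)

text \<open>A nonzero reduced remainder has a nonzero expansion, so the kernel is generated by
  \<open>f\<close>. As the values lie in a field, \<open>f\<close> is prime.\<close>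

lemma expand_infinity_eq_0_iff: "expand_infinity g = 0 \<longleftrightarrow> f dvd g"
proof
  obtain r where r: "f dvd g - r" "r = 0 \<or> Polynomial.degree r < q" using reduce by blast
  have "expand_infinity (g - r) = 0" using r(1) by (rule expand_infinity_dvd)
  then have "expand_infinity g = expand_infinity r" by (simp add: rhom_simps rhom_expand_infinity)
  moreover assume "expand_infinity g = 0"
  ultimately have "r = 0" using expand_infinity_small(1)[of r] r(2) by auto
  then show "f dvd g" using r by simp
qed (rule expand_infinity_dvd)

lemma f_prime: "f dvd a * b \<longleftrightarrow> f dvd a \<or> f dvd b"
  by (simp flip: expand_infinity_eq_0_iff add: rhom_simps rhom_expand_infinity)

text \<open>The derivative of \<open>y ^ q + y - c\<close> is 1, so all roots are simple.\<close>

lemma fiber_card: "card {y :: 'k. y ^ q + y = c} = q"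
proof -
  define p where "p = Polynomial.monom 1 q + [:- c, 1 :: 'k:]"
  have deg: "Polynomial.degree p = q" unfolding p_def using q2
    by (subst degree_add_eq_left) (simp_all add: degree_monom_eq)
  have p0: "p \<noteq> 0" using deg q2 by auto
  obtain A where A: "size A = Polynomial.degree p"
    "p = Polynomial.smult (Polynomial.lead_coeff p) (\<Prod>x\<in>#A. [:-x, 1:])"
    using alg_closed_imp_factorization[OF p0] by blast
  have lc: "Polynomial.lead_coeff p \<noteq> 0" using p0 by simp
  have "of_nat q = (0 :: 'k)"
    using e by (simp add: q_eq)
  then have pd: "pderiv p = 1"
    by (simp add: p_def pderiv_add pderiv_monom pderiv_pCons one_pCons)
  have le: "count A x \<le> 1" for x
  proof (rule ccontr)
    assume "\<not> count A x \<le> 1"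
    then have "replicate_mset 2 x \<subseteq># A" by (simp flip: count_le_replicate_mset_subset_eq)
    then obtain B where "A = replicate_mset 2 x + B" by (auto simp: subset_mset.le_iff_add)
    then have "(\<Prod>x\<in>#A. [:-x, 1:]) = [:-x, 1:] * ([:-x, 1:] * (\<Prod>x\<in>#B. [:-x, 1:]))"
      by (simp add: numeral_2_eq_2 del: mult_pCons_left mult_pCons_right)
    then obtain r where r: "p = [:-x, 1:] * ([:-x, 1:] * r)"
      using A(2) by (metis mult_smult_right)
    have "poly (pderiv p) x = 0" unfolding r pderiv_mult by simp
    then show False by (simp add: pd)
  qed
  have "count A x = 1" if "x \<in># A" for x
  proof -
    have "0 < count A x" using that by simp
    then show ?thesis using le[of x] by linarith
  qed
  then have "card (set_mset A) = size A"
    by (simp add: size_multiset_overloaded_eq)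
  moreover have "set_mset A = {y. y ^ q + y = c}"
  proof -
    have "poly p y = 0 \<longleftrightarrow> y \<in># A" for y
      by (subst A(2)) (use lc in \<open>auto simp: poly_prod_mset prod_mset_zero_iff\<close>)
    moreover have "poly p y = 0 \<longleftrightarrow> y ^ q + y = c" for y
      by (simp add: p_def poly_monom algebra_simps eq_neg_iff_add_eq_0)
    ultimately show ?thesis by auto
  qed
  ultimately show ?thesis using A(1) deg by simp
qed

lemma fiber_finite: "finite {y :: 'k. y ^ q + y = c}"
  using fiber_card[of c] q2 by (metis card.infinite not_numeral_le_zero)

section \<open>Translations in Y and the norm to K[X]\<close>

definition translate :: "'k \<Rightarrow> 'k Polynomial.poly Polynomial.poly \<Rightarrow> 'k Polynomial.poly Polynomial.poly" where
  "translate b g = eval_hom (\<lambda>c. [:c:]) [:[:b:], 1:] g"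

lemma rhom_translate: "rhom (translate b)"
  unfolding translate_def by (intro rhom_eval_hom rhom_const)

lemma translate_pCons: "translate b (pCons a g) = [:a:] + [:[:b:], 1:] * translate b g"
  unfolding translate_def by (rule eval_hom_pCons[OF rhom_const])

lemma translate_const: "translate b [:a:] = [:a:]"
  unfolding translate_def by (rule eval_hom_const[OF rhom_const])

lemma translate_translate: "translate b (translate c g) = translate (c + b) g"
proof (induction g)
  case (pCons a g)
  have "translate b [:[:c:], 1:] = [:[:c + b:], 1:]"
    by (simp add: translate_pCons rhom_0[OF rhom_translate])
  with pCons show ?case
    by (simp only: translate_pCons[of _ a g] rhom_add[OF rhom_translate] rhom_mult[OF rhom_translate] translate_const)
qed (simp add: translate_def eval_hom_0)

lemma translate_0: "translate 0 g = g"
  by (induction g) (simp_all add: translate_pCons rhom_0[OF rhom_translate])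

lemma degree_translate: "Polynomial.degree (translate b g) = Polynomial.degree g"
proof -
  have "translate b g = pcompose g [:[:b:], 1:]" by (simp add: translate_def eval_hom_def pcompose_altdef)
  then show ?thesis by (simp add: degree_pcompose)
qed

lemma poly_translate: "poly (translate b g) [:y:] = poly g [:y + b:]"
proof (induction g)
  case (pCons a g)
  have "[:b:] + [:y:] = [:y + b:]" by simp
  then show ?case
    by (simp only: translate_pCons poly_add poly_mult poly_pCons poly_0 pCons.IH mult_zero_right add_0_right mult_1_right)
qed (simp add: rhom_0[OF rhom_translate])

lemma translate_f:
  assumes "b ^ q + b = 0"
  shows "translate b f = f"
proof -
  have "translate b [:0, 1:] = [:0, 1:] + [:[:b:]:]"
    by (simp add: translate_pCons rhom_0[OF rhom_translate])
  then have "translate b f = ([:0, 1:] + [:[:b:]:]) ^ q + ([:0, 1:] + [:[:b:]:]) - [:[:0, 1:] ^ (q + 1):]"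
    by (simp only: f_def rhom_diff[OF rhom_translate] rhom_add[OF rhom_translate] rhom_power[OF rhom_translate] translate_const)
  also have "\<dots> = f + [:[:b ^ q + b:]:]"
    unfolding frob_poly2 f_def by (simp add: poly_const_pow)
  finally show ?thesis by (simp add: assms)
qed

text \<open>The norm of \<open>g\<close> is the product of its conjugates under the translations \<open>Y \<mapsto> Y + b\<close>,
  which form the Galois group of the function field over the field of rational functions in \<open>X\<close>.\<close>

lemma norm_exists:
  assumes g: "\<not> f dvd g"
  shows "\<exists>g' n. n \<noteq> 0 \<and> f dvd g * g' - [:n:]"
proof -
  define B where "B = {b :: 'k. b ^ q + b = 0}"
  define N where "N = (\<Prod>b\<in>B. translate b g)"
  have finB: "finite B" and cardB: "card B = q" using fiber_finite[of 0] fiber_card[of 0] by (simp_all add: B_def)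
  have B0: "0 \<in> B" using q2 by (simp add: B_def)
  have Badd: "b + c \<in> B" if "b \<in> B" "c \<in> B" for b c
  proof -
    have "(b + c) ^ q + (b + c) = (b ^ q + b) + (c ^ q + c)" by (simp add: frob_k)
    also have "\<dots> = 0" using that by (simp add: B_def)
    finally show ?thesis by (simp add: B_def)
  qed
  have Bneg: "- b \<in> B" if "b \<in> B" for b
  proof -
    have "(- b) ^ q + (- b) = - (b ^ q + b)" by (simp add: frob_k_uminus)
    also have "\<dots> = 0" using that by (simp add: B_def)
    finally show ?thesis by (simp add: B_def)
  qed
  have sN: "translate c N = N" if c: "c \<in> B" for c
  proof -
    have "translate c N = (\<Prod>b\<in>B. translate (b + c) g)"
      by (simp add: N_def rhom_prod[OF rhom_translate] translate_translate)
    also have "\<dots> = N" unfolding N_def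
      by (rule prod.reindex_bij_witness[of _ "\<lambda>b. b - c" "\<lambda>b. b + c"])
         (use Badd Bneg c in \<open>auto simp: diff_conv_add_uminus simp del: add_uminus_conv_diff\<close>)
    finally show ?thesis .
  qed
  obtain s where s: "f dvd N - s" "s = 0 \<or> Polynomial.degree s < q" using reduce by blast
  have deg_s: "Polynomial.degree s < q" using s(2) q2 by auto
  \<comment> \<open>Translation preserves the degree in \<open>Y\<close>, so both sides are reduced
    and congruent modulo \<open>f\<close>, hence equal.\<close>
  have ss: "translate c s = s" if c: "c \<in> B" for c
  proof -
    have "translate c f dvd translate c (N - s)" by (rule rhom_dvd[OF rhom_translate s(1)])
    then have "f dvd N - translate c s"
      using c sN[OF c] translate_f[of c] by (simp add: B_def rhom_diff[OF rhom_translate])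
    then have "f dvd (N - s) - (N - translate c s)" using s(1) by (rule dvd_diff[rotated])
    then have "f dvd translate c s - s" by simp
    then have "translate c s - s = 0"
      by (rule f_dvd_small) (use deg_s in \<open>simp add: degree_diff_less degree_translate\<close>)
    then show ?thesis by simp
  qed
  define n where "n = poly s 0"
  \<comment> \<open>By invariance \<open>s\<close> takes the same value at all \<open>q\<close>
    constants in \<open>B\<close>, too often for a nonconstant polynomial of degree below
    \<open>q\<close> in \<open>Y\<close>.\<close>
  have "s - [:n:] = 0"
  proof (rule ccontr)
    assume nz: "s - [:n:] \<noteq> 0"
    have "poly (s - [:n:]) [:b:] = 0" if "b \<in> B" for b
      using poly_translate[of b s 0] ss[OF that] by (simp add: n_def)
    then have sub: "(\<lambda>b. [:b:]) ` B \<subseteq> {x. poly (s - [:n:]) x = 0}" by auto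
    have "card B = card ((\<lambda>b. [:b:]) ` B)" by (rule card_image[symmetric]) (simp add: inj_on_def)
    also have "\<dots> \<le> card {x. poly (s - [:n:]) x = 0}"
      by (rule card_mono[OF poly_roots_finite[OF nz] sub])
    also have "\<dots> \<le> Polynomial.degree (s - [:n:])" by (rule card_poly_roots_bound[OF nz])
    also have "\<dots> < q" using deg_s by (simp add: degree_diff_less)
    finally show False using cardB by simp
  qed
  then have sn: "s = [:n:]" by simp
  have "\<not> f dvd translate b g" if "b \<in> B" for b
  proof
    assume "f dvd translate b g"
    then have "translate (- b) f dvd translate (- b) (translate b g)" by (rule rhom_dvd[OF rhom_translate])
    then show False using g translate_f[of "- b"] Bneg[OF that] by (simp add: translate_translate translate_0 B_def)
  qed
  then have "expand_infinity (translate b g) \<noteq> 0" if "b \<in> B" for b using that by (simp add: expand_infinity_eq_0_iff)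
  then have "expand_infinity N \<noteq> 0" using finB by (simp add: N_def rhom_prod[OF rhom_expand_infinity] prod_zero_iff)
  moreover have "expand_infinity N = expand_infinity s" using expand_infinity_dvd[OF s(1)] by (simp add: rhom_diff[OF rhom_expand_infinity])
  ultimately have "n \<noteq> 0" using sn by (auto simp: rhom_0[OF rhom_expand_infinity])
  moreover have "N = g * (\<Prod>b\<in>B - {0}. translate b g)"
    unfolding N_def using prod.remove[OF finB B0, of "\<lambda>b. translate b g"] by (simp add: translate_0)
  ultimately show ?thesis using s(1) sn by metis
qed

section \<open>Expansions at affine points and their kernel\<close>

definition expand_affine :: "'k \<Rightarrow> 'k \<Rightarrow> 'k Polynomial.poly Polynomial.poly \<Rightarrow> 'k fps" where
  "expand_affine x y g = eval_hom2 fps_const (fps_const x + fps_X) (fps_const y + eta x) g"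

lemma rhom_expand_affine: "rhom (expand_affine x y)"
  unfolding expand_affine_def by (intro rhom_eval_hom rhom_fps_const)

lemma E_affine: "E (x, y, 1) p = expand_affine x y (dehom p)"
  by (simp add: E_def branch_def expand_affine_def eval_hom3_dehom[OF rhom_fps_const])

lemma expand_affine_f: "y ^ q + y = x ^ (q + 1) \<Longrightarrow> expand_affine x y f = 0"
  using E_F[of "(x, y, 1)"] by (simp add: points_def E_affine dehom_F rhom_minus[OF rhom_expand_affine])

lemma expand_affine_dvd: "y ^ q + y = x ^ (q + 1) \<Longrightarrow> f dvd g \<Longrightarrow> expand_affine x y g = 0"
  by (elim dvdE) (simp add: rhom_mult[OF rhom_expand_affine] expand_affine_f)

lemma expand_affine_nth_0: "fps_nth (expand_affine x y g) 0 = poly (poly g [:y:]) x"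
proof -
  have c: "fps_nth (eval_hom fps_const (fps_const x + fps_X) c) 0 = poly c x" for c :: "'k Polynomial.poly"
    by (induction c) (simp_all add: eval_hom_0 eval_hom_pCons rhom_fps_const)
  show ?thesis unfolding expand_affine_def
    by (induction g) (simp_all add: eval_hom_0 eval_hom_pCons rhom_eval_hom rhom_fps_const c eta_0)
qed

text \<open>Splitting off the root \<open>x\<close> with its multiplicity leaves a power of the
  parameter times a unit.\<close>

lemma expand_affine_const_nz:
  assumes "n \<noteq> 0"
  shows "expand_affine x y [:n:] \<noteq> 0"
proof -
  obtain m where m: "n = [:-x, 1:] ^ Polynomial.order x n * m" "\<not> [:-x, 1:] dvd m"
    using order_decomp[OF assms] by blast
  have h: "rhom (eval_hom fps_const (fps_const x + fps_X))" by (intro rhom_eval_hom rhom_fps_const)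
  have "expand_affine x y [:n:] = eval_hom fps_const (fps_const x + fps_X) n"
    unfolding expand_affine_def by (rule eval_hom_const[OF h])
  also have "\<dots> = fps_X ^ Polynomial.order x n * eval_hom fps_const (fps_const x + fps_X) m"
    by (subst m(1)) (simp add: rhom_mult[OF h] rhom_power[OF h] eval_hom_pCons eval_hom_0 rhom_fps_const flip: fps_const_neg)
  finally have "expand_affine x y [:n:] = fps_X ^ Polynomial.order x n * expand_affine x y [:m:]"
    unfolding expand_affine_def by (simp only: eval_hom_const[OF h])
  moreover have "fps_nth (expand_affine x y [:m:]) 0 \<noteq> 0"
    using m(2) by (simp add: expand_affine_nth_0 poly_eq_0_iff_dvd)
  then have "expand_affine x y [:m:] \<noteq> 0" by auto
  ultimately show ?thesis by simp
qed

text \<open>At an affine point orders do not separate the powers of \<open>Y\<close>. Instead, if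
  \<open>g\<close> vanished along the branch, so would its norm, a nonzero polynomial in
  \<open>X\<close> alone.\<close>

lemma expand_affine_eq_0_iff:
  assumes "y ^ q + y = x ^ (q + 1)"
  shows "expand_affine x y g = 0 \<longleftrightarrow> f dvd g"
proof
  assume 0: "expand_affine x y g = 0"
  show "f dvd g"
  proof (rule ccontr)
    assume "\<not> f dvd g"
    then obtain g' n where n: "n \<noteq> 0" "f dvd g * g' - [:n:]" using norm_exists by blast
    have "expand_affine x y [:n:] = 0"
      using expand_affine_dvd[OF assms n(2)] 0 by (simp add: rhom_diff[OF rhom_expand_affine] rhom_mult[OF rhom_expand_affine])
    then show False using expand_affine_const_nz n(1) by simp
  qed
qed (rule expand_affine_dvd[OF assms])

text \<open>At \<open>Z = 0\<close> the form \<open>F\<close> becomes \<open>X ^ (q + 1)\<close>, so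
  the prime \<open>Z\<close> does not divide \<open>F\<close> and can be cancelled.\<close>

lemma F_dvd_Z: "F dvd p * var_Z ^ m \<Longrightarrow> F dvd p"
proof (induction m)
  case (Suc m)
  have cancel: "F dvd r" if "F dvd r * var_Z" for r
  proof -
    from that obtain k where k: "r * var_Z = F * k" by (rule dvdE)
    have "poly F 0 \<noteq> 0"
      using q2 by (simp add: hermitian_def var_X_def var_Y_def var_Z_def power_0_left)
    moreover have "poly F 0 * poly k 0 = 0"
      using arg_cong[OF k, of "\<lambda>p. poly p 0"] by (simp add: var_Z_def)
    ultimately have "poly k 0 = 0" by simp
    then obtain k' where "k = var_Z * k'" by (auto simp: poly_eq_0_iff_dvd var_Z_def elim!: dvdE)
    then have "var_Z * r = var_Z * (F * k')" using k by (simp add: mult_ac)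
    moreover have "var_Z \<noteq> (0 :: 'k poly3)" by (simp add: var_Z_def)
    ultimately have "r = F * k'" by simp
    then show ?thesis by simp
  qed
  have "F dvd p * var_Z ^ m * var_Z" using Suc.prems by (simp only: power_Suc2 mult.assoc)
  from cancel[OF this] show ?case by (rule Suc.IH)
qed simp

lemma f_dvd_dehom:
  assumes "is_form d p" "f dvd dehom p"
  shows "F dvd p"
proof -
  obtain k where k: "dehom p = f * k" using assms(2) by (rule dvdE)
  obtain e' kh where kh: "is_form e' kh" "dehom kh = k" using dehom_surj by blast
  \<comment> \<open>The plus sign reflects \<open>dehom F = - f\<close>; the powers of
    \<open>Z\<close> bring both terms to the same degree.\<close>
  define r where "r = p * var_Z ^ (q + 1 + e') + var_Z ^ d * (F * kh)"
  have "is_form (d + (q + 1 + e')) r"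
    unfolding r_def by (intro is_form_add is_form_mult assms is_form_power1 is_form_var is_form_F kh(1))
  moreover have "dehom r = 0"
    by (simp add: r_def rhom_simps rhom_dehom dehom_F k kh del: power_Suc)
  ultimately have "r = 0" by (rule dehom_inj)
  then have "p * var_Z ^ (q + 1 + e') = F * (- (var_Z ^ d * kh))"
    by (simp add: r_def eq_neg_iff_add_eq_0 mult_ac)
  then show ?thesis by (intro F_dvd_Z[of p "q + 1 + e'"]) simp
qed

lemma E_dvd: "s \<in> points \<Longrightarrow> F dvd p \<Longrightarrow> E s p = 0"
  by (elim dvdE) (simp add: rhom_mult[OF rhom_E] E_F)

text \<open>Vanishing along a single branch forces divisibility by \<open>F\<close>; hence a form
  that is nonzero along one branch has a finite order at every point.\<close>

lemma E_eq_0_iff: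
  assumes "s \<in> points" "is_form d p"
  shows "E s p = 0 \<longleftrightarrow> F dvd p"
proof
  assume 0: "E s p = 0"
  from assms(1) consider x y where "s = (x, y, 1)" "y ^ q + y = x ^ (q + 1)" | "s = (0, 1, 0)"
    by (auto simp: points_def)
  then have "f dvd dehom p"
  proof cases
    case 1
    have "expand_affine x y (dehom p) = 0" using 0 by (simp only: 1(1) E_affine)
    then show ?thesis by (simp only: expand_affine_eq_0_iff[OF 1(2)])
  next
    case 2
    then have "expand_infinity (dehom p) = 0" using E_inf[OF assms(2)] 0 zeta_nz by simp
    then show ?thesis by (simp add: expand_infinity_eq_0_iff)
  qed
  then show "F dvd p" by (rule f_dvd_dehom[OF assms(2)])
qed (rule E_dvd[OF assms(1)])

text \<open>The affine coordinate ring is integrally closed: a function \<open>N / D\<close> without poles in the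
  affine part is a polynomial, since a root \<open>x\<close> of a least denominator \<open>d\<close> in \<open>g / d\<close>
  would force \<open>g\<close> to vanish at all \<open>q\<close> points above \<open>x\<close>.\<close>

lemma affine_regular:
  assumes D: "\<not> f dvd D"
    and reg: "\<And>x y. y ^ q + y = x ^ (q + 1) \<Longrightarrow>
      expand_affine x y N = 0 \<or> subdegree (expand_affine x y D) \<le> subdegree (expand_affine x y N)"
  shows "\<exists>g. Polynomial.degree g < q \<and> f dvd N - g * D"
proof -
  \<comment> \<open>\<open>P d\<close> says that \<open>N / D\<close> can be written as
    \<open>g / d\<close> with \<open>g\<close> reduced modulo \<open>f\<close>.\<close>
  define P where "P d \<longleftrightarrow> d \<noteq> 0 \<and> (\<exists>g. Polynomial.degree g < q \<and> f dvd N * [:d:] - g * D)" for d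
  have red: "\<exists>r. f dvd g - r \<and> Polynomial.degree r < q" for g
    using reduce[of g] q2 by (metis Polynomial.degree_0 less_le_trans zero_less_numeral)
  \<comment> \<open>The norm of \<open>D\<close> supplies a first denominator in \<open>X\<close>
    alone.\<close>
  obtain D' n where n: "n \<noteq> 0" "f dvd D * D' - [:n:]" using norm_exists[OF D] by blast
  obtain g0 where g0: "f dvd N * D' - g0" "Polynomial.degree g0 < q" using red by blast
  have "N * [:n:] - g0 * D = (N * D' - g0) * D - N * (D * D' - [:n:])" by (simp add: algebra_simps)
  then have "f dvd N * [:n:] - g0 * D" using g0 n by (metis dvd_diff dvd_mult dvd_mult2)
  then have "P n" using n g0 by (auto simp: P_def)
  then obtain d where d: "P d" and least: "\<And>d'. P d' \<Longrightarrow> Polynomial.degree d \<le> Polynomial.degree d'"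
    using ex_has_least_nat[of P n Polynomial.degree] by auto
  from d obtain g where g: "d \<noteq> 0" "Polynomial.degree g < q" "f dvd N * [:d:] - g * D"
    by (auto simp: P_def)
  have "Polynomial.degree d = 0"
  proof (rule ccontr)
    assume "Polynomial.degree d \<noteq> 0"
    then obtain x where x: "poly d x = 0" using alg_closed_imp_poly_has_root[of d] by auto
    define gx where "gx = map_poly (\<lambda>c. poly c x) g"
    have gx: "poly gx y = poly (poly g [:y:]) x" for y
      unfolding gx_def by (induction g) (auto simp: map_poly_pCons)
    \<comment> \<open>If \<open>g\<close> did not vanish at \<open>(x, y)\<close>, comparing orders
      in \<open>N d = g D\<close> would make the order of \<open>N\<close> smaller than that of
      \<open>D\<close>, because \<open>d\<close> vanishes there.\<close>
    have root: "poly gx y = 0" if y: "y ^ q + y = x ^ (q + 1)" for y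
    proof (rule ccontr)
      assume "poly gx y \<noteq> 0"
      then have g1: "fps_nth (expand_affine x y g) 0 \<noteq> 0" by (simp add: gx expand_affine_nth_0)
      then have g2: "expand_affine x y g \<noteq> 0" by auto
      have D1: "expand_affine x y D \<noteq> 0" using D expand_affine_eq_0_iff[OF y] by simp
      have d1: "expand_affine x y [:d:] \<noteq> 0" by (rule expand_affine_const_nz[OF g(1)])
      have eq: "expand_affine x y N * expand_affine x y [:d:] = expand_affine x y g * expand_affine x y D"
        using expand_affine_dvd[OF y g(3)] by (simp only: rhom_diff[OF rhom_expand_affine] rhom_mult[OF rhom_expand_affine] right_minus_eq)
      then have N1: "expand_affine x y N \<noteq> 0" using g2 D1 by auto
      have "subdegree (expand_affine x y N) + subdegree (expand_affine x y [:d:]) = subdegree (expand_affine x y g) + subdegree (expand_affine x y D)"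
        using arg_cong[OF eq, of subdegree] N1 D1 d1 g2 by simp
      moreover have "subdegree (expand_affine x y g) = 0" using g1 by simp
      moreover have "subdegree (expand_affine x y [:d:]) \<noteq> 0"
        using d1 x by (simp add: subdegree_eq_0_iff expand_affine_nth_0)
      ultimately show False using reg[OF y] N1 by simp
    qed
    \<comment> \<open>Having \<open>q\<close> roots and degree below \<open>q\<close>, the
      restriction of \<open>g\<close> to the fibre is zero, so \<open>X - x\<close> divides every
      coefficient of \<open>g\<close> and cancels against \<open>d\<close>.\<close>
    have gx0: "gx = 0"
    proof (rule ccontr)
      assume nz: "gx \<noteq> 0"
      have "q = card {y. y ^ q + y = x ^ (q + 1)}" by (rule fiber_card[symmetric])
      also have "\<dots> \<le> card {y. poly gx y = 0}"
        by (rule card_mono[OF poly_roots_finite[OF nz]]) (use root in auto)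
      also have "\<dots> \<le> Polynomial.degree gx" by (rule card_poly_roots_bound[OF nz])
      also have "\<dots> \<le> Polynomial.degree g" unfolding gx_def by (rule map_poly_degree_leq)
      finally show False using g(2) by simp
    qed
    define g1 where "g1 = map_poly (\<lambda>c. c div [:-x, 1:]) g"
    have div: "[:-x, 1:] * (c div [:-x, 1:]) = c" if "poly c x = 0" for c
      using that unfolding poly_eq_0_iff_dvd by (rule dvd_mult_div_cancel)
    have gg1: "g = [:[:-x, 1:]:] * g1"
    proof (rule poly_eqI)
      fix i
      have "Polynomial.coeff gx i = 0" by (simp add: gx0)
      then have "poly (Polynomial.coeff g i) x = 0" by (simp add: gx_def coeff_map_poly)
      from div[OF this] show "Polynomial.coeff g i = Polynomial.coeff ([:[:-x, 1:]:] * g1) i"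
        by (simp add: g1_def coeff_map_poly)
    qed
    obtain d1 where d1: "d = [:-x, 1:] * d1" using x by (auto simp: poly_eq_0_iff_dvd elim!: dvdE)
    have d1nz: "d1 \<noteq> 0" using g(1) d1 by auto
    have "[:d:] = [:[:-x, 1:]:] * [:d1:]" by (simp add: d1)
    then have "N * [:d:] - g * D = [:[:-x, 1:]:] * (N * [:d1:] - g1 * D)"
      unfolding gg1 by (simp only: right_diff_distrib mult_ac)
    moreover have "\<not> f dvd [:[:-x, 1:]:]" using f_dvd_small[of "[:[:-x, 1:]:]"] q2 by auto
    ultimately have "f dvd N * [:d1:] - g1 * D" using g(3) by (simp only: f_prime) simp
    moreover have "Polynomial.degree g1 < q"
      unfolding g1_def by (rule le_less_trans[OF map_poly_degree_leq g(2)])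
    ultimately have "P d1" using d1nz by (auto simp: P_def)
    have "Polynomial.degree d = Polynomial.degree [:-x, 1:] + Polynomial.degree d1"
      unfolding d1 by (rule degree_mult_eq) (use d1nz in auto)
    then show False using least[OF \<open>P d1\<close>] by simp
  qed
  then obtain c where c: "d = [:c:]" by (rule degree_eq_zeroE)
  then have c0: "c \<noteq> 0" using g(1) by auto
  have "[:[:inverse c:]:] * (N * [:d:] - g * D) = N - [:[:inverse c:]:] * g * D"
    using c0 by (simp add: c smult_diff_right flip: one_pCons)
  then have "f dvd N - [:[:inverse c:]:] * g * D" using g(3) by (metis dvd_mult)
  moreover have "Polynomial.degree ([:[:inverse c:]:] * g) < q" using g(2) c0 by simp
  ultimately show ?thesis by blast
qed

section \<open>The function field and its valuations\<close>

lemma eval3_scale: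
  fixes p :: "'k poly3"
  shows "is_form d p \<Longrightarrow> eval3 p (c * x, c * y, c * z) = c ^ d * eval3 p (x, y, z)"
  unfolding eval3_eq_eval_hom3 by (rule eval_hom3_scale[OF rhom_id])

lemma eval3_F: "eval3 F (x, y, z) = x ^ (q + 1) - y ^ q * z - y * z ^ q"
  by (simp only: eval3_eq_eval_hom3 eval_hom3_F[OF rhom_id])

lemma points_curve: "s \<in> points \<Longrightarrow> proj_point s \<in> curve_points F"
proof -
  assume s: "s \<in> points"
  obtain x y z where xyz: "s = (x, y, z)" by (cases s)
  have "eval3 F s = 0" using E_nth_0[OF s, of F] E_F[OF s] by simp
  then have "\<forall>v\<in>proj_point s. eval3 F v = 0"
    by (auto simp: xyz proj_point_def eval3_scale[OF is_form_F])
  moreover have "s \<noteq> (0, 0, 0)" using s by (auto simp: points_def)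
  ultimately have "proj_point s \<in> proj_plane" unfolding proj_plane_def by blast
  then show ?thesis using \<open>\<forall>v\<in>proj_point s. eval3 F v = 0\<close> by (simp add: curve_points_def)
qed

lemma proj_point_scale:
  fixes c :: "'b :: field"
  assumes "c \<noteq> 0"
  shows "proj_point (c * x, c * y, c * z) = proj_point (x, y, z)"
proof -
  have "(\<exists>d. v = (d * (c * x), d * (c * y), d * (c * z)) \<and> d \<noteq> 0) \<longleftrightarrow>
    (\<exists>d. v = (d * x, d * y, d * z) \<and> d \<noteq> 0)" for v
  proof
    assume "\<exists>d. v = (d * x, d * y, d * z) \<and> d \<noteq> 0"
    then obtain d where "v = (d * x, d * y, d * z)" "d \<noteq> 0" by blast
    then show "\<exists>d. v = (d * (c * x), d * (c * y), d * (c * z)) \<and> d \<noteq> 0"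
      using assms by (intro exI[of _ "d / c"]) simp
  next
    assume "\<exists>d. v = (d * (c * x), d * (c * y), d * (c * z)) \<and> d \<noteq> 0"
    then obtain d where "v = (d * (c * x), d * (c * y), d * (c * z))" "d \<noteq> 0" by blast
    then show "\<exists>d. v = (d * x, d * y, d * z) \<and> d \<noteq> 0"
      using assms by (intro exI[of _ "d * c"]) (simp add: mult.assoc)
  qed
  then show ?thesis by (simp add: proj_point_def)
qed

lemma proj_point_self: "v \<in> proj_point v" for v :: "'b :: field \<times> 'b \<times> 'b"
  by (cases v) (auto simp: proj_point_def intro!: exI[of _ 1])

text \<open>At \<open>z = 0\<close> the equation reduces to \<open>x ^ (q + 1) = 0\<close>, which
  leaves a single point at infinity.\<close>

lemma curve_points_aux:
  fixes x y z :: 'k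
  assumes "proj_point (x, y, z) \<in> curve_points F"
  shows "if z = 0 then x = 0 \<and> y \<noteq> 0 \<and> proj_point (x, y, z) = proj_point (0, 1, 0)
    else (x / z, y / z, 1) \<in> points \<and> proj_point (x, y, z) = proj_point (x / z, y / z, 1)"
proof -
  have F0: "eval3 F (x, y, z) = 0" using assms proj_point_self by (auto simp: curve_points_def)
  have nz: "(x, y, z) \<noteq> (0, 0, 0)"
  proof
    assume "(x, y, z) = (0, 0, 0)"
    then have "proj_point (x, y, z) = {(0, 0, 0)}"
      by (auto simp: proj_point_def intro!: exI[of _ 1])
    moreover from assms obtain v :: "'k \<times> 'k \<times> 'k" where "v \<noteq> (0, 0, 0)" "proj_point (x, y, z) = proj_point v"
      unfolding curve_points_def proj_plane_def by blast
    ultimately show False using proj_point_self[of v] by auto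
  qed
  show ?thesis
  proof (cases "z = 0")
    case True
    then have "x = 0" using F0 q2 by (simp add: eval3_F power_0_left)
    then have "y \<noteq> 0" using nz True by auto
    then show ?thesis using True \<open>x = 0\<close> proj_point_scale[of y 0 1 0] by simp
  next
    case False
    have p: "proj_point (x, y, z) = proj_point (x / z, y / z, 1)"
      using proj_point_scale[OF False, of "x / z" "y / z" 1] False by simp
    then have "(x / z, y / z, 1) \<in> proj_point (x, y, z)" by (simp add: proj_point_self)
    then have "eval3 F (x / z, y / z, 1) = 0" using assms by (auto simp: curve_points_def)
    then show ?thesis using False p by (auto simp: points_def eval3_F algebra_simps)
  qed
qed

lemma curve_points: "S \<in> curve_points F \<Longrightarrow> \<exists>s\<in>points. S = proj_point s"
proof -
  assume S: "S \<in> curve_points F"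
  then obtain x y z where "S = proj_point (x, y, z)"
    by (auto simp: curve_points_def proj_plane_def)
  note aux = curve_points_aux[of x y z] S[unfolded \<open>S = _\<close>]
  show ?thesis
  proof (cases "z = 0")
    case True
    have "(0, 1, 0) \<in> points" by (simp add: points_def)
    then show ?thesis using aux True \<open>S = _\<close> by (auto intro!: bexI[of _ "(0, 1, 0)"])
  next
    case False
    then show ?thesis using aux \<open>S = _\<close> by (auto intro!: bexI[of _ "(x / z, y / z, 1)"])
  qed
qed

lemma points_inj: "s \<in> points \<Longrightarrow> s' \<in> points \<Longrightarrow> proj_point s = proj_point s' \<Longrightarrow> s = s'"
proof -
  assume s: "s \<in> points" "s' \<in> points" and "proj_point s = proj_point s'"
  then have "s \<in> proj_point s'" using proj_point_self[of s] by simp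
  then show ?thesis using s by (auto simp: points_def proj_point_def)
qed

lemma eval3_point:
  assumes "is_form d p"
  shows "(\<forall>v\<in>proj_point s. eval3 p v \<noteq> 0) \<longleftrightarrow> eval3 p s \<noteq> 0"
    and "(\<forall>v\<in>proj_point s. eval3 p v = 0) \<longleftrightarrow> eval3 p s = (0 :: 'k)"
proof -
  have "eval3 p v = 0 \<longleftrightarrow> eval3 p s = 0" if v: "v \<in> proj_point s" for v
  proof -
    obtain x y z where s: "s = (x, y, z)" by (cases s)
    with v obtain c where "v = (c * x, c * y, c * z)" "c \<noteq> 0"
      by (auto simp: proj_point_def)
    then show ?thesis by (simp add: s eval3_scale[OF assms])
  qed
  then show "(\<forall>v\<in>proj_point s. eval3 p v \<noteq> 0) \<longleftrightarrow> eval3 p s \<noteq> 0"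
    "(\<forall>v\<in>proj_point s. eval3 p v = 0) \<longleftrightarrow> eval3 p s = 0"
    using proj_point_self[of s] by blast+
qed

text \<open>At each point \<open>T\<close> is a local parameter and \<open>M\<close> does not vanish; the equation of the curve
  expresses the other local coordinate \<open>D\<close> as a multiple of \<open>T\<close>.\<close>

lemma local_coordinates:
  assumes "s \<in> points"
  obtains T D U W M :: "'k poly3" where
    "is_form 1 T" "is_form 1 D" "is_form 1 M" "is_form q U" "is_form q W"
    "subdegree (E s T) = 1" "eval3 M s = 1" "eval3 U s \<noteq> 0" "F = T * W - D * U"
    "\<And>v. v \<in> {var_X, var_Y, var_Z} \<Longrightarrow> \<exists>a b. v = const3 a * T + const3 b * D + const3 (eval3 v s) * M"
proof -
  have sd: "subdegree (fps_X + fps_const x - fps_const x) = 1" for x :: 'k by simp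
  note evs = E_def branch_def eval3_eq_eval_hom3 rhom_simps[OF rhom_eval_hom3[OF rhom_fps_const]]
    rhom_simps[OF rhom_eval_hom3[OF rhom_id]] eval_hom3_var[OF rhom_fps_const] eval_hom3_var[OF rhom_id]
    eval_hom3_const3[OF rhom_fps_const] eval_hom3_const3[OF rhom_id]
  note c01 = rhom_0[OF rhom_const3] rhom_1[OF rhom_const3]
  from assms consider x y where "s = (x, y, 1)" "y ^ q + y = x ^ (q + 1)" | "s = (0, 1, 0)"
    by (auto simp: points_def)
  then show ?thesis
  proof cases
    case 1
    define T where "T = var_X - const3 x * var_Z"
    define D where "D = var_Y - const3 y * var_Z"
    \<comment> \<open>\<open>T * W\<close> is the geometric sum for
      \<open>X ^ (q + 1) - (x Z) ^ (q + 1)\<close>. As \<open>D ^ q = Y ^ q - (y Z) ^ q\<close>, the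
      product \<open>D * U\<close> collects the terms in \<open>Y\<close>; the remaining multiples
      of \<open>Z ^ (q + 1)\<close> cancel because \<open>(x, y)\<close> lies on the curve.\<close>
    define W where "W = (\<Sum>i<q + 1. (const3 x * var_Z) ^ (q + 1 - Suc i) * var_X ^ i)"
    define U where "U = D ^ (q - 1) * var_Z + var_Z ^ q"
    have fc: "is_form 1 (const3 c * var_Z)" for c :: 'k
      using is_form_mult[OF is_form_const3 is_form_var(3)] by simp
    have fT: "is_form 1 T" "is_form 1 D" unfolding T_def D_def
      by (intro is_form_diff is_form_var fc)+
    have fU: "is_form q U" unfolding U_def
      using is_form_mult[OF is_form_power1[OF fT(2), of "q - 1"] is_form_var(3)] q2
      by (intro is_form_add is_form_power1 is_form_var) simp
    have fW: "is_form q W" unfolding W_def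
    proof (rule is_form_sum)
      fix i assume "i \<in> {..<q + 1}"
      then show "is_form q ((const3 x * var_Z) ^ (q + 1 - Suc i) * var_X ^ i)"
        using is_form_mult[OF is_form_power1[OF fc, of "q + 1 - Suc i" x] is_form_power1[OF is_form_var(1), of i]]
        by simp
    qed
    have TW: "T * W = var_X ^ (q + 1) - (const3 x * var_Z) ^ (q + 1)"
      unfolding T_def W_def by (rule power_diff_sumr2[symmetric])
    have "D * U = D ^ q * var_Z + D * var_Z ^ q"
      using q2 by (simp add: U_def algebra_simps flip: power_Suc) 
    also have "D ^ q = var_Y ^ q - (const3 y * var_Z) ^ q"
      using frob_poly3[of D "const3 y * var_Z"] by (simp add: D_def)
    finally have DU: "D * U = var_Y ^ q * var_Z + var_Y * var_Z ^ q - const3 (y ^ q + y) * var_Z ^ (q + 1)"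
      by (simp add: D_def power_mult_distrib rhom_simps rhom_const3 algebra_simps)
    have "F = T * W - D * U"
      unfolding TW DU 1(2) hermitian_def
      by (simp add: power_mult_distrib rhom_simps rhom_const3 algebra_simps)
    moreover have "subdegree (E s T) = 1"
      using sd[of x] by (simp add: 1(1) T_def evs add.commute)
    moreover have "eval3 U s \<noteq> 0" using q2 by (simp add: 1(1) U_def D_def evs power_0_left)
    moreover have "\<exists>a b. v = const3 a * T + const3 b * D + const3 (eval3 v s) * var_Z"
      if "v \<in> {var_X, var_Y, var_Z}" for v
    proof -
      from that consider "v = var_X" | "v = var_Y" | "v = var_Z" by auto
      then show ?thesis
      proof cases
        case a: 1
        show ?thesis by (rule exI[of _ 1], rule exI[of _ 0]) (simp add: a 1(1) T_def evs c01)
      next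
        case a: 2
        show ?thesis by (rule exI[of _ 0], rule exI[of _ 1]) (simp add: a 1(1) D_def evs c01)
      next
        case a: 3
        show ?thesis by (rule exI[of _ 0], rule exI[of _ 0]) (simp add: a 1(1) evs c01)
      qed
    qed
    moreover have "eval3 var_Z s = 1" by (simp add: 1(1) evs)
    ultimately show ?thesis using that[of T D var_Z U W] fT fU fW by simp
  next
    case 2
    define W :: "'k poly3" where "W = var_X ^ q"
    define U :: "'k poly3" where "U = var_Z ^ (q - 1) * var_Y + var_Y ^ q"
    have fU: "is_form q U" unfolding U_def
      using is_form_mult[OF is_form_power1[OF is_form_var(3), of "q - 1"] is_form_var(2)] q2
      by (intro is_form_add is_form_power1 is_form_var) simp
    have fW: "is_form q W" unfolding W_def by (intro is_form_power1 is_form_var)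
    have "var_Z * U = var_Z ^ q * var_Y + var_Z * var_Y ^ q"
      using q2 by (simp add: U_def algebra_simps flip: power_Suc)
    then have "F = var_X * W - var_Z * U"
      by (simp add: hermitian_def W_def algebra_simps)
    moreover have "subdegree (E s var_X) = 1" by (simp add: 2 evs)
    moreover have "eval3 U s \<noteq> 0" using q2 by (simp add: 2 U_def evs power_0_left)
    moreover have "\<exists>a b. v = const3 a * var_X + const3 b * var_Z + const3 (eval3 v s) * var_Y"
      if "v \<in> {var_X, var_Y, var_Z}" for v
    proof -
      from that consider "v = var_X" | "v = var_Y" | "v = var_Z" by auto
      then show ?thesis
      proof cases
        case a: 1
        show ?thesis by (rule exI[of _ 1], rule exI[of _ 0]) (simp add: a 2 evs c01)
      next
        case a: 2
        show ?thesis by (rule exI[of _ 0], rule exI[of _ 0]) (simp add: a 2 evs c01)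
      next
        case a: 3
        show ?thesis by (rule exI[of _ 0], rule exI[of _ 1]) (simp add: a 2 evs c01)
      qed
    qed
    moreover have "eval3 var_Y s = 1" by (simp add: 2 evs)
    ultimately show ?thesis using that[of var_X var_Z var_Y U W] fU fW by simp
  qed
qed

text \<open>Each variable is its value times \<open>M\<close> modulo \<open>T\<close> and
  \<open>D\<close>, which passes on to monomials factor by factor. For \<open>d = 0\<close> the
  degree \<open>d - 1\<close> is truncated, hence the extra clause.\<close>

lemma form_split:
  fixes T D M :: "'k poly3"
  assumes forms: "is_form 1 T" "is_form 1 D" "is_form 1 M"
    and vars: "\<And>v. v \<in> {var_X, var_Y, var_Z} \<Longrightarrow> \<exists>a b. v = const3 a * T + const3 b * D + const3 (eval3 v s) * M"
    and G: "is_form d G"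
  shows "\<exists>A B. is_form (d - 1) A \<and> is_form (d - 1) B \<and> (d = 0 \<longrightarrow> A = 0 \<and> B = 0) \<and>
    G = T * A + D * B + const3 (eval3 G s) * M ^ d"
    (is "?Q d G")
  using G
proof (induction G rule: form_induct)
  case zero
  show ?case by (intro exI[of _ 0]) (simp add: rhom_0[OF rhom_const3] rhom_0[OF rhom_eval3])
next
  case (add p r)
  then obtain A B A' B' where "is_form (d - 1) A" "is_form (d - 1) B" "d = 0 \<longrightarrow> A = 0 \<and> B = 0"
    "is_form (d - 1) A'" "is_form (d - 1) B'" "d = 0 \<longrightarrow> A' = 0 \<and> B' = 0"
    and p: "p = T * A + D * B + const3 (eval3 p s) * M ^ d"
    and r: "r = T * A' + D * B' + const3 (eval3 r s) * M ^ d" by blast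
  moreover have "p + r = T * (A + A') + D * (B + B') + const3 (eval3 (p + r) s) * M ^ d"
    by (subst p, subst r) (simp add: rhom_add[OF rhom_const3] rhom_add[OF rhom_eval3] algebra_simps)
  ultimately show ?case by (intro exI[of _ "A + A'"] exI[of _ "B + B'"]) (simp add: is_form_add)
next
  case (monom3 c i j k)
  have step: "?Q (Suc d) (v * m)" if Q: "?Q d m" and m: "is_form d m" and v: "v \<in> {var_X, var_Y, var_Z}" for d v m
  proof -
    from Q obtain A B where AB: "is_form (d - 1) A" "is_form (d - 1) B" "d = 0 \<longrightarrow> A = 0 \<and> B = 0"
      "m = T * A + D * B + const3 (eval3 m s) * M ^ d" by blast
    from vars[OF v] obtain a b where ab: "v = const3 a * T + const3 b * D + const3 (eval3 v s) * M" by blast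
    define A' where "A' = const3 a * m + const3 (eval3 v s) * (M * A)"
    define B' where "B' = const3 b * m + const3 (eval3 v s) * (M * B)"
    have MA: "is_form d (M * C)" if "is_form (d - 1) C" "d = 0 \<longrightarrow> C = 0" for C
      using is_form_mult[OF forms(3) that(1)] that(2) by (cases d) simp_all
    have cs: "is_form d (const3 c * C)" if "is_form d C" for c C
      using is_form_mult[OF is_form_const3 that] by simp
    have fA: "is_form d A'" "is_form d B'" unfolding A'_def B'_def
      using AB by (auto intro!: is_form_add cs MA m)
    have "v * m = (const3 a * T + const3 b * D) * m + const3 (eval3 v s) * M * m"
      by (subst ab) (simp add: algebra_simps)
    then have "v * m = (const3 a * T + const3 b * D) * m + 
        const3 (eval3 v s) * M * (T * A + D * B + const3 (eval3 m s) * M ^ d)"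
      using AB(4) by simp
    also have "\<dots> = T * A' + D * B' + const3 (eval3 (v * m) s) * M ^ Suc d"
      by (simp add: A'_def B'_def rhom_mult[OF rhom_const3] rhom_mult[OF rhom_eval3] algebra_simps)
    finally have "v * m = T * A' + D * B' + const3 (eval3 (v * m) s) * M ^ Suc d" .
    then show ?thesis using fA by auto
  qed
  have "?Q (i + j + k) (monom3 c i j k)"
  proof (induction k)
    case 0
    show ?case
    proof (induction j)
      case 0
      show ?case
      proof (induction i)
        case 0
        have "eval3 (monom3 c 0 0 0) s = c" by (cases s) (simp add: eval3_monom3)
        then show ?case by (intro exI[of _ 0]) (simp add: const3_def)
      next
        case (Suc i)
        have "monom3 c (Suc i) 0 0 = var_X * monom3 c i 0 0" by (simp add: var_eq_monom3 monom3_mult)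
        then show ?case using step[OF Suc, of var_X] by simp
      qed
    next
      case (Suc j)
      have "monom3 c i (Suc j) 0 = var_Y * monom3 c i j 0" by (simp add: var_eq_monom3 monom3_mult)
      then show ?case using step[OF Suc, of var_Y] by simp
    qed
  next
    case (Suc k)
    have "monom3 c i j (Suc k) = var_Z * monom3 c i j k" by (simp add: var_eq_monom3 monom3_mult)
    then show ?case using step[OF Suc, of var_Z] by simp
  qed
  then show ?case by (simp only: monom3)
qed

text \<open>The bridge from power series to algebra: up to a factor that does not vanish at the
  point, and modulo \<open>F\<close>, a form of order at least \<open>n\<close> is a multiple of
  \<open>T ^ n\<close>. It is what turns a nonnegative order into a representative with nonvanishing
  denominator.\<close>

lemma local_parameter:
  assumes s: "s \<in> points"
  obtains T M :: "'k poly3" where "is_form 1 T" "is_form 1 M" "subdegree (E s T) = 1" "eval3 M s = 1"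
    "\<And>d n G. is_form d G \<Longrightarrow> E s G = 0 \<or> n \<le> subdegree (E s G) \<Longrightarrow>
      \<exists>U V k l. is_form k U \<and> eval3 U s \<noteq> 0 \<and> is_form l V \<and> k + d = l + n \<and> F dvd U * G - V * T ^ n"
proof -
  obtain T D U0 W M :: "'k poly3" where
    forms: "is_form 1 T" "is_form 1 D" "is_form 1 M" "is_form q U0" "is_form q W" and
    T: "subdegree (E s T) = 1" and M: "eval3 M s = 1" and U0: "eval3 U0 s \<noteq> 0" and F: "F = T * W - D * U0" and
    vars: "\<And>v. v \<in> {var_X, var_Y, var_Z} \<Longrightarrow> \<exists>a b. v = const3 a * T + const3 b * D + const3 (eval3 v s) * M"
    by (rule local_coordinates[OF s], rule that)
  have nz: "E s p \<noteq> 0" "subdegree (E s p) = 0" if "eval3 p s \<noteq> 0" for p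
    using that E_nth_0[OF s, of p] by auto
  have T0: "E s T \<noteq> 0" using T by auto
  have main: "\<exists>U V k l. is_form k U \<and> eval3 U s \<noteq> 0 \<and> is_form l V \<and> k + d = l + n \<and> F dvd U * G - V * T ^ n"
    if G: "is_form d G" and n: "E s G = 0 \<or> n \<le> subdegree (E s G)" for d n G
  proof (cases "E s G = 0")
    case True
    then have "F dvd G" using E_eq_0_iff[OF s G] by simp
    moreover have "is_form n (M ^ n)" by (rule is_form_power1[OF forms(3)])
    moreover have "eval3 (M ^ n) s \<noteq> 0" using M by (simp add: rhom_power[OF rhom_eval3])
    ultimately show ?thesis by (intro exI[of _ "M ^ n"] exI[of _ 0] exI[of _ n] exI[of _ d]) simp
  next
    case False
    with n have "n \<le> subdegree (E s G)" by simp
    then show ?thesis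
    proof (induction n)
      case 0
      show ?case using G
        by (intro exI[of _ 1] exI[of _ G] exI[of _ 0] exI[of _ d]) (simp add: is_form_1 rhom_1[OF rhom_eval3])
    next
      case (Suc n)
      then obtain U V k l where *: "is_form k U" "eval3 U s \<noteq> 0" "is_form l V" "k + d = l + n"
        "F dvd U * G - V * T ^ n" by auto
      have eq: "E s U * E s G = E s V * E s T ^ n"
        using E_dvd[OF s *(5)] by (simp add: rhom_simps[OF rhom_E])
      then have V0: "E s V \<noteq> 0" using nz(1)[OF *(2)] False by auto
      have "subdegree (E s U) + subdegree (E s G) = subdegree (E s V) + n"
        using arg_cong[OF eq, of subdegree] nz(1)[OF *(2)] False V0 T0 T by simp
      then have "subdegree (E s V) \<noteq> 0" using nz(2)[OF *(2)] Suc.prems by simp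
      then have Vs: "eval3 V s = 0" using nz(2)[of V] by auto
      obtain A B where AB: "is_form (l - 1) A" "is_form (l - 1) B" "l = 0 \<longrightarrow> A = 0 \<and> B = 0"
        "V = T * A + D * B" using form_split[OF forms(1-3) vars *(3)] Vs by (auto simp: rhom_0[OF rhom_const3])
      have l: "l \<noteq> 0" using AB V0 by (auto simp: rhom_0[OF rhom_E])
      \<comment> \<open>As \<open>V\<close> vanishes at the point, \<open>V = T * A + D * B\<close>.
        Multiplying by \<open>U0\<close> and replacing \<open>D * U0\<close> by
        \<open>T * W - F\<close> produces one more factor \<open>T\<close>.\<close>
      define V' where "V' = A * U0 + B * W"
      have "U0 * U * G - V' * T ^ Suc n = U0 * (U * G - V * T ^ n) - F * B * T ^ n"
        by (simp add: V'_def AB(4) F algebra_simps)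
      then have "F dvd U0 * U * G - V' * T ^ Suc n" using *(5) by (simp add: dvd_diff mult.assoc)
      moreover have "is_form (q + k) (U0 * U)" by (rule is_form_mult[OF forms(4) *(1)])
      moreover have "is_form (l - 1 + q) V'" unfolding V'_def
        by (intro is_form_add is_form_mult AB forms)
      moreover have "eval3 (U0 * U) s \<noteq> 0" using U0 *(2) by (simp add: rhom_mult[OF rhom_eval3])
      moreover have "q + k + d = l - 1 + q + Suc n" using *(4) l by simp
      ultimately show ?case by blast
    qed
  qed
  show ?thesis by (rule that[OF forms(1,3) T M main])
qed

section \<open>The function field inside Laurent series\<close>

definition val :: "'k \<times> 'k \<times> 'k \<Rightarrow> 'k poly3 \<times> 'k poly3 \<Rightarrow> 'k fls" where
  "val s r = fps_to_fls (E s (fst r)) / fps_to_fls (E s (snd r))"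

lemma fractionsD:
  assumes "(G, H) \<in> fractions F" "s \<in> points"
  obtains d where "is_form d G" "is_form d H" "E s H \<noteq> 0"
  using assms E_eq_0_iff[OF assms(2)] by (auto simp: fractions_def)

lemma fractionsI:
  assumes "is_form d G" "is_form d H" "s \<in> points" "E s H \<noteq> 0"
  shows "(G, H) \<in> fractions F"
  using assms E_eq_0_iff[OF assms(3,2)] by (auto simp: fractions_def)

text \<open>Two fractions define the same function as soon as their expansions agree at one point,
  whichever point is taken.\<close>

lemma frac_rel_iff:
  assumes s: "s \<in> points"
  shows "(r, r') \<in> frac_rel F \<longleftrightarrow> r \<in> fractions F \<and> r' \<in> fractions F \<and> val s r = val s r'"
proof -
  obtain G H G' H' where r: "r = (G, H)" "r' = (G', H')" by (cases r, cases r')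
  have "F dvd G * H' - G' * H \<longleftrightarrow> val s r = val s r'" if f: "(G, H) \<in> fractions F" "(G', H') \<in> fractions F"
  proof -
    obtain d where d: "is_form d G" "is_form d H" "E s H \<noteq> 0" by (rule fractionsD[OF f(1) s])
    obtain d' where d': "is_form d' G'" "is_form d' H'" "E s H' \<noteq> 0" by (rule fractionsD[OF f(2) s])
    have "is_form (d + d') (G * H' - G' * H)"
      using is_form_mult[OF d(1) d'(2)] is_form_mult[OF d'(1) d(2)] by (intro is_form_diff) (simp_all add: add.commute)
    then have "F dvd G * H' - G' * H \<longleftrightarrow> E s (G * H' - G' * H) = 0"
      by (simp only: E_eq_0_iff[OF s])
    also have "\<dots> \<longleftrightarrow> E s G * E s H' = E s G' * E s H"
      by (simp add: rhom_diff[OF rhom_E] rhom_mult[OF rhom_E])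
    also have "\<dots> \<longleftrightarrow> fps_to_fls (E s G) * fps_to_fls (E s H') = fps_to_fls (E s G') * fps_to_fls (E s H)"
      by (simp flip: fls_times_fps_to_fls)
    also have "\<dots> \<longleftrightarrow> val s r = val s r'"
      using d(3) d'(3) by (simp add: val_def r frac_eq_eq)
    finally show ?thesis .
  qed
  then show ?thesis by (auto simp: frac_rel_def r)
qed

lemma points_nonempty: "(0, 1, 0) \<in> points"
  by (simp add: points_def)

text \<open>The choice is harmless: by \<open>frac_rel_iff\<close> all members of a class have the
  same expansion.\<close>

definition Val :: "'k \<times> 'k \<times> 'k \<Rightarrow> 'k rat_fun \<Rightarrow> 'k fls" where
  "Val s A = val s (SOME r. r \<in> A)"

abbreviation KF where "KF \<equiv> function_field F"

lemma carrier_KF: "carrier KF = {frac_class F r | r. r \<in> fractions F}"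
  by (auto simp: function_field_def quotient_def frac_class_def)

lemma frac_class_carrier: "r \<in> fractions F \<Longrightarrow> frac_class F r \<in> carrier KF"
  unfolding carrier_KF by blast

lemma mem_frac_class: "s \<in> points \<Longrightarrow> r \<in> fractions F \<Longrightarrow>
    r' \<in> frac_class F r \<longleftrightarrow> r' \<in> fractions F \<and> val s r' = val s r"
  by (auto simp: frac_class_def frac_rel_iff)

lemma Val_frac_class:
  assumes "s \<in> points" "r \<in> fractions F"
  shows "Val s (frac_class F r) = val s r"
proof -
  have "r \<in> frac_class F r" using assms by (simp add: mem_frac_class)
  then have "(SOME r'. r' \<in> frac_class F r) \<in> frac_class F r" by (rule someI)
  then show ?thesis using assms by (simp add: mem_frac_class Val_def)
qed

lemma carrier_mem:
  assumes "A \<in> carrier KF" "s \<in> points"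
  shows "r \<in> A \<longleftrightarrow> r \<in> fractions F \<and> val s r = Val s A"
  using assms by (auto simp: carrier_KF mem_frac_class Val_frac_class)

lemma carrier_obtain:
  assumes "A \<in> carrier KF"
  obtains G H where "(G, H) \<in> fractions F" "A = frac_class F (G, H)"
  using assms by (auto simp: carrier_KF)

lemma Val_inj:
  assumes "A \<in> carrier KF" "B \<in> carrier KF" "s \<in> points" "Val s A = Val s B"
  shows "A = B"
  by (rule Set.set_eqI)
     (simp only: carrier_mem[OF assms(1,3)] carrier_mem[OF assms(2,3)] assms(4))

lemma frac_class_eqI:
  assumes "r \<in> fractions F" "r' \<in> fractions F" "s \<in> points" "val s r = val s r'"
  shows "frac_class F r = frac_class F r'"
  using assms by (intro Val_inj[of _ _ s]) (simp_all add: frac_class_carrier Val_frac_class)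

lemma fractions_mult:
  assumes "(G, H) \<in> fractions F" "(G', H') \<in> fractions F"
  shows "(G * G', H * H') \<in> fractions F"
    and "s \<in> points \<Longrightarrow> val s (G * G', H * H') = val s (G, H) * val s (G', H')"
proof -
  obtain d where d: "is_form d G" "is_form d H" "E (0, 1, 0) H \<noteq> 0" by (rule fractionsD[OF assms(1) points_nonempty])
  obtain d' where d': "is_form d' G'" "is_form d' H'" "E (0, 1, 0) H' \<noteq> 0" by (rule fractionsD[OF assms(2) points_nonempty])
  show "(G * G', H * H') \<in> fractions F"
    using d d' by (intro fractionsI[of "d + d'" _ _ "(0, 1, 0)"] is_form_mult points_nonempty) (simp_all add: rhom_mult[OF rhom_E])
  show "s \<in> points \<Longrightarrow> val s (G * G', H * H') = val s (G, H) * val s (G', H')"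
    by (simp add: val_def rhom_mult[OF rhom_E] fls_times_fps_to_fls)
qed

lemma KF_mult:
  assumes "A \<in> carrier KF" "B \<in> carrier KF"
  shows "A \<otimes>\<^bsub>KF\<^esub> B \<in> carrier KF" and "s \<in> points \<Longrightarrow> Val s (A \<otimes>\<^bsub>KF\<^esub> B) = Val s A * Val s B"
proof -
  obtain G H where A: "(G, H) \<in> fractions F" "A = frac_class F (G, H)" by (rule carrier_obtain[OF assms(1)])
  obtain G' H' where B: "(G', H') \<in> fractions F" "B = frac_class F (G', H')" by (rule carrier_obtain[OF assms(2)])
  \<comment> \<open>The union in the definition of the product runs over equal classes, so it
    collapses to one of them.\<close>
  have const: "frac_class F (g * g', h * h') = frac_class F (G * G', H * H')"
    if "(g, h) \<in> A" "(g', h') \<in> B" for g h g' h'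
  proof (rule frac_class_eqI[OF _ _ points_nonempty])
    have gh: "(g, h) \<in> fractions F" "(g', h') \<in> fractions F"
      "val (0, 1, 0) (g, h) = val (0, 1, 0) (G, H)" "val (0, 1, 0) (g', h') = val (0, 1, 0) (G', H')"
      using that A B by (simp_all add: mem_frac_class[OF points_nonempty])
    then show "(g * g', h * h') \<in> fractions F" "(G * G', H * H') \<in> fractions F"
      using A B by (auto intro: fractions_mult)
    show "val (0, 1, 0) (g * g', h * h') = val (0, 1, 0) (G * G', H * H')"
      using gh A B by (simp add: fractions_mult points_nonempty)
  qed
  have mem: "(G, H) \<in> A" "(G', H') \<in> B"
    using A B by (simp_all add: mem_frac_class[OF points_nonempty])
  have "A \<otimes>\<^bsub>KF\<^esub> B = (\<Union>(g, h)\<in>A. \<Union>(g', h')\<in>B. frac_class F (g * g', h * h'))"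
    by (simp add: function_field_def)
  also have "\<dots> = (\<Union>r\<in>A. \<Union>r'\<in>B. frac_class F (G * G', H * H'))"
  proof (intro SUP_cong refl)
    fix r assume "r \<in> A"
    then show "(case r of (g, h) \<Rightarrow> \<Union>(g', h')\<in>B. frac_class F (g * g', h * h')) =
      (\<Union>r'\<in>B. frac_class F (G * G', H * H'))"
      using const by (cases r) (auto intro!: SUP_cong split: prod.splits simp del: UN_constant UN_simps)
  qed
  also have "\<dots> = frac_class F (G * G', H * H')" using mem by auto
  finally have "A \<otimes>\<^bsub>KF\<^esub> B = frac_class F (G * G', H * H')" .
  then show "A \<otimes>\<^bsub>KF\<^esub> B \<in> carrier KF" "s \<in> points \<Longrightarrow> Val s (A \<otimes>\<^bsub>KF\<^esub> B) = Val s A * Val s B"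
    using A B fractions_mult by (simp_all add: frac_class_carrier Val_frac_class)
qed

lemma fractions_one: "(1, 1) \<in> fractions F"
  by (rule fractionsI[OF is_form_1 is_form_1 points_nonempty]) (simp add: rhom_1[OF rhom_E])

lemma KF_one: "\<one>\<^bsub>KF\<^esub> \<in> carrier KF" "s \<in> points \<Longrightarrow> Val s \<one>\<^bsub>KF\<^esub> = 1"
proof -
  have "\<one>\<^bsub>KF\<^esub> = frac_class F (1, 1)" by (simp add: function_field_def)
  then show "\<one>\<^bsub>KF\<^esub> \<in> carrier KF" "s \<in> points \<Longrightarrow> Val s \<one>\<^bsub>KF\<^esub> = 1"
    using fractions_one by (simp_all add: frac_class_carrier Val_frac_class val_def rhom_1[OF rhom_E])
qed

lemma KF_pow:
  assumes "A \<in> carrier KF"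
  shows "A [^]\<^bsub>KF\<^esub> (n :: nat) \<in> carrier KF" and "s \<in> points \<Longrightarrow> Val s (A [^]\<^bsub>KF\<^esub> n) = Val s A ^ n"
proof -
  have "A [^]\<^bsub>KF\<^esub> n \<in> carrier KF \<and> (s \<in> points \<longrightarrow> Val s (A [^]\<^bsub>KF\<^esub> n) = Val s A ^ n)"
    by (induction n) (use assms in \<open>simp_all add: nat_pow_def KF_one KF_mult mult.commute\<close>)
  then show "A [^]\<^bsub>KF\<^esub> n \<in> carrier KF" "s \<in> points \<Longrightarrow> Val s (A [^]\<^bsub>KF\<^esub> n) = Val s A ^ n"
    by simp_all
qed

lemma KF_inverse:
  assumes "A \<in> carrier KF" "s \<in> points" "Val s A \<noteq> 0"
  obtains B where "B \<in> carrier KF" "Val s B = inverse (Val s A)"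
proof -
  obtain G H where A: "(G, H) \<in> fractions F" "A = frac_class F (G, H)" by (rule carrier_obtain[OF assms(1)])
  obtain d where d: "is_form d G" "is_form d H" "E s H \<noteq> 0" by (rule fractionsD[OF A(1) assms(2)])
  have v: "Val s A = val s (G, H)" using A assms by (simp add: Val_frac_class)
  then have "E s G \<noteq> 0" using assms(3) by (auto simp: val_def)
  then have "(H, G) \<in> fractions F" by (rule fractionsI[OF d(2,1) assms(2)])
  then show ?thesis using assms(2) v
    by (intro that[of "frac_class F (H, G)"]) (simp_all add: frac_class_carrier Val_frac_class val_def)
qed

lemma subdegree_val:
  assumes "(G, H) \<in> fractions F" "s \<in> points" "E s G \<noteq> 0"
  shows "fls_subdegree (val s (G, H)) = int (subdegree (E s G)) - int (subdegree (E s H))"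
    and "val s (G, H) \<noteq> 0"
proof -
  obtain d where "E s H \<noteq> 0" by (rule fractionsD[OF assms(1,2)])
  then show "fls_subdegree (val s (G, H)) = int (subdegree (E s G)) - int (subdegree (E s H))"
    "val s (G, H) \<noteq> 0"
    using assms(3) by (simp_all add: val_def fls_divide_subdegree fls_subdegree_fls_to_fps)
qed

lemma good_representative:
  assumes A: "A \<in> carrier KF" and s: "s \<in> points" and nn: "fls_subdegree (Val s A) \<ge> 0"
  obtains G H where "(G, H) \<in> A" "eval3 H s \<noteq> 0"
proof -
  obtain T M :: "'k poly3" where TM: "is_form 1 T" "is_form 1 M" "subdegree (E s T) = 1" "eval3 M s = 1"
    and div: "\<And>d n G. is_form d G \<Longrightarrow> E s G = 0 \<or> n \<le> subdegree (E s G) \<Longrightarrow>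
      \<exists>U V k l. is_form k U \<and> eval3 U s \<noteq> 0 \<and> is_form l V \<and> k + d = l + n \<and> F dvd U * G - V * T ^ n"
    by (rule local_parameter[OF s], rule that)
  obtain G H where GH: "(G, H) \<in> fractions F" "A = frac_class F (G, H)" by (rule carrier_obtain[OF A])
  obtain d where d: "is_form d G" "is_form d H" "E s H \<noteq> 0" by (rule fractionsD[OF GH(1) s])
  have v: "Val s A = val s (G, H)" using GH s by (simp add: Val_frac_class)
  \<comment> \<open>\<open>T ^ n\<close> is split off numerator and denominator, with
    \<open>n\<close> the order of the denominator. This leaves \<open>V * U'\<close> over
    \<open>V' * U\<close>, where \<open>V'\<close> has order 0 and hence does not vanish.\<close>
  define n where "n = subdegree (E s H)"
  have "E s G = 0 \<or> n \<le> subdegree (E s G)"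
    using subdegree_val(1)[OF GH(1) s] nn v by (cases "E s G = 0") (simp_all add: n_def)
  from div[OF d(1) this] obtain U V k l where U: "is_form k U" "eval3 U s \<noteq> 0" "is_form l V" "k + d = l + n"
    "F dvd U * G - V * T ^ n" by blast
  obtain U' V' k' l' where U': "is_form k' U'" "eval3 U' s \<noteq> 0" "is_form l' V'" "k' + d = l' + n"
    "F dvd U' * H - V' * T ^ n" using div[OF d(2), of n] by (auto simp: n_def)
  have T0: "E s T \<noteq> 0" using TM by auto
  have nz: "E s p \<noteq> 0" "subdegree (E s p) = 0" if "eval3 p s \<noteq> 0" for p
    using that E_nth_0[OF s, of p] by auto
  have e: "E s U * E s G = E s V * E s T ^ n" using E_dvd[OF s U(5)] by (simp add: rhom_simps[OF rhom_E])
  have e': "E s U' * E s H = E s V' * E s T ^ n" using E_dvd[OF s U'(5)] by (simp add: rhom_simps[OF rhom_E])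
  have V0: "E s V' \<noteq> 0" using e' d(3) nz(1)[OF U'(2)] by auto
  have "subdegree (E s U') + subdegree (E s H) = subdegree (E s V') + n"
    using arg_cong[OF e', of subdegree] nz(1)[OF U'(2)] d(3) V0 T0 TM by simp
  then have "subdegree (E s V') = 0" using nz(2)[OF U'(2)] by (simp add: n_def)
  then have "eval3 V' s \<noteq> 0" using V0 E_nth_0[OF s, of V'] by (simp add: subdegree_eq_0_iff)
  then have nzH: "eval3 (V' * U) s \<noteq> 0" using U(2) by (simp add: rhom_mult[OF rhom_eval3])
  have f1: "is_form (l + k') (V * U')" by (rule is_form_mult[OF U(3) U'(1)])
  have f2: "is_form (l + k') (V' * U)" using is_form_mult[OF U'(3) U(1)] U(4) U'(4) by (simp add: add.commute)
      (metis add.commute add_left_cancel group_cancel.add1)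
  have fr: "(V * U', V' * U) \<in> fractions F" by (rule fractionsI[OF f1 f2 s nz(1)[OF nzH]])
  have "E s V * E s U' * E s H = E s V * (E s V' * E s T ^ n)" using e' by (simp add: mult.assoc)
  also have "\<dots> = E s V' * (E s U * E s G)" using e by (simp add: mult_ac)
  finally have "E s (V * U') * E s H = E s G * E s (V' * U)"
    by (simp add: rhom_mult[OF rhom_E] mult_ac)
  then have "fps_to_fls (E s (V * U')) * fps_to_fls (E s H) = fps_to_fls (E s G) * fps_to_fls (E s (V' * U))"
    by (simp flip: fls_times_fps_to_fls)
  then have "val s (V * U', V' * U) = val s (G, H)"
    using nz(1)[OF nzH] d(3) by (simp add: val_def frac_eq_eq)
  then have "(V * U', V' * U) \<in> A" using fr v by (simp add: carrier_mem[OF A s])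
  then show ?thesis using nzH by (rule that)
qed

lemma mem_form: "A \<in> carrier KF \<Longrightarrow> (G, H) \<in> A \<Longrightarrow> \<exists>d. is_form d G \<and> is_form d H"
  using carrier_mem[OF _ points_nonempty] fractionsD[OF _ points_nonempty] by metis

lemma good_subdegree:
  assumes "A \<in> carrier KF" "s \<in> points" "(G, H) \<in> A" "eval3 H s \<noteq> 0"
  shows "fls_subdegree (Val s A) \<ge> 0"
    and "eval3 G s = 0 \<longleftrightarrow> Val s A = 0 \<or> fls_subdegree (Val s A) \<ge> 1"
proof -
  have fr: "(G, H) \<in> fractions F" and v: "Val s A = val s (G, H)"
    using assms carrier_mem[OF assms(1,2)] by auto
  have H: "subdegree (E s H) = 0" using assms(4) E_nth_0[OF assms(2), of H] by simp
  have G: "eval3 G s = 0 \<longleftrightarrow> E s G = 0 \<or> subdegree (E s G) \<ge> 1"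
    using E_nth_0[OF assms(2), of G] subdegree_eq_0_iff[of "E s G"] by auto
  show "fls_subdegree (Val s A) \<ge> 0"
    "eval3 G s = 0 \<longleftrightarrow> Val s A = 0 \<or> fls_subdegree (Val s A) \<ge> 1"
    using subdegree_val[OF fr assms(2)] H G v by (cases "E s G = 0"; simp add: val_def)+
qed

section \<open>Local rings, uniformizers and pole orders\<close>

lemma regular_at_iff:
  assumes s: "s \<in> points"
  shows "A \<in> regular_at F (proj_point s) \<longleftrightarrow> A \<in> carrier KF \<and> fls_subdegree (Val s A) \<ge> 0"
proof
  assume "A \<in> regular_at F (proj_point s)"
  then obtain G H where *: "A \<in> carrier KF" "(G, H) \<in> A" "\<forall>v\<in>proj_point s. eval3 H v \<noteq> 0"
    by (auto simp: regular_at_def)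
  then have "eval3 H s \<noteq> 0" using proj_point_self by blast
  then show "A \<in> carrier KF \<and> fls_subdegree (Val s A) \<ge> 0" using * good_subdegree(1)[OF _ s] by blast
next
  assume *: "A \<in> carrier KF \<and> fls_subdegree (Val s A) \<ge> 0"
  then obtain G H where GH: "(G, H) \<in> A" "eval3 H s \<noteq> 0" using good_representative[OF _ s] by blast
  moreover obtain d where "is_form d H" using mem_form[of A] * GH by blast
  ultimately show "A \<in> regular_at F (proj_point s)"
    using * eval3_point(1)[of d H s] by (auto simp: regular_at_def)
qed

text \<open>The zero function is listed separately because
  \<open>fls_subdegree 0 = 0\<close>.\<close>

lemma max_ideal_at_iff:
  assumes s: "s \<in> points"
  shows "A \<in> max_ideal_at F (proj_point s) \<longleftrightarrow>
    A \<in> carrier KF \<and> (Val s A = 0 \<or> fls_subdegree (Val s A) \<ge> 1)"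
proof
  assume "A \<in> max_ideal_at F (proj_point s)"
  then obtain G H where *: "A \<in> carrier KF" "(G, H) \<in> A" "\<forall>v\<in>proj_point s. eval3 H v \<noteq> 0 \<and> eval3 G v = 0"
    by (auto simp: max_ideal_at_def)
  then have "eval3 H s \<noteq> 0" "eval3 G s = 0" using proj_point_self by blast+
  then show "A \<in> carrier KF \<and> (Val s A = 0 \<or> fls_subdegree (Val s A) \<ge> 1)"
    using * good_subdegree(2)[OF _ s] by blast
next
  assume *: "A \<in> carrier KF \<and> (Val s A = 0 \<or> fls_subdegree (Val s A) \<ge> 1)"
  then have "fls_subdegree (Val s A) \<ge> 0" by auto
  then obtain G H where GH: "(G, H) \<in> A" "eval3 H s \<noteq> 0" using good_representative[OF _ s] * by blast
  moreover have "eval3 G s = 0" using good_subdegree(2)[OF _ s GH] * by blast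
  moreover obtain d where "is_form d G" "is_form d H" using mem_form[of A] * GH by blast
  ultimately show "A \<in> max_ideal_at F (proj_point s)"
    using * eval3_point(1)[of d H s] eval3_point(2)[of d G s] unfolding max_ideal_at_def by blast
qed

lemma local_ring_simps:
  "carrier (local_ring F S) = regular_at F S" "a \<otimes>\<^bsub>local_ring F S\<^esub> b = a \<otimes>\<^bsub>KF\<^esub> b"
  "\<one>\<^bsub>local_ring F S\<^esub> = \<one>\<^bsub>KF\<^esub>"
  by (simp_all add: local_ring_def)

lemma uniformizer_exists:
  assumes s: "s \<in> points"
  obtains A where "A \<in> carrier KF" "fls_subdegree (Val s A) = 1"
proof -
  obtain T M :: "'k poly3" where TM: "is_form 1 T" "is_form 1 M" "subdegree (E s T) = 1" "eval3 M s = 1"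
    using local_parameter[OF s] by metis
  have M: "E s M \<noteq> 0" "subdegree (E s M) = 0" using TM(4) E_nth_0[OF s, of M] by auto
  have fr: "(T, M) \<in> fractions F" by (rule fractionsI[OF TM(1,2) s M(1)])
  have "E s T \<noteq> 0" using TM(3) by auto
  then show ?thesis using fr s TM(3) M
    by (intro that[of "frac_class F (T, M)"]) (simp_all add: frac_class_carrier Val_frac_class subdegree_val)
qed

text \<open>A generator must divide the function of order 1 from \<open>uniformizer_exists\<close>,
  so its order is at most 1. Conversely, dividing by a function of order 1 keeps orders of elements
  of the maximal ideal nonnegative.\<close>

lemma uniformizer_iff:
  assumes s: "s \<in> points"
  shows "uniformizer F (proj_point s) t \<longleftrightarrow> t \<in> carrier KF \<and> fls_subdegree (Val s t) = 1"
proof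
  assume u: "uniformizer F (proj_point s) t"
  then have t: "t \<in> carrier KF"
    and id: "{x \<otimes>\<^bsub>KF\<^esub> t | x. x \<in> regular_at F (proj_point s)} = max_ideal_at F (proj_point s)"
    by (auto simp: uniformizer_def cgenideal_def local_ring_simps regular_at_iff[OF s])
  have "\<one>\<^bsub>KF\<^esub> \<in> regular_at F (proj_point s)" by (simp add: regular_at_iff[OF s] KF_one s)
  then have "\<one>\<^bsub>KF\<^esub> \<otimes>\<^bsub>KF\<^esub> t \<in> max_ideal_at F (proj_point s)" using id by blast
  then have 1: "Val s t = 0 \<or> fls_subdegree (Val s t) \<ge> 1"
    by (simp add: max_ideal_at_iff[OF s] KF_mult KF_one t s)
  obtain p where p: "p \<in> carrier KF" "fls_subdegree (Val s p) = 1" by (rule uniformizer_exists[OF s])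
  then have "p \<in> max_ideal_at F (proj_point s)" by (simp add: max_ideal_at_iff[OF s])
  then obtain x where x: "x \<in> regular_at F (proj_point s)" "p = x \<otimes>\<^bsub>KF\<^esub> t" using id by blast
  then have xc: "x \<in> carrier KF" "fls_subdegree (Val s x) \<ge> 0" by (simp_all add: regular_at_iff[OF s])
  have v: "Val s p = Val s x * Val s t" using x xc t s by (simp add: KF_mult)
  moreover have "Val s p \<noteq> 0" using p by auto
  ultimately have "Val s x \<noteq> 0" "Val s t \<noteq> 0" by auto
  then have "1 = fls_subdegree (Val s x) + fls_subdegree (Val s t)" using p v by simp
  then show "t \<in> carrier KF \<and> fls_subdegree (Val s t) = 1"
    using t xc 1 \<open>Val s t \<noteq> 0\<close> by auto
next
  assume t: "t \<in> carrier KF \<and> fls_subdegree (Val s t) = 1"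
  then have t0: "Val s t \<noteq> 0" by auto
  have "{x \<otimes>\<^bsub>KF\<^esub> t | x. x \<in> regular_at F (proj_point s)} = max_ideal_at F (proj_point s)"
  proof (intro equalityI subsetI)
    fix a assume "a \<in> {x \<otimes>\<^bsub>KF\<^esub> t | x. x \<in> regular_at F (proj_point s)}"
    then obtain x where x: "x \<in> carrier KF" "fls_subdegree (Val s x) \<ge> 0" "a = x \<otimes>\<^bsub>KF\<^esub> t"
      by (auto simp: regular_at_iff[OF s])
    then show "a \<in> max_ideal_at F (proj_point s)"
      using t t0 s by (cases "Val s x = 0") (simp_all add: max_ideal_at_iff KF_mult)
  next
    fix a assume "a \<in> max_ideal_at F (proj_point s)"
    then have a: "a \<in> carrier KF" "Val s a = 0 \<or> fls_subdegree (Val s a) \<ge> 1"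
      by (simp_all add: max_ideal_at_iff[OF s])
    obtain u where u: "u \<in> carrier KF" "Val s u = inverse (Val s t)"
      using KF_inverse[of t s] t t0 s by blast
    have x: "a \<otimes>\<^bsub>KF\<^esub> u \<in> carrier KF" "Val s (a \<otimes>\<^bsub>KF\<^esub> u) = Val s a * inverse (Val s t)"
      using a u s by (simp_all add: KF_mult)
    have "a \<otimes>\<^bsub>KF\<^esub> u \<in> regular_at F (proj_point s)"
      using x a(2) t t0 s by (cases "Val s a = 0") (simp_all add: regular_at_iff fls_inverse_subdegree)
    moreover have "a = (a \<otimes>\<^bsub>KF\<^esub> u) \<otimes>\<^bsub>KF\<^esub> t"
      using x a t t0 s by (intro Val_inj[OF _ _ s]) (simp_all add: KF_mult)
    ultimately show "a \<in> {x \<otimes>\<^bsub>KF\<^esub> t | x. x \<in> regular_at F (proj_point s)}" by blast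
  qed
  then show "uniformizer F (proj_point s) t"
    using t s by (auto simp: uniformizer_def cgenideal_def local_ring_simps regular_at_iff)
qed

lemma local_Units_iff:
  assumes s: "s \<in> points"
  shows "A \<in> Units (local_ring F (proj_point s)) \<longleftrightarrow>
    A \<in> carrier KF \<and> Val s A \<noteq> 0 \<and> fls_subdegree (Val s A) = 0"
proof
  assume "A \<in> Units (local_ring F (proj_point s))"
  then obtain B where A: "A \<in> regular_at F (proj_point s)" and B: "B \<in> regular_at F (proj_point s)"
    and AB: "B \<otimes>\<^bsub>KF\<^esub> A = \<one>\<^bsub>KF\<^esub>"
    by (auto simp: Units_def local_ring_simps)
  then have c: "A \<in> carrier KF" "B \<in> carrier KF" "fls_subdegree (Val s A) \<ge> 0" "fls_subdegree (Val s B) \<ge> 0"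
    by (simp_all add: regular_at_iff[OF s])
  have v: "Val s B * Val s A = 1" using AB c s KF_mult(2)[of B A s] KF_one(2)[OF s] by simp
  then have nz: "Val s A \<noteq> 0" "Val s B \<noteq> 0" by auto
  have "fls_subdegree (Val s B) + fls_subdegree (Val s A) = 0"
    using arg_cong[OF v, of fls_subdegree] nz by simp
  then show "A \<in> carrier KF \<and> Val s A \<noteq> 0 \<and> fls_subdegree (Val s A) = 0" using c nz by auto
next
  assume *: "A \<in> carrier KF \<and> Val s A \<noteq> 0 \<and> fls_subdegree (Val s A) = 0"
  then obtain B where B: "B \<in> carrier KF" "Val s B = inverse (Val s A)"
    using KF_inverse[of A s] s by blast
  have "B \<otimes>\<^bsub>KF\<^esub> A = \<one>\<^bsub>KF\<^esub>" "A \<otimes>\<^bsub>KF\<^esub> B = \<one>\<^bsub>KF\<^esub>"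
    using * B s by (simp_all add: Val_inj[OF _ _ s] KF_mult KF_one)
  then show "A \<in> Units (local_ring F (proj_point s))"
    using * B s by (auto simp: Units_def local_ring_simps regular_at_iff fls_inverse_subdegree intro!: bexI[of _ B])
qed

theorem pole_order_eq:
  assumes s: "s \<in> points" and A: "A \<in> carrier KF"
  shows "pole_order F A (proj_point s) = nat (- fls_subdegree (Val s A))"
proof (cases "fls_subdegree (Val s A) \<ge> 0")
  case True
  then show ?thesis using A by (simp add: pole_order_def regular_at_iff[OF s])
next
  case False
  then have v0: "Val s A \<noteq> 0" by auto
  \<comment> \<open>For every uniformizer the product is a unit exactly when \<open>n\<close> plus
    the order of \<open>A\<close> is 0, so the definite description has a unique solution that does
    not depend on \<open>t\<close>.\<close>
  have *: "(\<exists>t. uniformizer F (proj_point s) t \<and>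
      (t [^]\<^bsub>KF\<^esub> n) \<otimes>\<^bsub>KF\<^esub> A \<in> Units (local_ring F (proj_point s))) \<longleftrightarrow>
      n = nat (- fls_subdegree (Val s A))" (is "?L \<longleftrightarrow> _") for n
  proof -
    have U: "(t [^]\<^bsub>KF\<^esub> n) \<otimes>\<^bsub>KF\<^esub> A \<in> Units (local_ring F (proj_point s)) \<longleftrightarrow>
       int n + fls_subdegree (Val s A) = 0" if "t \<in> carrier KF" "fls_subdegree (Val s t) = 1" for t
    proof -
      have "Val s t \<noteq> 0" using that by auto
      then show ?thesis using that A s v0
        by (simp add: local_Units_iff KF_mult KF_pow fls_subdegree_pow)
    qed
    obtain p where p: "p \<in> carrier KF" "fls_subdegree (Val s p) = 1" by (rule uniformizer_exists[OF s])
    have "?L \<longleftrightarrow> int n + fls_subdegree (Val s A) = 0"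
      unfolding uniformizer_iff[OF s] using U p by blast
    then show ?thesis using False by auto
  qed
  show ?thesis using False A unfolding pole_order_def * by (simp add: regular_at_iff[OF s])
qed

section \<open>A residue theorem\<close>

lemma expand_affine_linear:
  "expand_affine x y [:[:- x0, 1:]:] = fps_const (x - x0) + fps_X"
proof -
  have "expand_affine x y [:[:- x0, 1:]:] = eval_hom fps_const (fps_const x + fps_X) [:- x0, 1:]"
    unfolding expand_affine_def by (rule eval_hom_const) (intro rhom_eval_hom rhom_fps_const)
  also have "\<dots> = fps_const (x - x0) + fps_X"
    by (simp add: eval_hom_pCons eval_hom_0 rhom_fps_const algebra_simps flip: fps_const_sub fps_const_neg)
  finally show ?thesis .
qed

lemma expand_infinity_linear: "expand_infinity [:[:- x0, 1:]:] \<noteq> 0" "fls_subdegree (expand_infinity [:[:- x0, 1:]:]) = - int q"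
proof -
  have "expand_infinity [:[:- x0, 1:]:] = eval_hom fls_const xi [:- x0, 1:]"
    unfolding expand_infinity_def by (rule eval_hom_const) (intro rhom_eval_hom rhom_fls_const)
  then show "expand_infinity [:[:- x0, 1:]:] \<noteq> 0" "fls_subdegree (expand_infinity [:[:- x0, 1:]:]) = - int q"
    using eval_hom_fls_subdegree[of "[:- x0, 1:]" xi] q2 by (simp_all add: subdegree_xi)
qed

lemma subdegree_expand_infinity_dehom:
  assumes "is_form d p" "E (0, 1, 0) p \<noteq> 0"
  shows "expand_infinity (dehom p) \<noteq> 0"
    and "fls_subdegree (expand_infinity (dehom p)) = int (subdegree (E (0, 1, 0) p)) - int ((q + 1) * d)"
proof -
  have e: "fps_to_fls (E (0, 1, 0) p) = fps_to_fls zeta ^ d * expand_infinity (dehom p)" by (rule E_inf[OF assms(1)])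
  then show nz: "expand_infinity (dehom p) \<noteq> 0" using assms(2) by auto
  have "int (subdegree (E (0, 1, 0) p)) = fls_subdegree (fps_to_fls zeta ^ d * expand_infinity (dehom p))"
    unfolding e[symmetric] by (simp add: fls_subdegree_fls_to_fps)
  also have "\<dots> = int d * int (q + 1) + fls_subdegree (expand_infinity (dehom p))"
    using nz zeta_nz by (simp add: fls_subdegree_pow fls_subdegree_fls_to_fps subdegree_zeta)
  finally show "fls_subdegree (expand_infinity (dehom p)) = int (subdegree (E (0, 1, 0) p)) - int ((q + 1) * d)"
    by (simp add: algebra_simps)
qed

text \<open>The forms of degree \<open>q - 2\<close> are the regular differentials, so \<open>N / H\<close> plays the role of a
  differential whose only pole is simple: it would have a nonzero residue there and no other one.\<close>

lemma no_single_simple_pole: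
  assumes N: "is_form (d + (q - 2)) N" and H: "is_form d H" and nz: "\<not> F dvd N" "\<not> F dvd H"
    and p: "p \<in> points" "subdegree (E p H) = subdegree (E p N) + 1"
    and reg: "\<And>s. s \<in> points \<Longrightarrow> s \<noteq> p \<Longrightarrow> subdegree (E s H) \<le> subdegree (E s N)"
  shows False
proof -
  have inf: "(0, 1, 0) \<in> points" by (simp add: points_def)
  have EN: "E s N \<noteq> 0" and EH: "E s H \<noteq> 0" if "s \<in> points" for s
    using E_eq_0_iff[OF that N] E_eq_0_iff[OF that H] nz by simp_all
  have fH: "\<not> f dvd dehom H" using f_dvd_dehom[OF H] nz by blast
  have aff: "(x, y, 1) \<in> points" if "y ^ q + y = x ^ (q + 1)" for x y :: 'k
    using that by (simp add: points_def)
  have psiN: "expand_infinity (dehom N) \<noteq> 0"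
      "fls_subdegree (expand_infinity (dehom N)) = int (subdegree (E (0, 1, 0) N)) - int ((q + 1) * (d + (q - 2)))"
    and psiH: "expand_infinity (dehom H) \<noteq> 0"
      "fls_subdegree (expand_infinity (dehom H)) = int (subdegree (E (0, 1, 0) H)) - int ((q + 1) * d)"
    using subdegree_expand_infinity_dehom[OF N EN[OF inf]] subdegree_expand_infinity_dehom[OF H EH[OF inf]] by simp_all
  obtain m where m: "q = m + 2" using q2 by (metis add.commute le_Suc_ex)
  from p(1) consider x0 y0 where "p = (x0, y0, 1)" "y0 ^ q + y0 = x0 ^ (q + 1)" | "p = (0, 1, 0)"
    by (auto simp: points_def)
  then show False
  proof cases
    case 1
    \<comment> \<open>The factor \<open>X - x0\<close> cancels the simple pole at \<open>p\<close>
      and adds a zero at the other \<open>q - 1\<close> points above \<open>x0\<close>. The quotient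
      becomes a polynomial \<open>g\<close> that vanishes at all points of this fibre except
      \<open>p\<close>.\<close>
    define L :: "'k Polynomial.poly Polynomial.poly" where "L = [:[:- x0, 1:]:]"
    define N' where "N' = L * dehom N"
    have paN': "expand_affine x y N' = (fps_const (x - x0) + fps_X) * E (x, y, 1) N" for x y :: 'k
      by (simp only: N'_def rhom_mult[OF rhom_expand_affine] L_def expand_affine_linear E_affine)
    have paX: "expand_affine x0 y N' = fps_X * E (x0, y, 1) N" for y :: 'k
      unfolding paN' by simp
    have "\<exists>g. Polynomial.degree g < q \<and> f dvd N' - g * dehom H"
    proof (rule affine_regular[OF fH])
      fix x y :: 'k assume xy: "y ^ q + y = x ^ (q + 1)"
      have "subdegree (E (x, y, 1) H) \<le> subdegree (expand_affine x y N')"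
      proof (cases "x = x0")
        case True
        have "subdegree (expand_affine x y N') = 1 + subdegree (E (x, y, 1) N)"
          using EN[OF aff[OF xy]] by (simp add: True paX)
        then show ?thesis using reg[OF aff[OF xy]] p(2) by (cases "(x, y, 1) = p") auto
      next
        case False
        then have "fps_nth (fps_const (x - x0) + fps_X) 0 \<noteq> 0" by simp
        then have "subdegree (fps_const (x - x0) + fps_X) = 0" "fps_const (x - x0) + fps_X \<noteq> 0"
          by (rule subdegree_eq_0, metis fps_zero_nth)
        then have "subdegree (expand_affine x y N') = subdegree (E (x, y, 1) N)"
          using EN[OF aff[OF xy]] by (simp add: paN')
        then show ?thesis using reg[OF aff[OF xy]] False 1 by auto
      qed
      then show "expand_affine x y N' = 0 \<or> subdegree (expand_affine x y (dehom H)) \<le> subdegree (expand_affine x y N')"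
        by (simp add: E_affine)
    qed
    then obtain g where g: "Polynomial.degree g < q" "f dvd N' - g * dehom H" by blast
    have pag: "fps_X * E (x0, y, 1) N = expand_affine x0 y g * E (x0, y, 1) H" if "y ^ q + y = x0 ^ (q + 1)" for y :: 'k
      using expand_affine_dvd[OF that g(2)] by (simp add: rhom_simps[OF rhom_expand_affine] paX E_affine)
    have sub: "1 + subdegree (E (x0, y, 1) N) = subdegree (expand_affine x0 y g) + subdegree (E (x0, y, 1) H)"
      "expand_affine x0 y g \<noteq> 0" if y: "y ^ q + y = x0 ^ (q + 1)" for y :: 'k
    proof -
      show nz: "expand_affine x0 y g \<noteq> 0" using pag[OF y] EN[OF aff[OF y]] by auto
      show "1 + subdegree (E (x0, y, 1) N) = subdegree (expand_affine x0 y g) + subdegree (E (x0, y, 1) H)"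
        using arg_cong[OF pag[OF y], of subdegree] EN[OF aff[OF y]] EH[OF aff[OF y]] nz by simp
    qed
    have "expand_infinity N' = expand_infinity g * expand_infinity (dehom H)"
      using expand_infinity_dvd[OF g(2)] by (simp add: rhom_simps[OF rhom_expand_infinity])
    then have quot: "expand_infinity L * expand_infinity (dehom N) = expand_infinity g * expand_infinity (dehom H)"
      by (simp only: N'_def rhom_mult[OF rhom_expand_infinity])
    then have pg: "expand_infinity g \<noteq> 0" using psiN expand_infinity_linear(1)[of x0] by (auto simp: L_def)
    have "fls_subdegree (expand_infinity L) + fls_subdegree (expand_infinity (dehom N)) = fls_subdegree (expand_infinity g) + fls_subdegree (expand_infinity (dehom H))"
      using arg_cong[OF quot, of fls_subdegree] pg psiN(1) psiH(1) expand_infinity_linear(1)[of x0] by (simp add: L_def)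
    moreover have "subdegree (E (0, 1, 0) H) \<le> subdegree (E (0, 1, 0) N)"
      by (rule reg[OF inf]) (use 1 in auto)
    ultimately have low: "fls_subdegree (expand_infinity g) \<ge> - int ((q + 1) * (q - 2)) - int q"
      unfolding psiN(2) psiH(2) by (simp add: L_def expand_infinity_linear(2) algebra_simps)
    have g0: "g \<noteq> 0" using pg by (auto simp: rhom_0[OF rhom_expand_infinity])
    \<comment> \<open>A term with \<open>Y ^ (q - 1)\<close> has pole order at least
      \<open>q ^ 2 - 1\<close> at infinity, but that of \<open>g\<close> is at most
      \<open>(q + 1) * (q - 2) + q = q ^ 2 - 2\<close>.\<close>
    have "Polynomial.coeff g (q - 1) = 0"
    proof (rule ccontr)
      assume "Polynomial.coeff g (q - 1) \<noteq> 0"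
      note expand_infinity_small(3)[OF g0 g(1) this]
      also have "- int (q * Polynomial.degree (Polynomial.coeff g (q - 1)) + (q + 1) * (q - 1))
          \<le> - int ((q + 1) * (q - 1))"
        by (simp only: neg_le_iff_le of_nat_le_iff le_add2)
      finally have "fls_subdegree (expand_infinity g) \<le> - int ((q + 1) * (q - 1))" .
      then show False using low by (simp add: m algebra_simps)
    qed
    then have dg: "Polynomial.degree g < q - 1"
      using g(1) g0 by (metis Suc_diff_1 less_Suc_eq leading_coeff_0_iff not_less_zero gr_zeroI)
    define gx where "gx = map_poly (\<lambda>c. poly c x0) g"
    have gx: "poly gx y = poly (poly g [:y:]) x0" for y
      unfolding gx_def by (induction g) (auto simp: map_poly_pCons)
    have root: "poly gx y = 0" if y: "y ^ q + y = x0 ^ (q + 1)" "y \<noteq> y0" for y :: 'k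
    proof -
      have "subdegree (E (x0, y, 1) H) \<le> subdegree (E (x0, y, 1) N)"
        by (rule reg[OF aff[OF y(1)]]) (use 1 y in auto)
      then have "subdegree (expand_affine x0 y g) \<noteq> 0" using sub(1)[OF y(1)] by simp
      then have "fps_nth (expand_affine x0 y g) 0 = 0" using subdegree_eq_0 by blast
      then show ?thesis by (simp add: gx expand_affine_nth_0)
    qed
    \<comment> \<open>There are \<open>q - 1\<close> roots for a degree of at most
      \<open>q - 2\<close>. So \<open>g\<close> vanishes at \<open>y0\<close> as well, where its
      order was seen to be 0.\<close>
    have "gx = 0"
    proof (rule ccontr)
      assume nz: "gx \<noteq> 0"
      have "q - 1 = card ({y. y ^ q + y = x0 ^ (q + 1)} - {y0})"
        using fiber_card[of "x0 ^ (q + 1)"] fiber_finite[of "x0 ^ (q + 1)"] 1(2) by (subst card_Diff_singleton) auto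
      also have "\<dots> \<le> card {y. poly gx y = 0}"
        by (rule card_mono[OF poly_roots_finite[OF nz]]) (use root in auto)
      also have "\<dots> \<le> Polynomial.degree gx" by (rule card_poly_roots_bound[OF nz])
      also have "\<dots> \<le> Polynomial.degree g" unfolding gx_def by (rule map_poly_degree_leq)
      finally show False using dg by simp
    qed
    then have "poly gx y0 = 0" by simp
    then have "fps_nth (expand_affine x0 y0 g) 0 = 0" by (simp add: gx expand_affine_nth_0)
    moreover have "subdegree (expand_affine x0 y0 g) = 0" using sub(1)[OF 1(2)] p(2) 1(1) by simp
    ultimately show False using sub(2)[OF 1(2)] by (simp add: subdegree_eq_0_iff)
  next
    case 2
    have "\<exists>g. Polynomial.degree g < q \<and> f dvd dehom N - g * dehom H"
    proof (rule affine_regular[OF fH])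
      fix x y :: 'k assume xy: "y ^ q + y = x ^ (q + 1)"
      have "subdegree (E (x, y, 1) H) \<le> subdegree (E (x, y, 1) N)"
        by (rule reg[OF aff[OF xy]]) (use 2 in auto)
      then show "expand_affine x y (dehom N) = 0 \<or> subdegree (expand_affine x y (dehom H)) \<le> subdegree (expand_affine x y (dehom N))"
        by (simp add: E_affine)
    qed
    then obtain g where g: "Polynomial.degree g < q" "f dvd dehom N - g * dehom H" by blast
    have quot: "expand_infinity (dehom N) = expand_infinity g * expand_infinity (dehom H)"
      using expand_infinity_dvd[OF g(2)] by (simp add: rhom_simps[OF rhom_expand_infinity])
    then have pg: "expand_infinity g \<noteq> 0" using psiN by auto
    have "fls_subdegree (expand_infinity (dehom N)) = fls_subdegree (expand_infinity g) + fls_subdegree (expand_infinity (dehom H))"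
      using arg_cong[OF quot, of fls_subdegree] pg psiH(1) by simp
    then have sub: "fls_subdegree (expand_infinity g) = - 1 - int ((q + 1) * (q - 2))"
      unfolding psiN(2) psiH(2) using p(2) 2 by (simp add: algebra_simps)
    have "g \<noteq> 0" using pg by (auto simp: rhom_0[OF rhom_expand_infinity])
    from expand_infinity_small(2)[OF this g(1)] obtain j where j: "j < q"
      "fls_subdegree (expand_infinity g) = - int (q * Polynomial.degree (Polynomial.coeff g j) + (q + 1) * j)" by blast
    \<comment> \<open>The pole order would be \<open>q ^ 2 - q - 1\<close>, the largest integer not
      of the form \<open>q * c + (q + 1) * j\<close>: modulo \<open>q\<close> it forces
      \<open>j = q - 1\<close>, and then \<open>(q + 1) * j\<close> alone is too large.\<close>
    define c where "c = Polynomial.degree (Polynomial.coeff g j)"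
    have "int (q * c + (q + 1) * j) = int (1 + (q + 1) * (q - 2))" using sub j(2) by (simp add: c_def)
    then have eq: "q * c + (q + 1) * j = 1 + (q + 1) * (q - 2)" by (simp only: of_nat_eq_iff)
    then have "q * (c + j) + j = q * m + (m + 1)" by (simp add: m algebra_simps)
    moreover have "(q * k + r) mod q = r" if "r < q" for k r
      using that by simp
    ultimately have "j = m + 1" using j(1) m by (metis add_less_cancel_left one_less_numeral_iff semiring_norm(76))
    then show False using eq by (simp add: m algebra_simps)
  qed
qed

end

section \<open>Rational functions with poles on a line\<close>

text \<open>\<open>u ^ q + u\<close> is \<open>u\<close> times the unit
  \<open>u ^ (q - 1) + 1\<close>.\<close>

lemma artin_schreier_subdegree:
  fixes u v :: "'a :: field fps"
  assumes "u ^ q + u = v" "fps_nth u 0 = 0" "v \<noteq> 0" "q \<ge> 2"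
  shows "u \<noteq> 0" "subdegree u = subdegree v"
proof -
  show u: "u \<noteq> 0" using assms by (auto simp: power_0_left)
  define w where "w = u ^ (q - 1) + 1"
  have w: "fps_nth w 0 = 1" using assms(2,4) by (simp add: w_def fps_nth_power_0 power_0_left)
  then have w0: "w \<noteq> 0" by (metis fps_zero_nth zero_neq_one)
  have "v = u * w" using assms(1,4) by (simp add: w_def algebra_simps flip: power_Suc)
  then have "subdegree v = subdegree u + subdegree w" using u w0 by simp
  moreover have "subdegree w = 0" by (rule subdegree_eq_0) (simp add: w)
  ultimately show "subdegree u = subdegree v" by simp
qed

definition pole_bound :: "'p \<Rightarrow> 'p \<Rightarrow> 'p \<Rightarrow> nat \<Rightarrow> nat \<Rightarrow> nat \<Rightarrow> 'p \<Rightarrow> nat" where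
  "pole_bound P Q R a b c s = (if s = P then a else if s = Q then b else if s = R then c else 0)"

text \<open>The criterion for a function with pole order exactly \<open>a\<close> at the first point and at most
  \<open>b\<close> and \<open>c\<close> at the others; \<open>n\<close> is the number of rational points on the line.\<close>

definition pole_attained :: "nat \<Rightarrow> nat \<Rightarrow> nat \<Rightarrow> nat \<Rightarrow> bool" where
  "pole_attained n a b c \<longleftrightarrow>
     (let j = (n - a mod n) mod n in j \<le> (a + j) div n + (b + j) div n + (c + j) div n)"

text \<open>\<open>h\<close> stands for the embedding of the field with \<open>q ^ 2\<close>
  elements into its closure; \<open>frob2\<close> expresses that twofold application of the
  \<open>q\<close>-th power fixes this field.\<close>

locale hermitian_curve_over = hermitian_curve q e K for q e and K :: "'k :: alg_closed_field itself" +
  fixes h :: "'a :: field \<Rightarrow> 'k"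
  assumes rhom_h: "rhom h" and h_eq_0: "h x = 0 \<Longrightarrow> x = 0"
    and frob2: "(h x ^ q) ^ q = h x" and card_ge: "finite (UNIV :: 'a set)" "card (UNIV :: 'a set) \<ge> 4"
begin

section \<open>Tangents at rational points and lines through them\<close>

definition over_base :: "'k poly3 \<Rightarrow> bool" where
  "over_base p \<longleftrightarrow> (\<exists>G. p = map_poly3 h G)"

lemma over_base_mult: "over_base p \<Longrightarrow> over_base r \<Longrightarrow> over_base (p * r)"
  unfolding over_base_def by (metis rhom_mult[OF rhom_map_poly3[OF rhom_h]])

lemma over_base_add: "over_base p \<Longrightarrow> over_base r \<Longrightarrow> over_base (p + r)"
  unfolding over_base_def by (metis rhom_add[OF rhom_map_poly3[OF rhom_h]])

lemma over_base_diff: "over_base p \<Longrightarrow> over_base r \<Longrightarrow> over_base (p - r)"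
  unfolding over_base_def by (metis rhom_diff[OF rhom_map_poly3[OF rhom_h]])

lemma over_base_power: "over_base p \<Longrightarrow> over_base (p ^ m)"
  unfolding over_base_def by (metis rhom_power[OF rhom_map_poly3[OF rhom_h]])

lemma over_base_const3: "over_base (const3 (h c))"
  unfolding over_base_def by (metis map_poly3_const3[OF rhom_h])

lemma over_base_var: "over_base var_X" "over_base var_Y" "over_base var_Z"
  unfolding over_base_def by (metis map_poly3_var[OF rhom_h])+

definition rational_representatives :: "('k \<times> 'k \<times> 'k) set" where
  "rational_representatives = {(h x, h y, h z) | x y z. True} \<inter> points"

text \<open>The gradient of \<open>F\<close> at the point: as \<open>q\<close> is 0 in the field,
  the partial derivatives are \<open>X ^ q\<close>, \<open>- Z ^ q\<close> and
  \<open>- Y ^ q\<close>.\<close>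

definition tangent :: "'k \<times> 'k \<times> 'k \<Rightarrow> 'k poly3" where
  "tangent = (\<lambda>(x, y, z). const3 (x ^ q) * var_X - const3 (z ^ q) * var_Y - const3 (y ^ q) * var_Z)"

lemma is_form_lin: "is_form 1 v \<Longrightarrow> is_form 1 (const3 c * v)"
  using is_form_mult[OF is_form_const3] by fastforce

lemma is_form_tangent: "is_form 1 (tangent s)"
  by (cases s) (auto simp only: tangent_def prod.case intro!: is_form_diff is_form_lin is_form_var)

lemma over_base_tangent: "s \<in> rational_representatives \<Longrightarrow> over_base (tangent s)"
  by (auto simp: rational_representatives_def tangent_def simp flip: rhom_power[OF rhom_h] intro!: over_base_diff over_base_mult over_base_const3 over_base_var)

lemma eval_hom3_lin:
  assumes "rhom g"
  shows "eval_hom3 g (x, y, z) (const3 a * var_X + const3 b * var_Y + const3 c * var_Z) = g a * x + g b * y + g c * z"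
    and "eval_hom3 g (x, y, z) (tangent (x0, y0, z0)) = g (x0 ^ q) * x - g (z0 ^ q) * y - g (y0 ^ q) * z"
  by (simp_all add: tangent_def rhom_simps[OF rhom_eval_hom3[OF assms]] eval_hom3_var[OF assms] eval_hom3_const3[OF assms])

lemma eval3_tangent: "eval3 (tangent (x0, y0, z0)) (x, y, z) = x0 ^ q * x - z0 ^ q * y - y0 ^ q * z"
  by (simp only: eval3_eq_eval_hom3 eval_hom3_lin[OF rhom_id])

lemma rational_representatives_cases:
  assumes "s \<in> rational_representatives"
  obtains (affine) x y where "s = (x, y, 1)" "y ^ q + y = x ^ (q + 1)" "(x ^ q) ^ q = x" "(y ^ q) ^ q = y"
    | (infinity) "s = (0, 1, 0)"
  using assms by (auto simp: rational_representatives_def points_def frob2)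

text \<open>By \<open>frob2\<close>, the \<open>q\<close>-th power of the tangent equation involves
  the coordinates of the rational point itself. Both equations and the two curve equations combine
  to \<open>(x - x0) ^ (q + 1) = 0\<close>.\<close>

lemma tangent_other:
  assumes s: "s \<in> rational_representatives" and s': "s' \<in> points" "s' \<noteq> s"
  shows "eval3 (tangent s) s' \<noteq> 0"
  using s
proof (cases rule: rational_representatives_cases)
  case (affine x0 y0)
  show ?thesis
  proof (cases "s' = (0, 1, 0)")
    case True
    then show ?thesis by (simp add: affine eval3_tangent)
  next
    case False
    with s' obtain x y where xy: "s' = (x, y, 1)" "y ^ q + y = x ^ (q + 1)" by (auto simp: points_def)
    show ?thesis
    proof
      assume "eval3 (tangent s) s' = 0"
      then have t: "x0 ^ q * x = y + y0 ^ q" by (simp add: affine xy eval3_tangent algebra_simps)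
      have t': "x0 * x ^ q = y ^ q + y0"
        using arg_cong[OF t, of "\<lambda>u. u ^ q"] by (simp add: power_mult_distrib frob_k affine)
      have "(x - x0) ^ q * (x - x0) = x ^ (q + 1) - x0 * x ^ q - x0 ^ q * x + x0 ^ (q + 1)"
        unfolding frob_k_diff by (simp add: algebra_simps)
      also have "\<dots> = (y ^ q + y) - (y ^ q + y0) - (y + y0 ^ q) + (y0 ^ q + y0)"
        by (simp only: t t' xy(2) affine(2))
      also have "\<dots> = 0" by (simp add: algebra_simps)
      finally have x: "x = x0" by auto
      have "y + y0 ^ q = x0 ^ (q + 1)" using t x by (simp add: mult.commute)
      also have "\<dots> = y0 + y0 ^ q" using affine(2) by (simp only: add.commute)
      finally have "y = y0" by simp
      then show False using x using s'(2) xy affine by simp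
    qed
  qed
next
  case infinity
  then obtain x y where "s' = (x, y, 1)" using s' by (auto simp: points_def)
  then show ?thesis using q2 by (simp add: infinity eval3_tangent power_0_left)
qed

lemma E_tangent_affine:
  assumes "y0 ^ q + y0 = x0 ^ (q + 1)"
  shows "E (x0, y0, 1) (tangent (x0, y0, 1)) = fps_const (x0 ^ q) * fps_X - eta x0"
proof -
  have "E (x0, y0, 1) (tangent (x0, y0, 1)) = fps_const (x0 ^ (q + 1) - (y0 ^ q + y0)) + fps_const (x0 ^ q) * fps_X - eta x0"
    by (simp add: E_def branch_def eval_hom3_lin[OF rhom_fps_const] algebra_simps flip: fps_const_sub fps_const_mult fps_const_add)
  then show ?thesis by (simp add: assms)
qed

text \<open>At an affine rational point the expansion \<open>u\<close> of the tangent satisfies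
  \<open>u ^ q + u = - t ^ (q + 1)\<close>, where the terms \<open>x0 * t ^ q\<close> cancel by
  \<open>frob2\<close>; at infinity it is \<open>- zeta\<close>.\<close>

lemma tangent_self:
  assumes s: "s \<in> rational_representatives"
  shows "E s (tangent s) \<noteq> 0" "subdegree (E s (tangent s)) = q + 1"
proof -
  have "E s (tangent s) \<noteq> 0 \<and> subdegree (E s (tangent s)) = q + 1"
    using s
  proof (cases rule: rational_representatives_cases)
    case (affine x0 y0)
    define u where "u = E s (tangent s)"
    have u: "u = fps_const (x0 ^ q) * fps_X - eta x0"
      unfolding u_def affine(1) E_tangent_affine[OF affine(2)] by simp
    then have et: "eta x0 = fps_const (x0 ^ q) * fps_X - u" by simp
    have "eta x0 ^ q + u ^ q = (eta x0 + u) ^ q" by (simp only: frob_fps)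
    also have "\<dots> = (fps_const (x0 ^ q) * fps_X) ^ q" by (simp add: et)
    also have "\<dots> = fps_const x0 * fps_X ^ q" by (simp add: power_mult_distrib fps_const_power affine(3))
    finally have e1: "u ^ q = fps_const x0 * fps_X ^ q - eta x0 ^ q" by (simp add: algebra_simps)
    have "eta x0 ^ q + eta x0 = (fps_const x0 ^ q + fps_X ^ q) * (fps_const x0 + fps_X) - fps_const x0 ^ (q + 1)"
      using eta_eq[of x0] by (simp add: frob_fps mult.commute)
    then have e2: "eta x0 ^ q = fps_const x0 ^ q * fps_X + fps_X ^ q * fps_const x0 + fps_X ^ (q + 1) - eta x0"
      by (simp add: algebra_simps)
    have e3: "u ^ q + u = - (fps_X ^ (q + 1))"
      unfolding e1 e2 by (simp add: u algebra_simps fps_const_power)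
    have "fps_nth u 0 = 0" by (simp add: u eta_0)
    from artin_schreier_subdegree[OF e3 this _ q2] show ?thesis by (simp add: u_def del: power_Suc)
  next
    case infinity
    have "E s (tangent s) = - zeta" using q2
      by (simp add: infinity E_def branch_def eval_hom3_lin[OF rhom_fps_const] power_0_left)
    then show ?thesis using zeta_nz by (simp add: subdegree_zeta)
  qed
  then show "E s (tangent s) \<noteq> 0" "subdegree (E s (tangent s)) = q + 1" by simp_all
qed

text \<open>If the linear coefficient of the expansion were 0, the form would be a multiple of the
  tangent at \<open>s\<close>, which does not vanish at \<open>s'\<close>.\<close>

lemma linear_form_simple_zero:
  assumes s: "s \<in> rational_representatives" "s' \<in> points" "s' \<noteq> s"
    and w: "w = const3 a * var_X + const3 b * var_Y + const3 c * var_Z" "(a, b, c) \<noteq> (0, 0, 0)"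
    and zeros: "eval3 w s = 0" "eval3 w s' = 0"
  shows "subdegree (E s w) = 1"
  using s(1)
proof (cases rule: rational_representatives_cases)
  case (affine x0 y0)
  have ws: "a * x0 + b * y0 + c = 0" using zeros(1) by (simp add: affine w eval3_eq_eval_hom3 eval_hom3_lin[OF rhom_id])
  define m where "m = a + b * x0 ^ q"
  have m: "m \<noteq> 0"
  proof
    assume "m = 0"
    then have a: "a = - (b * x0 ^ q)" by (simp add: m_def eq_neg_iff_add_eq_0)
    have "c = b * (x0 ^ (q + 1) - y0)" using ws by (simp add: a algebra_simps eq_diff_eq)
    also have "\<dots> = b * y0 ^ q" unfolding affine(2)[symmetric] by simp
    finally have c: "c = b * y0 ^ q" .
    obtain x y z where s': "s' = (x, y, z)" by (cases s')
    have "a * x + b * y + c * z = 0" using zeros(2) by (simp only: s' w eval3_eq_eval_hom3 eval_hom3_lin[OF rhom_id])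
    moreover have "b * eval3 (tangent s) s' = - (a * x + b * y + c * z)"
      by (simp add: s' affine(1) eval3_tangent a c algebra_simps)
    ultimately have "b * eval3 (tangent s) s' = 0" by simp
    then have "b = 0" using tangent_other[OF s] by simp
    then show False using w(2) a c by simp
  qed
  define u where "u = E s (tangent s)"
  have u: "eta x0 = fps_const (x0 ^ q) * fps_X - u"
    unfolding u_def affine(1) E_tangent_affine[OF affine(2)] by simp
  have "E s w = fps_const a * (fps_const x0 + fps_X) + fps_const b * (fps_const y0 + eta x0) + fps_const c"
    by (simp add: affine(1) w(1) E_def branch_def eval_hom3_lin[OF rhom_fps_const])
  also have "\<dots> = fps_const (a * x0 + b * y0 + c) + fps_const a * fps_X + fps_const b * eta x0"
    by (simp add: algebra_simps flip: fps_const_add fps_const_mult)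
  also have "\<dots> = fps_const a * fps_X + fps_const b * (fps_const (x0 ^ q) * fps_X - u)"
    by (simp add: ws u)
  also have "\<dots> = fps_const m * fps_X - fps_const b * u"
    by (simp add: m_def algebra_simps flip: fps_const_add fps_const_mult)
  finally have Ew: "E s w = fps_const m * fps_X - fps_const b * u" .
  \<comment> \<open>The order \<open>q + 1\<close> of the tangent is at least 3, so \<open>u\<close>
    leaves the linear coefficient \<open>m\<close> untouched.\<close>
  have "fps_nth u i = 0" if "i \<le> 1" for i
    by (rule nth_less_subdegree_zero) (use tangent_self(2)[OF s(1)] that q2 in \<open>simp add: u_def\<close>)
  then have "fps_nth u 0 = 0" "fps_nth u 1 = 0" by simp_all
  then show ?thesis unfolding Ew using m by (intro subdegreeI) auto
next
  case infinity
  have b: "b = 0" using zeros(1) by (simp add: infinity w eval3_eq_eval_hom3 eval_hom3_lin[OF rhom_id])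
  obtain x y where s': "s' = (x, y, 1)" using s infinity by (auto simp: points_def)
  have "a \<noteq> 0"
    using zeros(2) w(2) b by (auto simp: s' w eval3_eq_eval_hom3 eval_hom3_lin[OF rhom_id])
  moreover have "E s w = fps_const a * fps_X + fps_const c * zeta"
    by (simp add: infinity w E_def branch_def eval_hom3_lin[OF rhom_fps_const] b)
  moreover have "fps_nth zeta i = 0" if "i \<le> 1" for i
    by (rule nth_less_subdegree_zero) (use that q2 in \<open>simp add: subdegree_zeta\<close>)
  then have "fps_nth zeta 0 = 0" "fps_nth zeta 1 = 0" by simp_all
  ultimately show ?thesis by (intro subdegreeI) auto
qed

definition on_line :: "'k poly3 \<Rightarrow> 'k \<times> 'k \<times> 'k \<Rightarrow> 'k \<times> 'k \<times> 'k \<Rightarrow> 'k \<times> 'k \<times> 'k \<Rightarrow> bool" where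
  "on_line w P Q R \<longleftrightarrow> P \<in> rational_representatives \<and> Q \<in> rational_representatives \<and> R \<in> rational_representatives \<and> P \<noteq> Q \<and> P \<noteq> R \<and> Q \<noteq> R \<and>
     over_base w \<and> is_form 1 w \<and> subdegree (E P w) = 1 \<and> subdegree (E Q w) = 1 \<and> subdegree (E R w) = 1"

lemma line_exists:
  assumes pts: "P \<in> rational_representatives" "Q \<in> rational_representatives" "R \<in> rational_representatives" "P \<noteq> Q" "P \<noteq> R" "Q \<noteq> R"
    and coll: "(\<alpha>, \<beta>, \<gamma>) \<noteq> (0, 0, 0)" "\<And>x y z. (x, y, z) \<in> {P, Q, R} \<Longrightarrow> \<alpha> * x + \<beta> * y + \<gamma> * z = 0"
  shows "\<exists>w. on_line w P Q R"
proof -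
  obtain x1 y1 z1 where P: "P = (h x1, h y1, h z1)" using pts(1) by (auto simp: rational_representatives_def)
  obtain x2 y2 z2 where Q: "Q = (h x2, h y2, h z2)" using pts(2) by (auto simp: rational_representatives_def)
  obtain x3 y3 z3 where R: "R = (x3, y3, z3)" by (cases R)
  \<comment> \<open>The given line may have coefficients in the algebraic closure, whereas functions
    over the base field are wanted; the cross product of two rational points has its entries
    there.\<close>
  define a b c where "a = y1 * z2 - z1 * y2" and "b = z1 * x2 - x1 * z2" and "c = x1 * y2 - y1 * x2"
  define w where "w = const3 (h a) * var_X + const3 (h b) * var_Y + const3 (h c) * var_Z"
  note hs = rhom_simps[OF rhom_h]
  have points: "P \<in> points" "Q \<in> points" "R \<in> points" using pts by (auto simp: rational_representatives_def)
  have abc: "(h a, h b, h c) \<noteq> (0, 0, 0)"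
  proof
    assume "(h a, h b, h c) = (0, 0, 0)"
    then have z: "h y1 * h z2 = h z1 * h y2" "h z1 * h x2 = h x1 * h z2" "h x1 * h y2 = h y1 * h x2"
      by (simp_all add: a_def b_def c_def hs)
    then show False using points(1,2) pts(4) by (auto simp: P Q points_def)
  qed
  have e: "eval3 w (x, y, z) = h a * x + h b * y + h c * z" for x y z
    by (simp add: w_def eval3_eq_eval_hom3 eval_hom3_lin[OF rhom_id])
  have eP: "eval3 w P = 0" by (simp add: P e a_def b_def c_def hs algebra_simps)
  have eQ: "eval3 w Q = 0" by (simp add: Q e a_def b_def c_def hs algebra_simps)
  have l: "\<alpha> * h x1 + \<beta> * h y1 + \<gamma> * h z1 = 0" "\<alpha> * h x2 + \<beta> * h y2 + \<gamma> * h z2 = 0"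
    "\<alpha> * x3 + \<beta> * y3 + \<gamma> * z3 = 0"
    using coll(2) by (auto simp: P Q R)
  define d where "d = eval3 w R"
  have d: "d = (h y1 * h z2 - h z1 * h y2) * x3 + (h z1 * h x2 - h x1 * h z2) * y3 + (h x1 * h y2 - h y1 * h x2) * z3"
    by (simp add: d_def R e a_def b_def c_def hs)
  let ?l1 = "\<alpha> * h x1 + \<beta> * h y1 + \<gamma> * h z1" and ?l2 = "\<alpha> * h x2 + \<beta> * h y2 + \<gamma> * h z2"
  let ?l3 = "\<alpha> * x3 + \<beta> * y3 + \<gamma> * z3"
  \<comment> \<open>Cramer's rule: \<open>d\<close> is the determinant of the three points, and each
    coefficient of a line through them annihilates it.\<close>
  have "\<alpha> * d = ?l1 * (h y2 * z3 - h z2 * y3) + ?l2 * (y3 * h z1 - z3 * h y1) + ?l3 * (h y1 * h z2 - h z1 * h y2)"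
    "\<beta> * d = ?l1 * (h z2 * x3 - h x2 * z3) + ?l2 * (z3 * h x1 - x3 * h z1) + ?l3 * (h z1 * h x2 - h x1 * h z2)"
    "\<gamma> * d = ?l1 * (h x2 * y3 - h y2 * x3) + ?l2 * (x3 * h y1 - y3 * h x1) + ?l3 * (h x1 * h y2 - h y1 * h x2)"
    unfolding d by (simp_all add: algebra_simps)
  then have "\<alpha> * d = 0" "\<beta> * d = 0" "\<gamma> * d = 0"
    by (simp_all only: l mult_zero_left add_0_left)
  then have eR: "eval3 w R = 0" using coll(1) by (auto simp: d_def)
  have "is_form 1 w" unfolding w_def by (intro is_form_add is_form_lin is_form_var)
  moreover have "over_base w" unfolding w_def by (intro over_base_add over_base_mult over_base_const3 over_base_var)
  moreover have "subdegree (E P w) = 1"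
    by (rule linear_form_simple_zero[OF pts(1) points(2) _ w_def abc eP eQ]) (use pts in auto)
  moreover have "subdegree (E Q w) = 1"
    by (rule linear_form_simple_zero[OF pts(2) points(1) _ w_def abc eQ eP]) (use pts in auto)
  moreover have "subdegree (E R w) = 1"
    by (rule linear_form_simple_zero[OF pts(3) points(1) _ w_def abc eR eP]) (use pts in auto)
  ultimately show ?thesis using pts by (auto simp: on_line_def)
qed

section \<open>Functions over the base field with bounded poles\<close>

definition rational_fractions :: "('k poly3 \<times> 'k poly3) set" where
  "rational_fractions = {(G, H). (G, H) \<in> fractions F \<and> over_base G \<and> over_base H}"

text \<open>The Riemann-Roch space of \<open>D\<close> over the base field, represented by
  fractions; the zero function belongs to it because its expansion has subdegree 0.\<close>

definition bounded_poles :: "('k \<times> 'k \<times> 'k \<Rightarrow> nat) \<Rightarrow> ('k poly3 \<times> 'k poly3) set" where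
  "bounded_poles D = {r \<in> rational_fractions. \<forall>s\<in>points. fls_subdegree (val s r) \<ge> - int (D s)}"

lemma rational_fractions_combine:
  assumes "r1 \<in> rational_fractions" "r2 \<in> rational_fractions"
  shows "\<exists>r\<in>rational_fractions. \<forall>s\<in>points. val s r = val s r1 + fls_const (h l) * val s r2"
proof -
  obtain G1 H1 G2 H2 where r: "r1 = (G1, H1)" "r2 = (G2, H2)" by (cases r1, cases r2)
  have f: "(G1, H1) \<in> fractions F" "(G2, H2) \<in> fractions F" "over_base G1" "over_base H1" "over_base G2" "over_base H2"
    using assms by (auto simp: rational_fractions_def r)
  obtain d1 where d1: "is_form d1 G1" "is_form d1 H1" by (rule fractionsD[OF f(1) points_nonempty])
  obtain d2 where d2: "is_form d2 G2" "is_form d2 H2" by (rule fractionsD[OF f(2) points_nonempty])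
  have nz: "E s H1 \<noteq> 0" "E s H2 \<noteq> 0" if "s \<in> points" for s
    by (rule fractionsD[OF f(1) that]; assumption) (rule fractionsD[OF f(2) that]; assumption)
  define r where "r = (G1 * H2 + const3 (h l) * (G2 * H1), H1 * H2)"
  have fl: "is_form d (const3 (h l) * v)" if "is_form d v" for d v
    using is_form_mult[OF is_form_const3 that] by simp
  have f21: "is_form (d1 + d2) (G2 * H1)" using is_form_mult[OF d2(1) d1(2)] by (simp add: add.commute)
  have "E (0, 1, 0) (H1 * H2) \<noteq> 0" using nz[OF points_nonempty] by (simp add: rhom_mult[OF rhom_E])
  then have "r \<in> fractions F" unfolding r_def
    by (rule fractionsI[OF is_form_add[OF is_form_mult[OF d1(1) d2(2)] fl[OF f21]] is_form_mult[OF d1(2) d2(2)] points_nonempty])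
  moreover have "over_base (fst r)" "over_base (snd r)" unfolding r_def
    by (auto intro!: over_base_add over_base_mult over_base_const3 f)
  ultimately have "r \<in> rational_fractions" by (auto simp: rational_fractions_def r_def)
  moreover have "val s r = val s r1 + fls_const (h l) * val s r2" if s: "s \<in> points" for s
  proof -
    have "E s (const3 (h l)) = fps_const (h l)"
      unfolding E_def by (cases "branch s") (simp add: eval_hom3_const3[OF rhom_fps_const])
    then show ?thesis using nz[OF s]
      by (simp add: r_def r val_def rhom_simps[OF rhom_E] fls_times_fps_to_fls field_simps)
  qed
  ultimately show ?thesis by blast
qed

lemma few_bad_scalars:
  assumes "x \<noteq> 0 \<or> y \<noteq> 0"
  shows "card {l. x + h l * y = 0} \<le> 1"
proof -
  have "l = l'" if "x + h l * y = 0" "x + h l' * y = 0" for l l'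
  proof -
    have "y \<noteq> 0" using that assms by auto
    moreover have "(h l - h l') * y = (x + h l * y) - (x + h l' * y)" by (simp add: algebra_simps)
    then have "(h l - h l') * y = 0" by (simp only: that diff_self)
    ultimately have "h (l - l') = 0" by (simp add: rhom_diff[OF rhom_h])
    from h_eq_0[OF this] show ?thesis by simp
  qed
  moreover have "finite {l. x + h l * y = 0}" using card_ge(1) by (rule finite_subset[rotated]) simp
  ultimately show ?thesis unfolding One_nat_def by (subst card_le_Suc0_iff_eq) auto
qed

text \<open>Each condition excludes at most one scalar, and there are at least four.\<close>

lemma scalar_exists:
  assumes "x1 \<noteq> 0 \<or> y1 \<noteq> 0" "x2 \<noteq> 0 \<or> y2 \<noteq> 0" "x3 \<noteq> 0 \<or> y3 \<noteq> 0"
  shows "\<exists>l. x1 + h l * y1 \<noteq> 0 \<and> x2 + h l * y2 \<noteq> 0 \<and> x3 + h l * y3 \<noteq> 0"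
proof (rule ccontr)
  assume "\<not> ?thesis"
  then have "UNIV = {l. x1 + h l * y1 = 0} \<union> {l. x2 + h l * y2 = 0} \<union> {l. x3 + h l * y3 = 0}" by auto
  then have "card (UNIV :: 'a set) \<le> card {l. x1 + h l * y1 = 0} + card {l. x2 + h l * y2 = 0} + card {l. x3 + h l * y3 = 0}"
    by (metis (no_types, lifting) add_le_mono1 card_Un_le le_trans)
  then show False using card_ge(2) few_bad_scalars[OF assms(1)] few_bad_scalars[OF assms(2)] few_bad_scalars[OF assms(3)]
    by simp
qed

lemma bounded_poles_combine:
  assumes "r1 \<in> bounded_poles D" "r2 \<in> bounded_poles D"
  shows "\<exists>r\<in>bounded_poles D. \<forall>s\<in>points. val s r = val s r1 + fls_const (h l) * val s r2"
proof -
  obtain r where r: "r \<in> rational_fractions" "\<And>s. s \<in> points \<Longrightarrow> val s r = val s r1 + fls_const (h l) * val s r2"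
    using rational_fractions_combine[of r1 r2 l] assms by (auto simp: bounded_poles_def)
  have "fls_subdegree (val s r) \<ge> - int (D s)" if s: "s \<in> points" for s
  proof (cases "val s r = 0")
    case False
    show ?thesis
    proof (rule fls_subdegree_geI[OF False])
      fix k assume "k < - int (D s)"
      moreover have "fls_subdegree (val s r1) \<ge> - int (D s)" "fls_subdegree (val s r2) \<ge> - int (D s)"
        using assms s by (auto simp: bounded_poles_def)
      ultimately have "fls_nth (val s r1) k = 0" "fls_nth (val s r2) k = 0" by auto
      then show "fls_nth (val s r) k = 0" by (simp add: r(2)[OF s])
    qed
  qed simp
  then have "r \<in> bounded_poles D" using r(1) unfolding bounded_poles_def by blast
  then show ?thesis using r(2) by blast
qed

text \<open>Within \<open>bounded_poles D\<close> a nonzero coefficient at \<open>- D s\<close>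
  means pole order exactly \<open>D s\<close>. These coefficients depend linearly on the function,
  so a suitable scalar prevents cancellation.\<close>

lemma bounded_poles_attain_all:
  assumes r: "r1 \<in> bounded_poles D" "r2 \<in> bounded_poles D" "r3 \<in> bounded_poles D" and s: "P \<in> points" "Q \<in> points" "R \<in> points"
    and at: "fls_nth (val P r1) (- int (D P)) \<noteq> 0" "fls_nth (val Q r2) (- int (D Q)) \<noteq> 0"
      "fls_nth (val R r3) (- int (D R)) \<noteq> 0"
  shows "\<exists>r\<in>bounded_poles D. fls_nth (val P r) (- int (D P)) \<noteq> 0 \<and> fls_nth (val Q r) (- int (D Q)) \<noteq> 0 \<and>
    fls_nth (val R r) (- int (D R)) \<noteq> 0"
proof -
  let ?c = "\<lambda>s r. fls_nth (val s r) (- int (D s))"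
  \<comment> \<open>Only \<open>P\<close> and \<open>Q\<close> matter at this stage; the third pair
    is filled with 1.\<close>
  obtain l where l: "?c P r1 + h l * ?c P r2 \<noteq> 0" "?c Q r1 + h l * ?c Q r2 \<noteq> 0"
    using scalar_exists[of "?c P r1" "?c P r2" "?c Q r1" "?c Q r2" 1 1] at by auto
  obtain r' where r': "r' \<in> bounded_poles D" "\<And>s. s \<in> points \<Longrightarrow> val s r' = val s r1 + fls_const (h l) * val s r2"
    using bounded_poles_combine[OF r(1,2)] by blast
  have c': "?c P r' \<noteq> 0" "?c Q r' \<noteq> 0" using l by (simp_all add: r'(2) s)
  obtain m where m: "?c P r' + h m * ?c P r3 \<noteq> 0" "?c Q r' + h m * ?c Q r3 \<noteq> 0" "?c R r' + h m * ?c R r3 \<noteq> 0"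
    using scalar_exists[of "?c P r'" "?c P r3" "?c Q r'" "?c Q r3" "?c R r'" "?c R r3"] c' at by auto
  obtain r where "r \<in> bounded_poles D" "\<And>s. s \<in> points \<Longrightarrow> val s r = val s r' + fls_const (h m) * val s r3"
    using bounded_poles_combine[OF r'(1) r(3)] by blast
  then show ?thesis using m by (intro bexI[of _ r]) (simp_all add: s)
qed

lemma rational_representatives_points: "s \<in> rational_representatives \<Longrightarrow> s \<in> points"
  by (simp add: rational_representatives_def)

lemma E_form_nz:
  assumes "s \<in> points" "s' \<in> points" "is_form d v" "E s v \<noteq> 0"
  shows "E s' v \<noteq> 0"
  using E_eq_0_iff[OF assms(1,3)] E_eq_0_iff[OF assms(2,3)] assms(4) by simp

lemma E_tangent:
  assumes "P \<in> rational_representatives" "s \<in> points"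
  shows "E s (tangent P) \<noteq> 0" "subdegree (E s (tangent P)) = (if s = P then q + 1 else 0)"
proof -
  show nz: "E s (tangent P) \<noteq> 0"
    using E_form_nz[OF rational_representatives_points[OF assms(1)] assms(2) is_form_tangent tangent_self(1)[OF assms(1)]] .
  have "fps_nth (E s (tangent P)) 0 \<noteq> 0" if "s \<noteq> P"
    using tangent_other[OF assms that] E_nth_0[OF assms(2)] by simp
  then show "subdegree (E s (tangent P)) = (if s = P then q + 1 else 0)"
    using tangent_self(2)[OF assms(1)] by simp
qed

lemma E_line:
  assumes "on_line w P Q R" "s \<in> points"
  shows "E s w \<noteq> 0"
proof -
  have "E P w \<noteq> 0" using assms(1) by (auto simp: on_line_def)
  then show ?thesis using E_form_nz[of P s 1 w] assms rational_representatives_points by (simp add: on_line_def)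
qed

section \<open>The criterion for a single pole order\<close>

lemma pole_attained_function:
  assumes l: "on_line w P Q R" and at: "pole_attained (q + 1) a b c"
  shows "\<exists>r\<in>bounded_poles (pole_bound P Q R a b c). fls_nth (val P r) (- int (pole_bound P Q R a b c P)) \<noteq> 0"
proof -
  define n where "n = q + 1"
  define j where "j = (n - a mod n) mod n"
  define A B C where "A = (a + j) div n" and "B = (b + j) div n" and "C = (c + j) div n"
  have n: "n > 0" by (simp add: n_def)
  have jABC: "j \<le> A + B + C" using at by (simp add: pole_attained_def Let_def A_def B_def C_def j_def n_def)
  have "(a + j) mod n = 0"
  proof -
    have "(a + j) mod n = (a mod n + (n - a mod n)) mod n" by (simp add: j_def mod_simps)
    then show ?thesis using n by simp
  qed
  then have A: "a + j = n * A" by (simp add: A_def mod_eq_0_iff_dvd)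
  have B: "n * B \<le> b + j" and C: "n * C \<le> c + j" by (simp_all add: B_def C_def)
  \<comment> \<open>The line is taken to the power \<open>j\<close>, which turns the pole of order
    \<open>n * A\<close> at \<open>P\<close> into one of order \<open>a\<close>. The
    \<open>e'\<close> missing degrees of the numerator go to the tangent at \<open>Q\<close>, which
    can only lower the pole order there.\<close>
  define e' where "e' = A + B + C - j"
  have pts: "P \<in> rational_representatives" "Q \<in> rational_representatives" "R \<in> rational_representatives" and ne: "P \<noteq> Q" "P \<noteq> R" "Q \<noteq> R"
    and w: "over_base w" "is_form 1 w" and sw: "subdegree (E P w) = 1" "subdegree (E Q w) = 1" "subdegree (E R w) = 1"
    using l by (auto simp: on_line_def)
  define G where "G = w ^ j * tangent Q ^ e'"
  define H where "H = tangent P ^ A * tangent Q ^ B * tangent R ^ C"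
  have fG: "is_form (A + B + C) G"
    using is_form_mult[OF is_form_power1[OF w(2), of j] is_form_power1[OF is_form_tangent, of e' Q]] jABC
    by (simp add: G_def e'_def)
  have fH: "is_form (A + B + C) H"
    unfolding H_def by (intro is_form_mult is_form_power1 is_form_tangent)
  have nz: "E s G \<noteq> 0" "E s H \<noteq> 0" if s: "s \<in> points" for s
    using E_tangent(1)[OF pts(1) s] E_tangent(1)[OF pts(2) s] E_tangent(1)[OF pts(3) s] E_line[OF l s]
    by (simp_all add: G_def H_def rhom_simps[OF rhom_E])
  have fr: "(G, H) \<in> fractions F" by (rule fractionsI[OF fG fH points_nonempty nz(2)[OF points_nonempty]])
  have sub: "fls_subdegree (val s (G, H)) = int (j * subdegree (E s w) + e' * (if s = Q then n else 0))
      - int (A * (if s = P then n else 0) + B * (if s = Q then n else 0) + C * (if s = R then n else 0))"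
    if s: "s \<in> points" for s
  proof -
    note z = E_tangent(1)[OF pts(1) s] E_tangent(1)[OF pts(2) s] E_tangent(1)[OF pts(3) s] E_line[OF l s]
    have "subdegree (E s G) = j * subdegree (E s w) + e' * (if s = Q then n else 0)"
      using z by (simp add: G_def rhom_simps[OF rhom_E] E_tangent(2)[OF pts(2) s] n_def del: mult_Suc_right)
    moreover have "subdegree (E s H) = A * (if s = P then n else 0) + B * (if s = Q then n else 0) + C * (if s = R then n else 0)"
      using z by (simp add: H_def rhom_simps[OF rhom_E] E_tangent(2)[OF pts(1) s] E_tangent(2)[OF pts(2) s] E_tangent(2)[OF pts(3) s] n_def del: mult_Suc_right)
    ultimately show ?thesis using subdegree_val(1)[OF fr s nz(1)[OF s]] by simp
  qed
  have subP: "fls_subdegree (val P (G, H)) = - int a"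
  proof -
    have "fls_subdegree (val P (G, H)) = int j - int n * int A"
      using sub[OF rational_representatives_points[OF pts(1)]] ne sw by (simp add: algebra_simps)
    moreover have "int a + int j = int n * int A" using arg_cong[OF A, of int] by simp
    ultimately show ?thesis by linarith
  qed
  have "(G, H) \<in> rational_fractions" unfolding rational_fractions_def G_def H_def
    using fr by (auto simp: G_def H_def intro!: over_base_mult over_base_power over_base_tangent pts w)
  moreover have "fls_subdegree (val s (G, H)) \<ge> - int (pole_bound P Q R a b c s)" if s: "s \<in> points" for s
  proof -
    have B': "int n * int B \<le> int b + int j" and C': "int n * int C \<le> int c + int j"
      using B C by (simp_all flip: of_nat_mult of_nat_add)
    consider "s = P" | "s = Q" | "s = R" | "s \<noteq> P" "s \<noteq> Q" "s \<noteq> R" by blast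
    then show ?thesis
    proof cases
      case 1
      then show ?thesis using subP by (simp add: pole_bound_def)
    next
      case 2
      then have "fls_subdegree (val s (G, H)) = int j + int n * int e' - int n * int B"
        using sub[OF s] ne sw by (simp add: algebra_simps)
      moreover have "int n * int e' \<ge> 0" by simp
      moreover have "pole_bound P Q R a b c s = b" using 2 ne by (simp add: pole_bound_def)
      ultimately show ?thesis using B' by linarith
    next
      case 3
      then have "fls_subdegree (val s (G, H)) = int j - int n * int C"
        using sub[OF s] ne sw by (simp add: algebra_simps)
      then show ?thesis using C' 3 ne by (simp add: pole_bound_def)
    next
      case 4
      then show ?thesis using sub[OF s] by (simp add: pole_bound_def)
    qed
  qed
  ultimately have "(G, H) \<in> bounded_poles (pole_bound P Q R a b c)" by (simp add: bounded_poles_def)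
  moreover have "val P (G, H) \<noteq> 0" by (rule subdegree_val(2)[OF fr rational_representatives_points[OF pts(1)] nz(1)[OF rational_representatives_points[OF pts(1)]]])
  then have "fls_nth (val P (G, H)) (- int a) \<noteq> 0" using subP by (metis nth_fls_subdegree_nonzero)
  ultimately show ?thesis by (intro bexI[of _ "(G, H)"]) (simp_all add: pole_bound_def)
qed

text \<open>Multiplying a function with the forbidden poles by a suitable form of degree \<open>q - 2\<close>
  leaves a single simple pole.\<close>

lemma pole_not_attained:
  assumes l: "on_line w P Q R" and at: "\<not> pole_attained (q + 1) a b c"
    and r: "r \<in> fractions F" and poles: "\<And>s. s \<in> points \<Longrightarrow> nat (- fls_subdegree (val s r)) = pole_bound P Q R a b c s"
  shows False
proof -
  define n where "n = q + 1"
  define j where "j = (n - a mod n) mod n"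
  define A B C where "A = (a + j) div n" and "B = (b + j) div n" and "C = (c + j) div n"
  have n: "n > 0" by (simp add: n_def)
  have jABC: "A + B + C < j" using at by (simp add: pole_attained_def Let_def A_def B_def C_def j_def n_def)
  have jn: "j \<le> q" using mod_less_divisor[OF n, of "n - a mod n"] by (simp add: j_def n_def)
  have "(a + j) mod n = 0"
  proof -
    have "(a + j) mod n = (a mod n + (n - a mod n)) mod n" by (simp add: j_def mod_simps)
    then show ?thesis using n by simp
  qed
  then have A: "a + j = n * A" by (simp add: A_def mod_eq_0_iff_dvd)
  have "j > 0" using jABC by simp
  then have A1: "A > 0" using A by (cases A) auto
  have a1: "a > 0"
  proof (rule ccontr)
    assume "\<not> a > 0"
    then show False using jABC by (simp add: j_def)
  qed
  have B: "b + j < n + n * B" and C: "c + j < n + n * C"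
    unfolding B_def C_def by (rule dividend_less_times_div[OF n])+
  \<comment> \<open>\<open>G0\<close> shall have order \<open>a - 1 = (q - j) + (A - 1) * n\<close>
    at \<open>P\<close>, hence the exponents \<open>i\<close> and \<open>m\<close>. The powers
    \<open>B\<close> and \<open>C\<close> then suffice to cancel the poles at \<open>Q\<close> and
    \<open>R\<close>, as \<open>b\<close> is at most \<open>i + n * B\<close> and \<open>c\<close>
    at most \<open>i + n * C\<close>. The failing inequality gives
    \<open>i + m + B + C \<le> q - 2\<close>, so the subtraction in \<open>e'\<close> is exact and
    pads the degree to \<open>q - 2\<close>.\<close>
  define i m e' where "i = q - j" and "m = A - 1" and "e' = q - 2 - (i + m + B + C)"
  have deg: "i + m + (B + e') + C = q - 2" using jABC A1 jn by (simp add: i_def m_def e'_def)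
  have am: "a = i + m * n + 1"
  proof -
    obtain m' where m': "A = Suc m'" using A1 by (cases A) auto
    have "a + j = m' * n + q + 1" using A by (simp add: m' n_def algebra_simps)
    then show ?thesis using jn by (simp add: i_def m_def m')
  qed
  have "b \<le> i + n * B" "c \<le> i + n * C" using B C jn by (simp_all add: i_def n_def)
  then have bB: "b \<le> i + (B + e') * n" and cC: "c \<le> i + C * n" by (simp_all add: algebra_simps)
  have pts: "P \<in> rational_representatives" "Q \<in> rational_representatives" "R \<in> rational_representatives" and ne: "P \<noteq> Q" "P \<noteq> R" "Q \<noteq> R"
    and w: "is_form 1 w" and sw: "subdegree (E P w) = 1" "subdegree (E Q w) = 1" "subdegree (E R w) = 1"
    using l by (auto simp: on_line_def)
  have Pn: "P \<in> points" by (rule rational_representatives_points[OF pts(1)])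
  obtain G H where GH: "r = (G, H)" by (cases r)
  have fr: "(G, H) \<in> fractions F" using r GH by simp
  obtain d where d: "is_form d G" "is_form d H" "E P H \<noteq> 0" by (rule fractionsD[OF fr Pn])
  have subP: "fls_subdegree (val P r) = - int a" using poles[OF Pn] a1 by (simp add: pole_bound_def)
  have GP: "E P G \<noteq> 0"
  proof
    assume "E P G = 0"
    then have "val P r = 0" by (simp add: GH val_def)
    then show False using subP a1 by simp
  qed
  define G0 where "G0 = w ^ i * tangent P ^ m * tangent Q ^ (B + e') * tangent R ^ C"
  have f0: "is_form (q - 2) G0"
    unfolding deg[symmetric] G0_def by (intro is_form_mult is_form_power1 is_form_tangent w)
  have G0nz: "E s G0 \<noteq> 0" and sub0: "subdegree (E s G0) = i * subdegree (E s w) + m * (if s = P then n else 0) +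
      (B + e') * (if s = Q then n else 0) + C * (if s = R then n else 0)" if s: "s \<in> points" for s
  proof -
    note z = E_tangent(1)[OF pts(1) s] E_tangent(1)[OF pts(2) s] E_tangent(1)[OF pts(3) s] E_line[OF l s]
    show "E s G0 \<noteq> 0" using z by (simp add: G0_def rhom_simps[OF rhom_E])
    show "subdegree (E s G0) = i * subdegree (E s w) + m * (if s = P then n else 0) +
      (B + e') * (if s = Q then n else 0) + C * (if s = R then n else 0)"
      using z by (simp add: G0_def rhom_simps[OF rhom_E] E_tangent(2)[OF pts(1) s] E_tangent(2)[OF pts(2) s] E_tangent(2)[OF pts(3) s] n_def del: mult_Suc_right)
  qed
  have Gnz: "E s G \<noteq> 0" if "s \<in> points" for s by (rule E_form_nz[OF Pn that d(1) GP])
  have subN: "subdegree (E s (G * G0)) = subdegree (E s G) + subdegree (E s G0)" if "s \<in> points" for s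
    using Gnz[OF that] G0nz[OF that] by (simp add: rhom_mult[OF rhom_E])
  have subr: "fls_subdegree (val s r) = int (subdegree (E s G)) - int (subdegree (E s H))" if "s \<in> points" for s
    unfolding GH by (rule subdegree_val(1)[OF fr that Gnz[OF that]])
  show False
  proof (rule no_single_simple_pole)
    show "is_form (d + (q - 2)) (G * G0)" by (rule is_form_mult[OF d(1) f0])
    show "is_form d H" by (rule d(2))
    have "E P (G * G0) \<noteq> 0" using GP G0nz[OF Pn] by (simp add: rhom_mult[OF rhom_E])
    then show "\<not> F dvd G * G0" using E_dvd[OF Pn] by blast
    show "\<not> F dvd H" using d(3) E_dvd[OF Pn] by blast
    show "P \<in> points" by (rule Pn)
    show "subdegree (E P H) = subdegree (E P (G * G0)) + 1"
    proof -
      have "subdegree (E P G0) = i + m * n" using sub0[OF Pn] ne sw by simp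
      moreover have "subdegree (E P H) = subdegree (E P G) + a" using subr[OF Pn] subP by linarith
      ultimately show ?thesis using subN[OF Pn] am by simp
    qed
    show "subdegree (E s H) \<le> subdegree (E s (G * G0))" if s: "s \<in> points" "s \<noteq> P" for s
    proof -
      have "subdegree (E s H) \<le> subdegree (E s G) + pole_bound P Q R a b c s"
        using poles[OF s(1)] subr[OF s(1)] by simp
      moreover have "pole_bound P Q R a b c s \<le> subdegree (E s G0)"
      proof (cases "s = Q")
        case True
        then show ?thesis using sub0[OF s(1)] sw ne bB by (simp add: pole_bound_def)
      next
        case False
        then show ?thesis using sub0[OF s(1)] sw s cC by (auto simp: pole_bound_def)
      qed
      ultimately show ?thesis using subN[OF s(1)] by simp
    qed
  qed
qed

lemma on_line_swap: "on_line w P Q R \<Longrightarrow> on_line w Q P R" "on_line w P Q R \<Longrightarrow> on_line w R P Q"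
  by (auto simp: on_line_def)

lemma pole_bound_swap:
  assumes "P \<noteq> Q" "P \<noteq> R" "Q \<noteq> R"
  shows "pole_bound Q P R b a c = pole_bound P Q R a b c" "pole_bound R P Q c a b = pole_bound P Q R a b c"
  using assms by (auto simp: pole_bound_def fun_eq_iff)

theorem semigroup_criterion:
  assumes l: "on_line w P Q R"
  shows "(\<exists>r\<in>rational_fractions. \<forall>s\<in>points. nat (- fls_subdegree (val s r)) = pole_bound P Q R a b c s) \<longleftrightarrow>
    pole_attained (q + 1) a b c \<and> pole_attained (q + 1) b a c \<and> pole_attained (q + 1) c a b"
    (is "?L \<longleftrightarrow> ?R")
proof
  have ne: "P \<noteq> Q" "P \<noteq> R" "Q \<noteq> R" using l by (auto simp: on_line_def)
  note sw = pole_bound_swap[OF ne]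
  have pts: "P \<in> points" "Q \<in> points" "R \<in> points" using l rational_representatives_points by (auto simp: on_line_def)
  {
    assume ?L
    then obtain r where r: "r \<in> fractions F" "\<And>s. s \<in> points \<Longrightarrow> nat (- fls_subdegree (val s r)) = pole_bound P Q R a b c s"
      by (auto simp: rational_fractions_def)
    have "pole_attained (q + 1) b a c"
    proof (rule ccontr)
      assume n: "\<not> pole_attained (q + 1) b a c"
      show False by (rule pole_not_attained[OF on_line_swap(1)[OF l] n r(1)]) (simp only: r(2) sw)
    qed
    moreover have "pole_attained (q + 1) c a b"
    proof (rule ccontr)
      assume n: "\<not> pole_attained (q + 1) c a b"
      show False by (rule pole_not_attained[OF on_line_swap(2)[OF l] n r(1)]) (simp only: r(2) sw)
    qed
    ultimately show ?R using pole_not_attained[OF l _ r] by blast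
  }
  {
    assume R: ?R
    define D where "D = pole_bound P Q R a b c"
    obtain r1 where r1: "r1 \<in> bounded_poles D" "fls_nth (val P r1) (- int (D P)) \<noteq> 0"
      using pole_attained_function[OF l] R unfolding D_def by blast
    obtain r2 where r2: "r2 \<in> bounded_poles D" "fls_nth (val Q r2) (- int (D Q)) \<noteq> 0"
      using pole_attained_function[OF on_line_swap(1)[OF l], of b a c] R unfolding D_def sw by blast
    obtain r3 where r3: "r3 \<in> bounded_poles D" "fls_nth (val R r3) (- int (D R)) \<noteq> 0"
      using pole_attained_function[OF on_line_swap(2)[OF l], of c a b] R unfolding D_def sw by blast
    obtain r where r: "r \<in> bounded_poles D" "fls_nth (val P r) (- int (D P)) \<noteq> 0" "fls_nth (val Q r) (- int (D Q)) \<noteq> 0"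
      "fls_nth (val R r) (- int (D R)) \<noteq> 0"
      using bounded_poles_attain_all[OF r1(1) r2(1) r3(1) pts r1(2) r2(2) r3(2)] by blast
    have "nat (- fls_subdegree (val s r)) = D s" if s: "s \<in> points" for s
    proof -
      have ge: "fls_subdegree (val s r) \<ge> - int (D s)" using r(1) s by (simp add: bounded_poles_def)
      show ?thesis
      proof (cases "s \<in> {P, Q, R}")
        case True
        then have "fls_nth (val s r) (- int (D s)) \<noteq> 0" using r by auto
        then have "fls_subdegree (val s r) \<le> - int (D s)" by (rule fls_subdegree_leI)
        then show ?thesis using ge by simp
      next
        case False
        then have "D s = 0" by (auto simp: D_def pole_bound_def)
        then show ?thesis using ge by simp
      qed
    qed
    then show ?L using r(1) unfolding D_def bounded_poles_def by blast
  }
qed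

end

section \<open>Counting the gaps\<close>

text \<open>A pole order is written as \<open>n A - i\<close> with \<open>n = q + 1\<close> and \<open>i \<le> q\<close>, uniquely if \<open>i = 0\<close>
  is required for \<open>A = 0\<close>.\<close>

lemma ceiling_decomposition:
  fixes a q :: nat
  obtains A i where "i \<le> q" "A = 0 \<longrightarrow> i = 0" "a = (q + 1) * A - i"
proof -
  define A where "A = (a + q) div (q + 1)"
  have 1: "(q + 1) * A \<le> a + q" unfolding A_def by (rule times_div_less_eq_dividend)
  have 2: "a + q < (q + 1) + (q + 1) * A" unfolding A_def by (rule dividend_less_times_div) simp
  have "a \<le> (q + 1) * A" using 2 by simp
  then have "a = (q + 1) * A - ((q + 1) * A - a)" by (rule diff_diff_cancel[symmetric])
  moreover have "A = 0 \<longrightarrow> (q + 1) * A - a = 0" by simp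
  moreover have "(q + 1) * A - a \<le> q" using 1 by linarith
  ultimately show ?thesis by (intro that[of "(q + 1) * A - a" A])
qed

lemma ceiling_decomposition_unique:
  fixes A B i j q :: nat
  assumes "i \<le> q" "A = 0 \<longrightarrow> i = 0" "j \<le> q" "B = 0 \<longrightarrow> j = 0"
    and eq: "(q + 1) * A - i = (q + 1) * B - j"
  shows "A = B" "i = j"
proof -
  have *: "\<not> A < B" if "j \<le> q" "(q + 1) * A - i = (q + 1) * B - j" for A B i j :: nat
  proof
    assume "A < B"
    then have "(q + 1) * (A + 1) \<le> (q + 1) * B" by (intro mult_le_mono) simp_all
    then have "(q + 1) * A + q + 1 \<le> (q + 1) * B" by (simp add: algebra_simps)
    then show False using that by linarith
  qed
  show AB: "A = B" using *[OF assms(3) eq] *[OF assms(1) eq[symmetric]] by simp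
  have "i \<le> (q + 1) * A" using assms by (cases A) auto
  moreover have "j \<le> (q + 1) * A" using assms AB by (cases B) auto
  ultimately show "i = j" using eq AB by simp
qed

lemma ceiling_residue:
  fixes a A i q :: nat
  assumes "i \<le> q" "A = 0 \<longrightarrow> i = 0" "a = (q + 1) * A - i"
  shows "(q + 1 - a mod (q + 1)) mod (q + 1) = i"
proof (cases "i = 0")
  case False
  then obtain A' where A': "A = Suc A'" using assms(2) by (cases A) auto
  have "a = (q + 1) * A' + (q + 1 - i)" using assms(1,3) by (simp add: A')
  then have "a mod (q + 1) = (q + 1 - i) mod (q + 1)" by (simp only: mod_mult_self4)
  also have "\<dots> = q + 1 - i" using False assms(1) by simp
  finally show ?thesis using assms(1) by simp
qed (simp add: assms(3) del: mult_Suc)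

text \<open>Here \<open>a + j\<close> is \<open>(q + 1) * A\<close> plus \<open>j - i\<close>, which
  lies between \<open>- q\<close> and \<open>q\<close>, so the quotient drops by one exactly for
  \<open>j < i\<close>.\<close>

lemma ceiling_quotient:
  fixes a A i j q :: nat
  assumes "i \<le> q" "A = 0 \<longrightarrow> i = 0" "a = (q + 1) * A - i" "j \<le> q"
  shows "(a + j) div (q + 1) = A - of_bool (j < i)"
proof (cases "j < i")
  case True
  then obtain A' where A': "A = Suc A'" using assms(2) by (cases A) auto
  have "a + j = (q + 1 - i + j) + (q + 1) * A'" using assms(1,3) by (simp add: A')
  then have "(a + j) div (q + 1) = A' + (q + 1 - i + j) div (q + 1)" by (simp only: div_mult_self2)
  then show ?thesis using True assms(1) by (simp add: A')
next
  case False
  have "i \<le> (q + 1) * A" using assms(1,2) by (cases A) auto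
  then have "a + j = (j - i) + (q + 1) * A" using False assms(3) by simp
  then have "(a + j) div (q + 1) = A + (j - i) div (q + 1)" by (simp only: div_mult_self2)
  then show ?thesis using False assms(4) by simp
qed

section \<open>Gaps in terms of residues\<close>

definition gap_residues :: "nat \<Rightarrow> nat \<Rightarrow> nat \<Rightarrow> nat \<Rightarrow> bool" where
  "gap_residues T i j k \<longleftrightarrow> T < i \<or> T < j \<or> T < k \<or>
     (i = T \<and> j = T \<and> k + 1 = T) \<or> (i = T \<and> k = T \<and> j + 1 = T) \<or> (j = T \<and> k = T \<and> i + 1 = T)"

text \<open>Each inequality says that a residue plus the number of other residues exceeding it is at
  most \<open>T\<close>. If all residues are at most \<open>T\<close>, a residue below just one
  other satisfies this automatically; it can only fail for a residue \<open>T - 1\<close> below two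
  residues \<open>T\<close>.\<close>

lemma gap_iff_residues:
  assumes a: "i \<le> q" "A = 0 \<longrightarrow> i = 0" "a = (q + 1) * A - i"
    and b: "j \<le> q" "B = 0 \<longrightarrow> j = 0" "b = (q + 1) * B - j"
    and c: "k \<le> q" "C = 0 \<longrightarrow> k = 0" "c = (q + 1) * C - k"
  shows "\<not> (pole_attained (q + 1) a b c \<and> pole_attained (q + 1) b a c \<and> pole_attained (q + 1) c a b)
    \<longleftrightarrow> gap_residues (A + B + C) i j k"
proof -
  have "pole_attained (q + 1) a b c \<longleftrightarrow> i \<le> A + (B - of_bool (i < j)) + (C - of_bool (i < k))"
    unfolding pole_attained_def Let_def ceiling_residue[OF a]
      ceiling_quotient[OF a a(1)] ceiling_quotient[OF b a(1)] ceiling_quotient[OF c a(1)] by simp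
  moreover have "pole_attained (q + 1) b a c \<longleftrightarrow> j \<le> B + (A - of_bool (j < i)) + (C - of_bool (j < k))"
    unfolding pole_attained_def Let_def ceiling_residue[OF b]
      ceiling_quotient[OF a b(1)] ceiling_quotient[OF b b(1)] ceiling_quotient[OF c b(1)] by simp
  moreover have "pole_attained (q + 1) c a b \<longleftrightarrow> k \<le> C + (A - of_bool (k < i)) + (B - of_bool (k < j))"
    unfolding pole_attained_def Let_def ceiling_residue[OF c]
      ceiling_quotient[OF a c(1)] ceiling_quotient[OF b c(1)] ceiling_quotient[OF c c(1)] by simp
  \<comment> \<open>A zero quotient comes with residue 0, so the truncated subtractions are
    exact.\<close>
  moreover have "of_bool (x < i) \<le> A" "of_bool (x < j) \<le> B" "of_bool (x < k) \<le> C" for x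
    using a(2) b(2) c(2) by (auto simp: of_bool_def)
  moreover have move: "i \<le> A + (B - x) + (C - y) \<longleftrightarrow> i + x + y \<le> A + B + C" if "x \<le> B" "y \<le> C" for i A B C x y :: nat
    using that by linarith
  ultimately have "pole_attained (q + 1) a b c \<longleftrightarrow> i + of_bool (i < j) + of_bool (i < k) \<le> A + B + C"
    "pole_attained (q + 1) b a c \<longleftrightarrow> j + of_bool (j < i) + of_bool (j < k) \<le> A + B + C"
    "pole_attained (q + 1) c a b \<longleftrightarrow> k + of_bool (k < i) + of_bool (k < j) \<le> A + B + C"
    by (simp_all only: ac_simps)
  moreover have "\<not> (i + of_bool (i < j) + of_bool (i < k) \<le> T \<and> j + of_bool (j < i) + of_bool (j < k) \<le> T \<and>
    k + of_bool (k < i) + of_bool (k < j) \<le> T) \<longleftrightarrow> gap_residues T i j k" for T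
    unfolding gap_residues_def
    by (cases i j rule: linorder_cases; cases i k rule: linorder_cases; cases j k rule: linorder_cases;
        simp; arith)
  ultimately show ?thesis by (simp only:)
qed

definition residue_triples :: "nat \<Rightarrow> nat \<Rightarrow> nat \<Rightarrow> nat \<Rightarrow> (nat \<times> nat \<times> nat) set" where
  "residue_triples q A B C = {(i, j, k). i \<le> q \<and> j \<le> q \<and> k \<le> q \<and>
     (A = 0 \<longrightarrow> i = 0) \<and> (B = 0 \<longrightarrow> j = 0) \<and> (C = 0 \<longrightarrow> k = 0) \<and> gap_residues (A + B + C) i j k}"

lemma finite_residue_triples: "finite (residue_triples q A B C)"
  by (rule finite_subset[of _ "{..q} \<times> {..q} \<times> {..q}"]) (auto simp: residue_triples_def)

text \<open>In a gap some residue is at least \<open>T = A + B + C\<close>, and residues are at most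
  \<open>q\<close>, so only the levels \<open>T \<le> q\<close> occur. Uniqueness of the
  decomposition makes the sorting by levels a bijection.\<close>

lemma gap_set_card:
  fixes q :: nat
  defines "gaps \<equiv> {(a, b, c). \<not> (pole_attained (q + 1) a b c \<and> pole_attained (q + 1) b a c \<and> pole_attained (q + 1) c a b)}"
  shows "finite gaps" "card gaps = (\<Sum>T\<le>q. \<Sum>A\<le>T. \<Sum>B\<le>T - A. card (residue_triples q A B (T - A - B)))"
proof -
  define S where "S = (SIGMA T:{..q}. SIGMA A:{..T}. SIGMA B:{..T - A}. residue_triples q A B (T - A - B))"
  define \<phi> where "\<phi> = (\<lambda>(T, A, B, i, j, k). ((q + 1) * A - i, (q + 1) * B - j, (q + 1) * (T - A - B) - k))"
  have "inj_on \<phi> S"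
  proof (rule inj_onI)
    fix x y assume xy: "x \<in> S" "y \<in> S" "\<phi> x = \<phi> y"
    obtain T A B i j k where x: "x = (T, A, B, i, j, k)" by (cases x)
    obtain T' A' B' i' j' k' where y: "y = (T', A', B', i', j', k')" by (cases y)
    have S: "A \<le> T" "B \<le> T - A" "A' \<le> T'" "B' \<le> T' - A'" using xy by (auto simp: S_def x y)
    have r: "(i, j, k) \<in> residue_triples q A B (T - A - B)" "(i', j', k') \<in> residue_triples q A' B' (T' - A' - B')"
      using xy by (auto simp: S_def x y)
    have e: "(q + 1) * A - i = (q + 1) * A' - i'" "(q + 1) * B - j = (q + 1) * B' - j'"
      "(q + 1) * (T - A - B) - k = (q + 1) * (T' - A' - B') - k'" using xy(3) by (simp_all add: \<phi>_def x y)
    have "A = A'" "i = i'" by (rule ceiling_decomposition_unique[OF _ _ _ _ e(1)]; use r in \<open>simp add: residue_triples_def\<close>)+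
    moreover have "B = B'" "j = j'" by (rule ceiling_decomposition_unique[OF _ _ _ _ e(2)]; use r in \<open>simp add: residue_triples_def\<close>)+
    moreover have "T - A - B = T' - A' - B'" "k = k'"
      by (rule ceiling_decomposition_unique[OF _ _ _ _ e(3)]; use r in \<open>simp add: residue_triples_def\<close>)+
    ultimately show "x = y" using S by (simp add: x y)
  qed
  moreover have "\<phi> ` S = gaps"
  proof (intro equalityI subsetI)
    fix t assume "t \<in> \<phi> ` S"
    then obtain T A B i j k where S: "(T, A, B, i, j, k) \<in> S" and t: "t = \<phi> (T, A, B, i, j, k)" by (auto simp: S_def)
    then have r: "(i, j, k) \<in> residue_triples q A B (T - A - B)" by (simp add: S_def)
    then show "t \<in> gaps"
      using gap_iff_residues[of i q A _ j B _ k "T - A - B", OF _ _ refl _ _ refl _ _ refl]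
      by (simp add: t \<phi>_def gaps_def residue_triples_def del: mult_Suc)
  next
    fix t assume t: "t \<in> gaps"
    obtain a b c where abc: "t = (a, b, c)" by (cases t)
    obtain A i where A: "i \<le> q" "A = 0 \<longrightarrow> i = 0" "a = (q + 1) * A - i" by (rule ceiling_decomposition[of q a])
    obtain B j where B: "j \<le> q" "B = 0 \<longrightarrow> j = 0" "b = (q + 1) * B - j" by (rule ceiling_decomposition[of q b])
    obtain C k where C: "k \<le> q" "C = 0 \<longrightarrow> k = 0" "c = (q + 1) * C - k" by (rule ceiling_decomposition[of q c])
    have g: "gap_residues (A + B + C) i j k"
      using gap_iff_residues[OF A B C] t by (simp add: gaps_def abc)
    then have "A + B + C \<le> q" using A(1) B(1) C(1) by (auto simp: gap_residues_def)
    then have "(A + B + C, A, B, i, j, k) \<in> S"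
      using A B C g by (simp add: S_def residue_triples_def)
    moreover have "\<phi> (A + B + C, A, B, i, j, k) = t" by (simp add: \<phi>_def abc A B C del: mult_Suc)
    ultimately show "t \<in> \<phi> ` S" by (metis image_eqI)
  qed
  ultimately have "bij_betw \<phi> S gaps" by (simp add: bij_betw_def)
  moreover have "finite S" unfolding S_def by (intro finite_SigmaI finite_atMost finite_residue_triples)
  ultimately show "finite gaps" and c: "card gaps = (\<Sum>T\<le>q. \<Sum>A\<le>T. \<Sum>B\<le>T - A. card (residue_triples q A B (T - A - B)))"
    using bij_betw_finite[of \<phi> S gaps] bij_betw_same_card[of \<phi> S gaps]
    by (simp_all add: S_def card_SigmaI finite_residue_triples finite_SigmaI)
qed

section \<open>Counting each level and summing\<close>

lemma card_Diff_add:
  assumes "finite A" "B \<subseteq> A"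
  shows "card (A - B) + card B = card A"
  using card_Diff_subset[OF finite_subset[OF assms(2,1)] assms(2)] card_mono[OF assms] by linarith

text \<open>The triples outside the cube \<open>{..T}\<close> cubed, plus the three exceptional
  ones, which lie inside it. The additive form avoids truncated subtraction.\<close>

lemma card_residue_triples_3:
  assumes "A > 0" "B > 0" "C > 0" "A + B + C \<le> q"
  shows "card (residue_triples q A B C) + (A + B + C + 1) ^ 3 = (q + 1) ^ 3 + 3"
proof -
  define T where "T = A + B + C"
  have T: "T > 0" "T \<le> q" using assms by (simp_all add: T_def)
  let ?U = "{..q} \<times> {..q} \<times> {..q}" and ?V = "{..T} \<times> {..T} \<times> {..T}"
  let ?X = "{(T, T, T - 1), (T, T - 1, T), (T - 1, T, T)}"
  have "residue_triples q A B C = (?U - ?V) \<union> ?X"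
    using assms T unfolding residue_triples_def gap_residues_def T_def[symmetric] by auto
  moreover have "card ((?U - ?V) \<union> ?X) = card (?U - ?V) + card ?X"
    by (rule card_Un_disjoint) auto
  moreover have "card ?X = 3" using T by auto
  moreover have "card (?U - ?V) + card ?V = card ?U"
    by (rule card_Diff_add) (use T in auto)
  ultimately show ?thesis unfolding T_def[symmetric]
    by (simp add: card_cartesian_product power3_eq_cube algebra_simps)
qed

lemma card_square_diff:
  fixes T q :: nat
  assumes "T \<le> q"
  shows "card ({..q} \<times> {..q} - {..T} \<times> {..T}) + (T + 1) ^ 2 = (q + 1) ^ 2"
proof -
  have "card ({..q} \<times> {..q} - {..T} \<times> {..T}) + card ({..T} \<times> {..T}) = card ({..q} \<times> {..q})"
    by (rule card_Diff_add) (use assms in auto)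
  then show ?thesis by (simp add: card_cartesian_product power2_eq_square)
qed

text \<open>The zero quotient forces a residue 0, and this is neither \<open>T\<close> nor
  \<open>T - 1\<close> since \<open>T\<close> is at least 2; so no exceptional triples
  occur.\<close>

lemma card_residue_triples_2:
  assumes "A > 0" "B > 0" "A + B \<le> q"
  shows "card (residue_triples q 0 A B) + (A + B + 1) ^ 2 = (q + 1) ^ 2"
    and "card (residue_triples q A 0 B) + (A + B + 1) ^ 2 = (q + 1) ^ 2"
    and "card (residue_triples q A B 0) + (A + B + 1) ^ 2 = (q + 1) ^ 2"
proof -
  define T where "T = A + B"
  have T: "T > 1" "T \<le> q" using assms by (simp_all add: T_def)
  let ?D = "{..q} \<times> {..q} - {..T} \<times> {..T}"
  have "residue_triples q 0 A B = (\<lambda>(j, k). (0, j, k)) ` ?D"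
    using assms T unfolding residue_triples_def gap_residues_def by (auto simp flip: T_def)
  moreover have "residue_triples q A 0 B = (\<lambda>(j, k). (j, 0, k)) ` ?D"
    using assms T unfolding residue_triples_def gap_residues_def by (auto simp flip: T_def)
  moreover have "residue_triples q A B 0 = (\<lambda>(j, k). (j, k, 0)) ` ?D"
    using assms T unfolding residue_triples_def gap_residues_def by (auto simp flip: T_def)
  moreover have "inj_on (\<lambda>(j, k). (0 :: nat, j, k)) ?D" "inj_on (\<lambda>(j, k). (j, 0 :: nat, k)) ?D"
    "inj_on (\<lambda>(j, k). (j, k, 0 :: nat)) ?D" by (auto simp: inj_on_def)
  ultimately show "card (residue_triples q 0 A B) + (A + B + 1) ^ 2 = (q + 1) ^ 2"
    and "card (residue_triples q A 0 B) + (A + B + 1) ^ 2 = (q + 1) ^ 2"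
    and "card (residue_triples q A B 0) + (A + B + 1) ^ 2 = (q + 1) ^ 2"
    using card_square_diff[OF T(2)] unfolding T_def[symmetric] by (simp_all only: card_image)
qed

text \<open>Two residues are forced to be 0, while an exceptional triple has two residues equal to
  \<open>T > 0\<close>.\<close>

lemma card_residue_triples_1:
  assumes "T > 0"
  shows "card (residue_triples q 0 0 T) = q - T"
    and "card (residue_triples q 0 T 0) = q - T"
    and "card (residue_triples q T 0 0) = q - T"
proof -
  have "residue_triples q 0 0 T = (\<lambda>k. (0, 0, k)) ` {T<..q}"
    using assms unfolding residue_triples_def gap_residues_def by auto
  moreover have "residue_triples q 0 T 0 = (\<lambda>k. (0, k, 0)) ` {T<..q}"
    using assms unfolding residue_triples_def gap_residues_def by auto
  moreover have "residue_triples q T 0 0 = (\<lambda>k. (k, 0, 0)) ` {T<..q}"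
    using assms unfolding residue_triples_def gap_residues_def by auto
  ultimately show "card (residue_triples q 0 0 T) = q - T"
    and "card (residue_triples q 0 T 0) = q - T"
    and "card (residue_triples q T 0 0) = q - T"
    by (simp_all add: card_image inj_on_def)
qed

lemma row_sum:
  fixes g :: "nat \<Rightarrow> real"
  assumes "M > 0" "g 0 = u" "g M = u" "\<And>B. 0 < B \<Longrightarrow> B < M \<Longrightarrow> g B = v"
  shows "(\<Sum>B\<le>M. g B) = 2 * u + (real M - 1) * v"
proof -
  have eq: "{..M} = {0, M} \<union> {0<..<M}" using assms(1) by auto
  have "(\<Sum>B\<le>M. g B) = (\<Sum>B\<in>{0, M}. g B) + (\<Sum>B\<in>{0<..<M}. g B)"
    unfolding eq by (rule sum.union_disjoint) auto
  also have "(\<Sum>B\<in>{0<..<M}. g B) = (\<Sum>B\<in>{0<..<M}. v)"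
    by (rule sum.cong) (use assms(4) in auto)
  finally show ?thesis using assms(1-3) by (simp add: of_nat_diff)
qed

text \<open>Among the ordered decompositions of \<open>T\<close> into three summands, 3 have two
  zeros, \<open>3 * (T - 1)\<close> one zero and \<open>(T - 1) * (T - 2) / 2\<close> none.\<close>

lemma level_sum:
  assumes T: "T > 0" "T \<le> q"
  shows "(\<Sum>A\<le>T. \<Sum>B\<le>T - A. real (card (residue_triples q A B (T - A - B)))) =
    3 * (real q - real T) + 3 * (real T - 1) * ((real q + 1) ^ 2 - (real T + 1) ^ 2) +
    (real T - 1) * (real T - 2) / 2 * ((real q + 1) ^ 3 + 3 - (real T + 1) ^ 3)"
    (is "(\<Sum>A\<le>T. ?r A) = _")
proof -
  define u1 u2 u3 where "u1 = real q - real T" and "u2 = (real q + 1) ^ 2 - (real T + 1) ^ 2"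
    and "u3 = (real q + 1) ^ 3 + 3 - (real T + 1) ^ 3"
  have g3: "real (card (residue_triples q A B C)) = u3" if "A > 0" "B > 0" "C > 0" "A + B + C = T" for A B C
  proof -
    have "card (residue_triples q A B C) + (T + 1) ^ 3 = (q + 1) ^ 3 + 3"
      using card_residue_triples_3[of A B C q] that T by (simp only: that(4))
    from arg_cong[OF this, of real] show ?thesis by (simp add: u3_def add.commute)
  qed
  have g2: "real (card (residue_triples q 0 A B)) = u2" "real (card (residue_triples q A 0 B)) = u2"
    "real (card (residue_triples q A B 0)) = u2" if "A > 0" "B > 0" "A + B = T" for A B
  proof -
    have *: "real c = u2" if "c + (T + 1) ^ 2 = (q + 1) ^ 2" for c
      using arg_cong[OF that, of real] by (simp add: u2_def add.commute)
    show "real (card (residue_triples q 0 A B)) = u2" "real (card (residue_triples q A 0 B)) = u2"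
      "real (card (residue_triples q A B 0)) = u2"
      using card_residue_triples_2[of A B q] that T by (simp_all only: that(3) *)
  qed
  have r0: "?r 0 = 2 * u1 + (real T - 1) * u2"
    unfolding minus_nat.diff_0
    by (rule row_sum) (use T in \<open>auto simp: card_residue_triples_1 u1_def of_nat_diff g2\<close>)
  have rT: "?r T = u1" using T by (simp add: card_residue_triples_1 u1_def of_nat_diff)
  have rA: "?r A = 2 * u2 + (real (T - A) - 1) * u3" if "0 < A" "A < T" for A
    by (rule row_sum) (use that in \<open>auto simp: g2 g3\<close>)
  have eq: "{..T} = {0, T} \<union> {0<..<T}" using T by auto
  have "(\<Sum>A\<le>T. ?r A) = (\<Sum>A\<in>{0, T}. ?r A) + (\<Sum>A\<in>{0<..<T}. ?r A)"
    unfolding eq by (rule sum.union_disjoint) auto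
  also have "(\<Sum>A\<in>{0, T}. ?r A) = ?r 0 + ?r T" using T by simp
  also have "(\<Sum>A\<in>{0<..<T}. ?r A) = (\<Sum>A\<in>{0<..<T}. 2 * u2 + (real (T - A) - 1) * u3)"
    by (rule sum.cong) (use rA in auto)
  also have "\<dots> = (real T - 1) * (2 * u2) + (\<Sum>A\<in>{0<..<T}. real (T - A) - 1) * u3"
    using T by (simp add: sum.distrib sum_distrib_right of_nat_diff)
  also have "(\<Sum>A\<in>{0<..<T}. real (T - A) - 1) = (\<Sum>A\<in>{0<..<T}. real A - 1)"
    by (rule sum.reindex_bij_witness[of _ "\<lambda>A. T - A" "\<lambda>A. T - A"]) auto
  also have "\<dots> = (real T - 1) * (real T - 2) / 2"
    using T(1)
  proof (induction T rule: nat_induct_non_zero)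
    case (Suc m)
    have "{0<..<Suc m} = insert m {0<..<m}" using Suc.hyps by auto
    then show ?case using Suc.IH by (simp add: field_simps)
  qed simp
  finally show ?thesis unfolding r0 rT by (simp add: u1_def u2_def u3_def algebra_simps)
qed

text \<open>\<open>Q\<close>, \<open>P\<close> and \<open>W\<close> stay free because the induction
  runs over the upper limit; afterwards they become \<open>q\<close>, \<open>(q + 1) ^ 2\<close> and
  \<open>(q + 1) ^ 3 + 3\<close>. The sum of fifth powers has denominator 12 and enters halved,
  hence the factor 24.\<close>

lemma level_sums_total:
  fixes Q P W :: real
  shows "24 * (\<Sum>T = 1..m. 3 * (Q - real T) + 3 * (real T - 1) * (P - (real T + 1) ^ 2) +
      (real T - 1) * (real T - 2) / 2 * (W - (real T + 1) ^ 3)) =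
    m * (72 * Q - 72 * P + 48 + 24 * W) + m * (real m + 1) * (36 * P - 18 * W - 18) +
    m * (real m + 1) * (2 * real m + 1) * (2 * W - 8) - 6 * (m * (real m + 1)) ^ 2 -
    (m * (real m + 1)) ^ 2 * (2 * real m ^ 2 + 2 * real m - 1)"
  (is "24 * (\<Sum>T = 1..m. ?f T) = ?r m")
proof (induction m)
  case (Suc m)
  have "24 * (\<Sum>T = 1..Suc m. ?f T) = 24 * (\<Sum>T = 1..m. ?f T) + 24 * ?f (Suc m)"
    by (simp only: sum.cl_ivl_Suc distrib_left) simp
  also have "\<dots> = ?r m + 24 * ?f (Suc m)" by (simp only: Suc)
  also have "\<dots> = ?r (Suc m)"
    by (simp add: field_simps power2_eq_square power3_eq_cube)
  finally show ?case .
qed simp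

theorem card_gaps:
  fixes q :: nat
  defines "gaps \<equiv> {(a, b, c). \<not> (pole_attained (q + 1) a b c \<and> pole_attained (q + 1) b a c \<and> pole_attained (q + 1) c a b)}"
  shows "24 * real (card gaps) = 2 * real q ^ 6 - 6 * real q ^ 5 + 9 * real q ^ 4 + 12 * real q ^ 3 - 35 * real q ^ 2 + 18 * real q"
proof -
  define lev where "lev T = (\<Sum>A\<le>T. \<Sum>B\<le>T - A. real (card (residue_triples q A B (T - A - B))))" for T
  have "residue_triples q 0 0 0 = {}" by (auto simp: residue_triples_def gap_residues_def)
  then have l0: "lev 0 = 0" by (simp add: lev_def)
  have "real (card gaps) = (\<Sum>T\<le>q. lev T)"
    unfolding gaps_def gap_set_card(2) lev_def by simp
  also have "\<dots> = (\<Sum>T = 1..q. lev T)"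
    by (rule sum.mono_neutral_right) (auto simp: l0 not_less_eq_eq)
  also have "\<dots> = (\<Sum>T = 1..q. 3 * (real q - real T) + 3 * (real T - 1) * ((real q + 1) ^ 2 - (real T + 1) ^ 2) +
    (real T - 1) * (real T - 2) / 2 * ((real q + 1) ^ 3 + 3 - (real T + 1) ^ 3))"
    unfolding lev_def by (rule sum.cong, rule refl, rule level_sum) auto
  finally show ?thesis
    by (simp only: level_sums_total) (simp add: algebra_simps power2_eq_square power3_eq_cube power_numeral_reduce)
qed

section \<open>The gap set of a collinear triangle\<close>

lemma finite_field_power_card:
  fixes x :: "'a :: {field, finite}"
  shows "x ^ CARD('a) = x"
proof (cases "x = 0")
  case False
  define U where "U = UNIV - {0 :: 'a}"
  have card: "CARD('a) = Suc (card U)"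
    using card.remove[of "UNIV :: 'a set" 0] by (simp add: U_def)
  \<comment> \<open>Multiplication by \<open>x\<close> permutes the nonzero elements, so their
    product can be cancelled.\<close>
  have "x ^ card U * \<Prod>U = (\<Prod>y\<in>U. x * y)" by (simp add: prod.distrib)
  also have "\<dots> = \<Prod>U"
    using False by (intro prod.reindex_bij_witness[of _ "\<lambda>y. y / x" "\<lambda>y. x * y"]) (auto simp: U_def)
  finally have "x ^ card U = 1" by (simp add: U_def)
  then show ?thesis by (simp add: card)
qed (simp add: zero_power)

lemma hermitian_curve_over_finite_field:
  assumes "primepow q" "CARD('a :: {field, finite}) = q ^ 2"
  obtains e where "hermitian_curve_over q e (to_ac :: 'a \<Rightarrow> 'a alg_closure)"
proof -
  obtain p e where p: "prime p" "e > 0" "q = p ^ e" using assms(1) by (auto simp: primepow_def)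
  have pos: "CHAR('a) > 0" by (rule finite_imp_CHAR_pos) simp
  then have prime: "prime CHAR('a)" by (rule prime_CHAR_semidom)
  have "CHAR('a) dvd p ^ (2 * e)"
    using CHAR_dvd_CARD[where 'a = 'a] by (simp add: assms(2) p(3) power_mult[symmetric] mult.commute)
  then have "CHAR('a) dvd p" using prime prime_dvd_power by blast
  then have char: "CHAR('a) = p" using p(1) prime primes_dvd_imp_eq by blast
  have "hermitian_curve_over q e (to_ac :: 'a \<Rightarrow> 'a alg_closure)"
  proof unfold_locales
    show "prime CHAR('a alg_closure)" "q = CHAR('a alg_closure) ^ e" "e > 0"
      using prime p char by simp_all
    show "rhom (to_ac :: 'a \<Rightarrow> _)" by (rule rhom_to_ac)
    fix x :: 'a
    show "to_ac x = 0 \<Longrightarrow> x = 0" by simp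
    have "(x ^ q) ^ q = x" using finite_field_power_card[of x]
      by (simp add: assms(2) power2_eq_square power_mult)
    then show "(to_ac x ^ q) ^ q = to_ac x" by (metis to_ac_power)
  next
    show "finite (UNIV :: 'a set)" by simp
    have "q \<ge> 2" using p prime_ge_2_nat[OF p(1)] self_le_power[of p e] by simp
    then have "2 ^ 2 \<le> q ^ 2" by (rule power_mono) simp
    then show "CARD('a) \<ge> 4" by (simp add: assms(2))
  qed
  then show ?thesis by (rule that)
qed

lemma geom_hermitian: "geom (hermitian q) = hermitian q"
  by (simp add: hermitian_def rhom_simps[OF rhom_map_poly3[OF rhom_to_ac]] map_poly3_var[OF rhom_to_ac])

text \<open>Normalizing divides by \<open>z\<close>, which keeps the coordinates in the base
  field.\<close>

lemma rational_points_normalized: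
  fixes P :: "'a :: field alg_closure proj_pt"
  assumes hr: "hermitian_curve_over q e (to_ac :: 'a \<Rightarrow> 'a alg_closure)" and P: "P \<in> rational_points (hermitian q)"
  obtains s where "s \<in> hermitian_curve_over.rational_representatives q (to_ac :: 'a \<Rightarrow> _)" "P = proj_point s"
proof -
  interpret hermitian_curve_over q e "TYPE('a alg_closure)" to_ac by (rule hr)
  obtain x y z where xyz: "P \<in> curve_points F" "P = proj_point (to_ac x, to_ac y, to_ac z)"
    using P by (auto simp: rational_points_def geom_hermitian)
  note aux = curve_points_aux[OF xyz(1)[unfolded xyz(2)]]
  show ?thesis
  proof (cases "z = 0")
    case True
    have "(to_ac 0, to_ac 1, to_ac 0) \<in> rational_representatives" unfolding rational_representatives_def by (auto simp: points_def)
    then have "(0, 1, 0) \<in> rational_representatives" by simp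
    moreover have "to_ac z = 0" using True by simp
    note aux[unfolded if_P[OF this]]
    then have "P = proj_point (0, 1, 0)" by (elim conjE) (rule trans[OF xyz(2)])
    ultimately show ?thesis by (rule that)
  next
    case False
    then have "to_ac z \<noteq> 0" by simp
    note n = aux[unfolded if_not_P[OF this]]
    have aux': "(to_ac x / to_ac z, to_ac y / to_ac z, 1) \<in> points"
      "P = proj_point (to_ac x / to_ac z, to_ac y / to_ac z, 1)"
      by (rule conjunct1[OF n], rule trans[OF xyz(2) conjunct2[OF n]])
    then have "(to_ac (x / z), to_ac (y / z), to_ac 1) \<in> points" by simp
    then have "(to_ac (x / z), to_ac (y / z), to_ac 1) \<in> rational_representatives" unfolding rational_representatives_def by blast
    then have "(to_ac x / to_ac z, to_ac y / to_ac z, 1) \<in> rational_representatives" by simp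
    then show ?thesis using aux'(2) by (rule that)
  qed
qed

lemma weierstrass_semigroup_iff:
  fixes p1 p2 p3 :: "'a :: field alg_closure \<times> 'a alg_closure \<times> 'a alg_closure"
  assumes hr: "hermitian_curve_over q e (to_ac :: 'a \<Rightarrow> 'a alg_closure)"
    and l: "hermitian_curve_over.on_line q (to_ac :: 'a \<Rightarrow> _) w p1 p2 p3"
  shows "(a, b, c) \<in> weierstrass_semigroup (hermitian q :: 'a poly3) (proj_point p1) (proj_point p2) (proj_point p3)
    \<longleftrightarrow> pole_attained (q + 1) a b c \<and> pole_attained (q + 1) b a c \<and> pole_attained (q + 1) c a b"
proof -
  interpret hermitian_curve_over q e "TYPE('a alg_closure)" to_ac by (rule hr)
  have pts: "p1 \<in> points" "p2 \<in> points" "p3 \<in> points" and ne: "p1 \<noteq> p2" "p1 \<noteq> p3" "p2 \<noteq> p3"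
    using l rational_representatives_points by (auto simp: on_line_def)
  define D :: "'a alg_closure divisor" where
    "D = (\<lambda>S. a * point_divisor (proj_point p1) S + b * point_divisor (proj_point p2) S + c * point_divisor (proj_point p3) S)"
  have D: "D (proj_point s) = pole_bound p1 p2 p3 a b c s" if "s \<in> points" for s
  proof -
    have "proj_point s = proj_point t \<longleftrightarrow> s = t" if "t \<in> points" for t
      using points_inj[OF \<open>s \<in> points\<close> that] by auto
    then show ?thesis using pts ne by (auto simp: D_def point_divisor_def pole_bound_def)
  qed
  have D0: "D S = 0" if "S \<notin> curve_points F" for S
    using that points_curve[OF pts(1)] points_curve[OF pts(2)] points_curve[OF pts(3)]
    by (auto simp: D_def point_divisor_def)
  have pd: "D = pole_divisor F (frac_class F r) \<longleftrightarrow> (\<forall>s\<in>points. nat (- fls_subdegree (val s r)) = pole_bound p1 p2 p3 a b c s)"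
    if r: "r \<in> fractions F" for r
  proof -
    have po: "pole_divisor F (frac_class F r) (proj_point s) = nat (- fls_subdegree (val s r))" if "s \<in> points" for s
      using points_curve[OF that] pole_order_eq[OF that frac_class_carrier[OF r]] Val_frac_class[OF that r]
      by (simp add: pole_divisor_def)
    \<comment> \<open>Both divisors vanish off the curve, so they are compared at the normalized
      representatives only.\<close>
    have "D = pole_divisor F (frac_class F r) \<longleftrightarrow> (\<forall>S\<in>curve_points F. D S = pole_divisor F (frac_class F r) S)"
      using D0 by (auto simp: fun_eq_iff pole_divisor_def)
    also have "\<dots> \<longleftrightarrow> (\<forall>s\<in>points. D (proj_point s) = pole_divisor F (frac_class F r) (proj_point s))"
      using curve_points points_curve by blast
    also have "\<dots> \<longleftrightarrow> (\<forall>s\<in>points. nat (- fls_subdegree (val s r)) = pole_bound p1 p2 p3 a b c s)"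
      using D po by (auto simp: eq_commute)
    finally show ?thesis .
  qed
  have "rational_functions (hermitian q :: 'a poly3) = frac_class F ` rational_fractions"
    by (auto simp: rational_functions_def geom_hermitian rational_fractions_def over_base_def)
  then have "(a, b, c) \<in> weierstrass_semigroup (hermitian q :: 'a poly3) (proj_point p1) (proj_point p2) (proj_point p3)
      \<longleftrightarrow> (\<exists>r\<in>rational_fractions. D = pole_divisor F (frac_class F r))"
    by (simp add: weierstrass_semigroup_def geom_hermitian D_def)
  also have "\<dots> \<longleftrightarrow> (\<exists>r\<in>rational_fractions. \<forall>s\<in>points. nat (- fls_subdegree (val s r)) = pole_bound p1 p2 p3 a b c s)"
    by (intro bex_cong refl pd) (auto simp: rational_fractions_def)
  finally show ?thesis using semigroup_criterion[OF l] by simp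
qed

theorem proposition15:
  fixes q :: nat
    and P Q R :: "'a :: {field, finite} alg_closure proj_pt"
  assumes "primepow q"
    and "CARD('a) = q ^ 2"
    and "P \<in> rational_points (hermitian q)"
    and "Q \<in> rational_points (hermitian q)"
    and "R \<in> rational_points (hermitian q)"
    and "P \<noteq> Q" and "P \<noteq> R" and "Q \<noteq> R"
    and "collinear_points {P, Q, R}"
  shows "finite (weierstrass_gaps (hermitian q :: 'a poly3) P Q R) \<and>
    real (card (weierstrass_gaps (hermitian q :: 'a poly3) P Q R)) =
      1 / 24 * (2 * real q ^ 6 - 6 * real q ^ 5 + 9 * real q ^ 4
                + 12 * real q ^ 3 - 35 * real q ^ 2 + 18 * real q)"
proof -
  obtain e where hr: "hermitian_curve_over q e (to_ac :: 'a \<Rightarrow> 'a alg_closure)"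
    by (rule hermitian_curve_over_finite_field[OF assms(1,2)])
  interpret hermitian_curve_over q e "TYPE('a alg_closure)" to_ac by (rule hr)
  obtain p1 where p1: "p1 \<in> rational_representatives" "P = proj_point p1" by (rule rational_points_normalized[OF hr assms(3)])
  obtain p2 where p2: "p2 \<in> rational_representatives" "Q = proj_point p2" by (rule rational_points_normalized[OF hr assms(4)])
  obtain p3 where p3: "p3 \<in> rational_representatives" "R = proj_point p3" by (rule rational_points_normalized[OF hr assms(5)])
  obtain \<alpha> \<beta> \<gamma> where line: "(\<alpha>, \<beta>, \<gamma>) \<noteq> (0, 0, 0)"
    "\<forall>S\<in>{P, Q, R}. \<forall>(x, y, z)\<in>S. \<alpha> * x + \<beta> * y + \<gamma> * z = 0"
    using assms(9) unfolding collinear_points_def by (elim exE conjE) (rule that)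
  have mem: "\<exists>S\<in>{P, Q, R}. v \<in> S" if "v \<in> {p1, p2, p3}" for v
    using that proj_point_self[of v] by (auto simp: p1(2) p2(2) p3(2))
  have on: "\<alpha> * x + \<beta> * y + \<gamma> * z = 0" if "(x, y, z) \<in> {p1, p2, p3}" for x y z
    using mem[OF that] line(2) by fastforce
  have "p1 \<noteq> p2" "p1 \<noteq> p3" "p2 \<noteq> p3"
    using assms(6-8) by (auto simp only: p1(2) p2(2) p3(2))
  have "\<exists>w. on_line w p1 p2 p3"
    by (rule line_exists[OF p1(1) p2(1) p3(1) \<open>p1 \<noteq> p2\<close> \<open>p1 \<noteq> p3\<close> \<open>p2 \<noteq> p3\<close> line(1)], rule on)
  then obtain w where l: "on_line w p1 p2 p3" by (elim exE) (rule that)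
  have gaps: "weierstrass_gaps (hermitian q :: 'a poly3) P Q R =
    {(a, b, c). \<not> (pole_attained (q + 1) a b c \<and> pole_attained (q + 1) b a c \<and> pole_attained (q + 1) c a b)}"
    unfolding weierstrass_gaps_def p1(2) p2(2) p3(2)
    by (auto simp only: weierstrass_semigroup_iff[OF hr l] Diff_iff UNIV_I mem_Collect_eq prod.case)
  show ?thesis
    unfolding gaps using gap_set_card(1)[of q] card_gaps[of q] by simp
qed

end
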